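(* (i) The sheaf $\lambda_I(M_0)$ is the sheaf of sections of the holomorphic vector bundle over $\mathbf{E}_q$ associated to the tamely irregular module $\underline{End}^{>0}(M_0)$. (ii) The filtration $(\lambda_I^t(M_0))_{t\ge0}$ of $\lambda_I(M_0)$ by levels of flatness is the decreasing filtration associated to the graduation inherited from $\underline{End}^{>0}(M_0)$; that is, $\lambda_I^t(M_0)=\bigoplus_{t'\ge t}\lambda_I^{(t')}(M_0)$, where $\lambda_I^{(t')}(M_0)$ is the sheaf of sections of the vector bundle associated to the pure module $\underline{End}^{(t')}(M_0)$.
   Context: Fix $q\in\mathbf{C}$ with $|q|>1$; $\sigma_q f(z)=f(qz)$, applied entrywise. $\mathbf{C}(\{z\})$ is the fraction field of the ring of convergent power series; $\mathbf{E}_q=\mathbf{C}^*/q^{\mathbf{Z}}$. For $A\in GL_n(\mathbf{C}(\{z\}))$, $(\mathbf{C}(\{z\})^n,\Phi_A)$ with $\Phi_A(X)=A^{-1}\sigma_qX$ is a $q$-difference module. Fix integers $\mu_1>\cdots>\mu_k$, $r_i\ge1$, $A_i\in GL_{r_i}(\mathbf{C})$, $n=\sum r_i$; $P_i=(\mathbf{C}(\{z\})^{r_i},\Phi_{z^{-\mu_i}A_i})$ is pure of slope $\mu_i$, and $M_0=P_1\oplus\cdots\oplus P_k=(\mathbf{C}(\{z\})^n,\Phi_{A_0})$ with $A_0$ block diagonal with blocks $z^{-\mu_i}A_i$. Tamely irregular modules (with integral slopes) are direct sums of pure modules of integral slopes. The vector bundle over $\mathbf{E}_q$ associated to a pure module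 $(\mathbf{C}(\{z\})^r,\Phi_{z^{-\mu}A})$, $A\in GL_r(\mathbf{C})$, is the quotient of $\mathbf{C}^*\times\mathbf{C}^r$ by the equivalence relation generated by $(z,X)\sim(qz,z^{-\mu}AX)$; the construction extends to direct sums. The internal Hom $\underline{Hom}(P_j,P_i)$ is the space of $r_i\times r_j$ matrices over $\mathbf{C}(\{z\})$ with $\Phi(X)=(z^{-\mu_i}A_i)^{-1}(\sigma_qX)(z^{-\mu_j}A_j)$; it is pure of slope $\mu_i-\mu_j$. $\underline{End}^{(t)}(M_0)=\bigoplus_{\mu_i-\mu_j=t}\underline{Hom}(P_j,P_i)$ and $\underline{End}^{>0}(M_0)=\bigoplus_{t>0}\underline{End}^{(t)}(M_0)$. Flatness. A sector is a germ at $0$ of a $q^{-\mathbf{N}}$-invariant open subset $W\subset\mathbf{C}^*$; its horizon is its image in $\mathbf{E}_q$. A function $f$ holomorphic on $W$ is flat if for every $m\in\mathbf{N}$, $z^{-m}f$ is bounded on $q^{-\mathbf{N}}K$ for every compact $K\subset W$. It is $t$-flat ($t\ge0$ real) if $f|\theta|^t$ has polynomial growth near $0$ on $q^{-\mathbf{N}}K$ for every compact $K\subset W$ (i.e. is $O(|z|^{-N})$ for some $N$), for one (hence any) $\theta=\theta_{q,c}$, where $\theta_{q,c}(z)=\sum_{m\in\mathbf{Z}}q^{-m(m+1)/2}(z/c)^m$. $\mathcal{A}_0$ is the sheaf on $\mathbf{E}_q$ whose sections over $V$ are (classes, under restriction to smaller sectors with the same horizon, of) flat functions on sectors with horizon $V$.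 $\lambda_I(M_0)$ is the sheaf on $\mathbf{E}_q$ whose sections over $V$ are the block strictly upper triangular matrices $f=(f_{i,j})$ (blocks $f_{i,j}$ of size $r_i\times r_j$, zero unless $i<j$) with entries in $\mathcal{A}_0(V)$ such that $(\sigma_qf)A_0=A_0f$. $\lambda_I^t(M_0)\subset\lambda_I(M_0)$ is the subsheaf of sections with $t$-flat entries. *)

theory Defs
  imports
    "HOL-Complex_Analysis.Complex_Analysis"
    "HOL-Algebra.Module"
    "Jordan_Normal_Form.Matrix"
    "Jordan_Normal_Form.Gauss_Jordan_Elimination"
begin

section \<open>The elliptic curve, its topology and its structure sheaf\<close>

text \<open>Points of \<open>E\<^sub>q = \<complex>\<^sup>* / q\<^sup>\<int>\<close> are \<open>q\<^sup>\<int>\<close>-orbits in \<open>\<complex>\<^sup>*\<close>;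
  \<open>qorbit q\<close> is the canonical projection.\<close>

definition qorbit :: "complex \<Rightarrow> complex \<Rightarrow> complex set" where
  "qorbit q z = range (\<lambda>k::int. q powi k * z)"

definition Ell :: "complex \<Rightarrow> complex set set" where
  "Ell q = qorbit q ` (- {0})"

definition Eq_preimage :: "complex \<Rightarrow> complex set set \<Rightarrow> complex set" where
  "Eq_preimage q V = {z. z \<noteq> 0 \<and> qorbit q z \<in> V}"

definition Eq_topology :: "complex \<Rightarrow> complex set topology" where
  "Eq_topology q = topology (\<lambda>V. V \<subseteq> Ell q \<and> open (Eq_preimage q V))"

lemma openin_Eq: "openin (Eq_topology q) V \<longleftrightarrow> V \<subseteq> Ell q \<and> open (Eq_preimage q V)"
proof -
  have "Eq_preimage q (S \<inter> T) = Eq_preimage q S \<inter> Eq_preimage q T" for S T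
    by (auto simp: Eq_preimage_def)
  moreover have "Eq_preimage q (\<Union>K) = (\<Union>S\<in>K. Eq_preimage q S)" for K
    by (auto simp: Eq_preimage_def)
  ultimately have "istopology (\<lambda>V. V \<subseteq> Ell q \<and> open (Eq_preimage q V))"
    unfolding istopology_def by auto
  then show ?thesis
    unfolding Eq_topology_def by (simp add: topology_inverse')
qed

definition Eq_hol :: "complex \<Rightarrow> complex set set \<Rightarrow> (complex set \<Rightarrow> complex) set" where
  "Eq_hol q V = {g \<in> extensional V. (\<lambda>z. g (qorbit q z)) holomorphic_on Eq_preimage q V}"

section \<open>Isomorphisms of sheaves of modules, internal direct sums\<close>

text \<open>A sheaf of \<open>\<O>\<close>-modules on \<open>E\<^sub>q\<close> is given by the modules of sections \<open>F V\<close> over the open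
  sets \<open>V\<close> and the restriction maps \<open>resF V V'\<close> from \<open>V\<close> to \<open>V' \<subseteq> V\<close>. The ring
  multiplication in the record type \<open>module\<close> is not used.\<close>

definition sheaf_module_iso ::
  "complex \<Rightarrow>
   (complex set set \<Rightarrow> (complex set \<Rightarrow> complex, 'a) module) \<Rightarrow>
   (complex set set \<Rightarrow> complex set set \<Rightarrow> 'a \<Rightarrow> 'a) \<Rightarrow>
   (complex set set \<Rightarrow> (complex set \<Rightarrow> complex, 'b) module) \<Rightarrow>
   (complex set set \<Rightarrow> complex set set \<Rightarrow> 'b \<Rightarrow> 'b) \<Rightarrow>
   (complex set set \<Rightarrow> 'a \<Rightarrow> 'b) \<Rightarrow> bool" where
  "sheaf_module_iso q F resF G resG \<phi> \<longleftrightarrow>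
     (\<forall>V. openin (Eq_topology q) V \<longrightarrow>
        bij_betw (\<phi> V) (carrier (F V)) (carrier (G V)) \<and>
        (\<forall>x\<in>carrier (F V). \<forall>y\<in>carrier (F V). \<phi> V (x \<oplus>\<^bsub>F V\<^esub> y) = \<phi> V x \<oplus>\<^bsub>G V\<^esub> \<phi> V y) \<and>
        (\<forall>g\<in>Eq_hol q V. \<forall>x\<in>carrier (F V). \<phi> V (g \<odot>\<^bsub>F V\<^esub> x) = g \<odot>\<^bsub>G V\<^esub> \<phi> V x)) \<and>
     (\<forall>V V'. openin (Eq_topology q) V \<and> openin (Eq_topology q) V' \<and> V' \<subseteq> V \<longrightarrow>
        (\<forall>x\<in>carrier (F V). \<phi> V' (resF V V' x) = resG V V' (\<phi> V x)))"

definition is_internal_direct_sum ::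
  "('b, 'm) ring_scheme \<Rightarrow> 't set \<Rightarrow> ('t \<Rightarrow> 'b set) \<Rightarrow> 'b set \<Rightarrow> bool" where
  "is_internal_direct_sum M T N S \<longleftrightarrow> bij_betw (\<lambda>x. finsum M x T) (\<Pi>\<^sub>E t\<in>T. N t) S"

section \<open>\<open>q\<close>-difference modules\<close>

text \<open>\<open>\<complex>({z})\<close>, the fraction field of the ring of convergent power series, is the field of
  convergent Laurent series.\<close>

definition conv_laurent :: "complex fls set" where
  "conv_laurent = {F. fls_conv_radius F > 0}"

definition qshift :: "complex \<Rightarrow> complex fls \<Rightarrow> complex fls" where
  "qshift q F = fls_compose_fps F (fps_const q * fps_X)"

abbreviation eval_mat :: "complex fls mat \<Rightarrow> complex \<Rightarrow> complex mat" where
  "eval_mat X z \<equiv> map_mat (\<lambda>F. eval_fls F z) X"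

abbreviation const_mat :: "complex mat \<Rightarrow> complex fls mat" where
  "const_mat \<equiv> map_mat fls_const"

definition mat_inv :: "'a::field mat \<Rightarrow> 'a mat" where
  "mat_inv A = the (mat_inverse A)"

text \<open>All modules below are spaces of matrices of a fixed format over \<open>\<complex>({z})\<close> (column vectors
  being matrices with one column), spanned by the constant matrices they contain.\<close>

record qmodule =
  nrows :: nat
  ncols :: nat
  elts :: "complex fls mat set"
  Phi :: "complex fls mat \<Rightarrow> complex fls mat"

definition conv_mats :: "nat \<Rightarrow> nat \<Rightarrow> complex fls mat set" where
  "conv_mats m n = {X \<in> carrier_mat m n. \<forall>a<m. \<forall>b<n. X $$ (a, b) \<in> conv_laurent}"

definition std_qmodule :: "complex \<Rightarrow> complex fls mat \<Rightarrow> qmodule" where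
  "std_qmodule q A = \<lparr>nrows = dim_row A, ncols = 1, elts = conv_mats (dim_row A) 1,
     Phi = (\<lambda>X. mat_inv A * map_mat (qshift q) X)\<rparr>"

text \<open>The internal Hom from \<open>std_qmodule q A\<close> to \<open>std_qmodule q B\<close>.\<close>

definition hom_qmodule :: "complex \<Rightarrow> complex fls mat \<Rightarrow> complex fls mat \<Rightarrow> qmodule" where
  "hom_qmodule q A B = \<lparr>nrows = dim_row B, ncols = dim_row A,
     elts = conv_mats (dim_row B) (dim_row A),
     Phi = (\<lambda>X. mat_inv B * map_mat (qshift q) X * A)\<rparr>"

section \<open>The module \<open>M\<^sub>0\<close> and its internal endomorphisms\<close>

text \<open>\<open>M\<^sub>0 = P\<^sub>1 \<oplus> \<dots> \<oplus> P\<^sub>k\<close> is given by the list \<open>P\<close> of the pairs \<open>(\<mu>\<^sub>i, A\<^sub>i)\<close>;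
  indices start at \<open>0\<close>.\<close>

type_synonym pure_data = "(int \<times> complex mat) list"

definition slope :: "pure_data \<Rightarrow> nat \<Rightarrow> int" where
  "slope P i = fst (P ! i)"

definition rk :: "pure_data \<Rightarrow> nat \<Rightarrow> nat" where
  "rk P i = dim_row (snd (P ! i))"

definition offset :: "pure_data \<Rightarrow> nat \<Rightarrow> nat" where
  "offset P i = (\<Sum>l<i. rk P l)"

definition total_rk :: "pure_data \<Rightarrow> nat" where
  "total_rk P = offset P (length P)"

definition pure_mat :: "int \<times> complex mat \<Rightarrow> complex fls mat" where
  "pure_mat p = fls_X_intpow (- fst p) \<cdot>\<^sub>m const_mat (snd p)"

definition A0 :: "pure_data \<Rightarrow> complex fls mat" where
  "A0 P = diag_block_mat (map pure_mat P)"

definition block :: "pure_data \<Rightarrow> nat \<Rightarrow> nat \<Rightarrow> 'a mat \<Rightarrow> 'a mat" where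
  "block P i j X = mat (rk P i) (rk P j) (\<lambda>(a, b). X $$ (offset P i + a, offset P j + b))"

definition block_index :: "pure_data \<Rightarrow> nat \<Rightarrow> nat" where
  "block_index P a = (LEAST i. a < offset P (Suc i))"

definition from_blocks :: "pure_data \<Rightarrow> (nat \<Rightarrow> nat \<Rightarrow> 'a mat) \<Rightarrow> 'a mat" where
  "from_blocks P F = mat (total_rk P) (total_rk P) (\<lambda>(a, b).
     let i = block_index P a; j = block_index P b
     in F i j $$ (a - offset P i, b - offset P j))"

definition supported_on :: "pure_data \<Rightarrow> (nat \<times> nat) set \<Rightarrow> 'a::zero mat \<Rightarrow> bool" where
  "supported_on P S X \<longleftrightarrow>
     (\<forall>i<length P. \<forall>j<length P. (i, j) \<notin> S \<longrightarrow> block P i j X = 0\<^sub>m (rk P i) (rk P j))"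

text \<open>The direct sum of the internal Homs from \<open>P\<^sub>j\<close> to \<open>P\<^sub>i\<close> over \<open>(i, j) \<in> S\<close>; a family
  of blocks is written as a block matrix.\<close>

definition hom_sum :: "complex \<Rightarrow> pure_data \<Rightarrow> (nat \<times> nat) set \<Rightarrow> qmodule" where
  "hom_sum q P S = \<lparr>nrows = total_rk P, ncols = total_rk P,
     elts = {X \<in> conv_mats (total_rk P) (total_rk P). supported_on P S X},
     Phi = (\<lambda>X. from_blocks P (\<lambda>i j.
       Phi (hom_qmodule q (pure_mat (P ! j)) (pure_mat (P ! i))) (block P i j X)))\<rparr>"

definition End_slope :: "complex \<Rightarrow> pure_data \<Rightarrow> int \<Rightarrow> qmodule" where
  "End_slope q P t = hom_sum q P {(i, j). slope P i - slope P j = t}"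

definition End_pos :: "complex \<Rightarrow> pure_data \<Rightarrow> qmodule" where
  "End_pos q P = hom_sum q P {(i, j). slope P i - slope P j > 0}"

definition pos_levels :: "pure_data \<Rightarrow> int set" where
  "pos_levels P = {slope P i - slope P j | i j.
     i < length P \<and> j < length P \<and> slope P i - slope P j > 0}"

section \<open>The vector bundle associated to a module\<close>

definition fibre :: "qmodule \<Rightarrow> complex mat set" where
  "fibre M = {Y. const_mat Y \<in> elts M}"

text \<open>If \<open>\<Phi>(X) = A\<^sup>-\<^sup>1 \<sigma>\<^sub>q X\<close>, then \<open>\<Phi>(Y) = A\<^sup>-\<^sup>1 Y\<close> for a constant \<open>Y\<close>, so the pairs below are
  the pairs \<open>((z, X), (q z, A(z) X))\<close>; see the lemma
  \<open>bundle_step_std_qmodule\<close>. Here \<open>\<Phi>(Y)\<close> is a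
  Laurent polynomial for the tamely irregular modules in question, so that it can be
  evaluated at each point of \<open>\<complex>\<^sup>*\<close>. Stating this through \<open>\<Phi>\<close> covers internal Homs and direct
  sums without choosing an ordering of their bases.\<close>

definition bundle_step ::
  "complex \<Rightarrow> qmodule \<Rightarrow> ((complex \<times> complex mat) \<times> (complex \<times> complex mat)) set" where
  "bundle_step q M = {((z, X), (q * z, Y)) | z X Y.
     z \<noteq> 0 \<and> X \<in> fibre M \<and> Y \<in> fibre M \<and> X = eval_mat (Phi M (const_mat Y)) z}"

lemma smult_smult_mat:
  fixes A :: "'a::semiring_1 mat"
  shows "a \<cdot>\<^sub>m (b \<cdot>\<^sub>m A) = (a * b) \<cdot>\<^sub>m A" "1 \<cdot>\<^sub>m A = A"
  by (auto intro!: eq_matI simp: mult.assoc)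

lemma mat_inv_props:
  fixes A :: "'a::field mat"
  assumes A: "A \<in> carrier_mat r r" and inv: "invertible_mat A"
  shows "mat_inv A \<in> carrier_mat r r" "A * mat_inv A = 1\<^sub>m r" "mat_inv A * A = 1\<^sub>m r"
proof -
  obtain B where B: "A * B = 1\<^sub>m r" "B * A = 1\<^sub>m (dim_row B)"
    using inv A unfolding invertible_mat_def inverts_mat_def by auto
  have "B \<in> carrier_mat r r"
    using B A by (metis carrier_matD carrier_matI index_mult_mat(2,3) index_one_mat(2,3))
  then have "A \<in> Units (ring_mat TYPE('a) r ())"
    using A B unfolding Units_def ring_mat_def by auto
  then obtain C where "mat_inverse A = Some C"
    using mat_inverse(1)[OF A, of "()"] by (cases "mat_inverse A") auto
  with mat_inverse(2)[OF A this]
  show "mat_inv A \<in> carrier_mat r r" "A * mat_inv A = 1\<^sub>m r" "mat_inv A * A = 1\<^sub>m r"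
    unfolding mat_inv_def by auto
qed

lemma mat_inv_unique:
  fixes A :: "'a::field mat"
  assumes A: "A \<in> carrier_mat r r" and B: "B \<in> carrier_mat r r"
    and AB: "A * B = 1\<^sub>m r" and BA: "B * A = 1\<^sub>m r"
  shows "mat_inv A = B"
proof -
  have "invertible_mat A"
    unfolding invertible_mat_def inverts_mat_def using assms by auto
  note p = mat_inv_props[OF A this]
  have "mat_inv A = mat_inv A * (A * B)" using p AB by simp
  also have "\<dots> = (mat_inv A * A) * B" using assoc_mult_mat[OF p(1) A B] by simp
  also have "\<dots> = B" using p B by simp
  finally show ?thesis .
qed

lemma const_mat_mult:
  assumes "A \<in> carrier_mat m n" "B \<in> carrier_mat n p"
  shows "const_mat (A * B) = const_mat A * const_mat B"
proof -
  interpret semiring_hom "fls_const :: complex \<Rightarrow> complex fls"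
    by unfold_locales (auto simp: fls_plus_const fls_const_mult_const)
  show ?thesis using assms by (rule mat_hom_mult)
qed

lemma const_mat_one: "const_mat (1\<^sub>m n) = 1\<^sub>m n"
  by (rule eq_matI) auto

lemma pure_mat_carrier: "A \<in> carrier_mat r r \<Longrightarrow> pure_mat (\<mu>, A) \<in> carrier_mat r r"
  by (auto simp: pure_mat_def)

lemma mat_inv_pure_mat:
  assumes A: "A \<in> carrier_mat r r" and inv: "invertible_mat A"
  shows "mat_inv (pure_mat (\<mu>, A)) = pure_mat (- \<mu>, mat_inv A)"
proof (rule mat_inv_unique[where r = r])
  note p = mat_inv_props[OF A inv]
  show "pure_mat (\<mu>, A) \<in> carrier_mat r r" "pure_mat (- \<mu>, mat_inv A) \<in> carrier_mat r r"
    using A p by (auto intro: pure_mat_carrier)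
  have X: "fls_X_intpow \<mu> * fls_X_intpow (- \<mu>) = (1 :: complex fls)"
    "fls_X_intpow (- \<mu>) * fls_X_intpow \<mu> = (1 :: complex fls)"
    by (simp_all add: fls_X_intpow_times_conv_shift)
  have c: "const_mat A \<in> carrier_mat r r" "const_mat (mat_inv A) \<in> carrier_mat r r"
    using A p by auto
  have "const_mat A * const_mat (mat_inv A) = 1\<^sub>m r"
    using const_mat_mult[OF A p(1)] p(2) const_mat_one by metis
  then show "pure_mat (\<mu>, A) * pure_mat (- \<mu>, mat_inv A) = 1\<^sub>m r"
    using c X unfolding pure_mat_def
    by (simp add: mult_smult_assoc_mat[of _ r r] mult_smult_distrib[of _ r r _ r] smult_smult_mat)
  have "const_mat (mat_inv A) * const_mat A = 1\<^sub>m r"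
    using const_mat_mult[OF p(1) A] p(3) const_mat_one by metis
  then show "pure_mat (- \<mu>, mat_inv A) * pure_mat (\<mu>, A) = 1\<^sub>m r"
    using c X unfolding pure_mat_def
    by (simp add: mult_smult_assoc_mat[of _ r r] mult_smult_distrib[of _ r r _ r] smult_smult_mat)
qed

lemma const_mat_in_conv_mats [simp]: "const_mat Y \<in> conv_mats m n \<longleftrightarrow> Y \<in> carrier_mat m n"
  by (auto simp: conv_mats_def conv_laurent_def)

lemma qshift_const_mat [simp]: "map_mat (qshift q) (const_mat Y) = const_mat Y"
  by (rule eq_matI) (auto simp: qshift_def)
lemma eval_mat_smult:
  assumes "z \<noteq> 0"
  shows "eval_mat (fls_X_intpow m \<cdot>\<^sub>m const_mat Y) z = z powi m \<cdot>\<^sub>m Y"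
  using assms by (intro eq_matI) (auto simp: fls_X_intpow_times_conv_shift eval_fls_shift)

lemma bundle_step_hom_qmodule:
  assumes A: "A \<in> carrier_mat r r" "invertible_mat A"
    and B: "B \<in> carrier_mat s s" "invertible_mat B"
  shows "bundle_step q (hom_qmodule q (pure_mat (\<mu>, A)) (pure_mat (\<nu>, B))) =
    {((z, X), (q * z, z powi (- (\<nu> - \<mu>)) \<cdot>\<^sub>m (B * X * mat_inv A))) | z X.
       z \<noteq> 0 \<and> X \<in> carrier_mat s r}"
proof -
  note a = mat_inv_props[OF A] and b = mat_inv_props[OF B]
  let ?M = "hom_qmodule q (pure_mat (\<mu>, A)) (pure_mat (\<nu>, B))"
  have dims: "dim_row (pure_mat (\<mu>, A)) = r" "dim_row (pure_mat (\<nu>, B)) = s"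
    using A B by (auto simp: pure_mat_def)
  have fib: "fibre ?M = carrier_mat s r"
    unfolding fibre_def hom_qmodule_def by (auto simp: dims)
  have ev: "eval_mat (Phi ?M (const_mat Y)) z = z powi (\<nu> - \<mu>) \<cdot>\<^sub>m (mat_inv B * Y * A)"
    if Y: "Y \<in> carrier_mat s r" and "z \<noteq> 0" for Y z
  proof -
    have X: "fls_X_intpow \<nu> * fls_X_intpow (- \<mu>) = (fls_X_intpow (\<nu> - \<mu>) :: complex fls)"
      by (simp add: fls_X_intpow_times_conv_shift)
    have c: "const_mat A \<in> carrier_mat r r" "const_mat (mat_inv B) \<in> carrier_mat s s"
      "const_mat Y \<in> carrier_mat s r"
      using A b Y by auto
    have m: "const_mat (mat_inv B) * const_mat Y * const_mat A = const_mat (mat_inv B * Y * A)"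
      using const_mat_mult[OF b(1) Y]
        const_mat_mult[OF mult_carrier_mat[OF b(1) Y] A(1)] by simp
    have c2: "const_mat (mat_inv B) * const_mat Y \<in> carrier_mat s r" using c by simp
    have "Phi ?M (const_mat Y) = pure_mat (- \<nu>, mat_inv B) * const_mat Y * pure_mat (\<mu>, A)"
      unfolding hom_qmodule_def using mat_inv_pure_mat[OF B] by simp
    also have "\<dots> = fls_X_intpow (\<nu> - \<mu>) \<cdot>\<^sub>m const_mat (mat_inv B * Y * A)"
      unfolding pure_mat_def m[symmetric] X[symmetric]
      using mult_smult_assoc_mat[OF c(2,3), of "fls_X_intpow \<nu>"]
        mult_smult_distrib[OF smult_carrier_mat[OF c2] c(1), of "fls_X_intpow \<nu>" "fls_X_intpow (-\<mu>)"]
        mult_smult_assoc_mat[OF c2 c(1), of "fls_X_intpow \<nu>"]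
      by (simp add: smult_smult_mat mult.commute[of "fls_shift \<mu> 1"])
    finally show ?thesis
      using \<open>z \<noteq> 0\<close> by (simp only: eval_mat_smult not_False_eq_True)
  qed
  have key: "X = z powi (\<nu> - \<mu>) \<cdot>\<^sub>m (mat_inv B * Y * A) \<longleftrightarrow>
      Y = z powi (- (\<nu> - \<mu>)) \<cdot>\<^sub>m (B * X * mat_inv A)"
    if z: "z \<noteq> 0" and X: "X \<in> carrier_mat s r" and Y: "Y \<in> carrier_mat s r" for X Y and z :: complex
  proof -
    have p: "z powi (\<nu> - \<mu>) * z powi (- (\<nu> - \<mu>)) = 1"
      using z power_int_add[of z "\<nu> - \<mu>" "- (\<nu> - \<mu>)"] by simp
    have 1: "B * (c \<cdot>\<^sub>m (mat_inv B * Y * A)) * mat_inv A = c \<cdot>\<^sub>m Y" for c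
    proof -
      have "B * (c \<cdot>\<^sub>m (mat_inv B * Y * A)) * mat_inv A =
          c \<cdot>\<^sub>m (B * (mat_inv B * Y * A) * mat_inv A)"
        using a b A B Y by (simp add: mult_smult_distrib[of _ s s _ r] mult_smult_assoc_mat[of _ s r _ r])
      also have "B * (mat_inv B * Y * A) * mat_inv A = (B * mat_inv B) * Y * (A * mat_inv A)"
        using a(1) b(1) A(1) B(1) Y by (simp add: assoc_mult_mat[where ?n\<^sub>1.0 = s]
           assoc_mult_mat[of _ s s _ r _ r] assoc_mult_mat[of _ s s _ s _ r] assoc_mult_mat[of _ s r _ r _ r])
      finally show ?thesis using a b Y by simp
    qed
    have 2: "mat_inv B * (c \<cdot>\<^sub>m (B * X * mat_inv A)) * A = c \<cdot>\<^sub>m X" for c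
    proof -
      have "mat_inv B * (c \<cdot>\<^sub>m (B * X * mat_inv A)) * A =
          c \<cdot>\<^sub>m (mat_inv B * (B * X * mat_inv A) * A)"
        using a b A B X by (simp add: mult_smult_distrib[of _ s s _ r] mult_smult_assoc_mat[of _ s r _ r])
      also have "mat_inv B * (B * X * mat_inv A) * A = (mat_inv B * B) * X * (mat_inv A * A)"
        using a(1) b(1) A(1) B(1) X by (simp add: assoc_mult_mat[where ?n\<^sub>1.0 = s]
           assoc_mult_mat[of _ s s _ r _ r] assoc_mult_mat[of _ s s _ s _ r] assoc_mult_mat[of _ s r _ r _ r])
      finally show ?thesis using a b X by simp
    qed
    show ?thesis
    proof
      assume "X = z powi (\<nu> - \<mu>) \<cdot>\<^sub>m (mat_inv B * Y * A)"
      then have "B * X * mat_inv A = z powi (\<nu> - \<mu>) \<cdot>\<^sub>m Y" using 1 by simp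
      then show "Y = z powi (- (\<nu> - \<mu>)) \<cdot>\<^sub>m (B * X * mat_inv A)"
        using p by (simp add: smult_smult_mat mult.commute)
    next
      assume "Y = z powi (- (\<nu> - \<mu>)) \<cdot>\<^sub>m (B * X * mat_inv A)"
      then have "mat_inv B * Y * A = z powi (- (\<nu> - \<mu>)) \<cdot>\<^sub>m X" using 2 by simp
      then show "X = z powi (\<nu> - \<mu>) \<cdot>\<^sub>m (mat_inv B * Y * A)"
        using p by (simp add: smult_smult_mat)
    qed
  qed
  have car: "z powi m \<cdot>\<^sub>m (B * X * mat_inv A) \<in> carrier_mat s r" if "X \<in> carrier_mat s r" for X m and z :: complex
    using that a B by auto
  have "bundle_step q ?M = {((z, X), (q * z, Y)) | z X Y.
      z \<noteq> 0 \<and> X \<in> carrier_mat s r \<and> Y \<in> carrier_mat s r \<and>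
      Y = z powi (- (\<nu> - \<mu>)) \<cdot>\<^sub>m (B * X * mat_inv A)}"
    unfolding bundle_step_def fib using ev key by (smt (verit, best) Collect_cong)
  also have "\<dots> = {((z, X), (q * z, z powi (- (\<nu> - \<mu>)) \<cdot>\<^sub>m (B * X * mat_inv A))) | z X.
      z \<noteq> 0 \<and> X \<in> carrier_mat s r}"
    using car by blast
  finally show ?thesis .
qed

lemma bundle_step_std_qmodule:
  assumes A: "A \<in> carrier_mat r r" "invertible_mat A"
  shows "bundle_step q (std_qmodule q (pure_mat (\<mu>, A))) =
    {((z, X), (q * z, z powi (- \<mu>) \<cdot>\<^sub>m (A * X))) | z X. z \<noteq> 0 \<and> X \<in> carrier_mat r 1}"
proof -
  have one: "pure_mat (0, 1\<^sub>m 1) = 1\<^sub>m 1" "mat_inv (1\<^sub>m 1 :: complex mat) = 1\<^sub>m 1"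
    by (simp_all add: pure_mat_def const_mat_one mat_inv_unique[of _ 1] smult_smult_mat)
  note one_Suc = one(1)[unfolded One_nat_def]
  have d: "dim_row (pure_mat (\<mu>, A)) = r" using A by (simp add: pure_mat_def)
  have c: "Phi (std_qmodule q (pure_mat (\<mu>, A))) (const_mat Y) =
      Phi (hom_qmodule q (pure_mat (0, 1\<^sub>m 1)) (pure_mat (\<mu>, A))) (const_mat Y)"
    if "Y \<in> carrier_mat r 1" for Y
  proof -
    have "mat_inv (pure_mat (\<mu>, A)) * const_mat Y \<in> carrier_mat r 1"
      using that mat_inv_pure_mat[OF A] mult_carrier_mat[OF pure_mat_carrier[OF mat_inv_props(1)[OF A]], of "const_mat Y" 1] by simp
    then show ?thesis
      unfolding std_qmodule_def hom_qmodule_def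
      by (simp add: one_Suc right_mult_one_mat[of _ r "Suc 0"])
  qed
  have f: "fibre (std_qmodule q (pure_mat (\<mu>, A))) = carrier_mat r 1"
    "fibre (hom_qmodule q (pure_mat (0, 1\<^sub>m 1)) (pure_mat (\<mu>, A))) = carrier_mat r 1"
    by (auto simp: fibre_def std_qmodule_def hom_qmodule_def d one_Suc)
  have "bundle_step q (std_qmodule q (pure_mat (\<mu>, A))) =
      bundle_step q (hom_qmodule q (pure_mat (0, 1\<^sub>m 1)) (pure_mat (\<mu>, A)))"
    unfolding bundle_step_def f using c by (smt (verit, best) Collect_cong)
  also have "\<dots> = {((z, X), (q * z, z powi (- (\<mu> - 0)) \<cdot>\<^sub>m (A * X * mat_inv (1\<^sub>m 1)))) | z X.
      z \<noteq> 0 \<and> X \<in> carrier_mat r 1}"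
    by (rule bundle_step_hom_qmodule[OF _ _ A])
      (auto simp: invertible_mat_def inverts_mat_def intro!: exI[of _ "1\<^sub>m 1"])
  also have "\<dots> = {((z, X), (q * z, z powi (- \<mu>) \<cdot>\<^sub>m (A * X))) | z X. z \<noteq> 0 \<and> X \<in> carrier_mat r 1}"
  proof -
    have "A * X * mat_inv (1\<^sub>m 1) = A * X" if "X \<in> carrier_mat r 1" for X
      unfolding one(2) by (rule right_mult_one_mat[OF mult_carrier_mat[OF A(1) that]])
    then show ?thesis by (smt (verit, best) Collect_cong diff_zero)
  qed
  finally show ?thesis .
qed

definition bundle_rel ::
  "complex \<Rightarrow> qmodule \<Rightarrow> ((complex \<times> complex mat) \<times> (complex \<times> complex mat)) set" where
  "bundle_rel q M = (bundle_step q M \<union> (bundle_step q M)\<inverse>)\<^sup>* \<inter>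
     ((- {0}) \<times> fibre M) \<times> ((- {0}) \<times> fibre M)"

definition bundle_total :: "complex \<Rightarrow> qmodule \<Rightarrow> (complex \<times> complex mat) set set" where
  "bundle_total q M = ((- {0}) \<times> fibre M) // bundle_rel q M"

definition bundle_class ::
  "complex \<Rightarrow> qmodule \<Rightarrow> complex \<times> complex mat \<Rightarrow> (complex \<times> complex mat) set" where
  "bundle_class q M p = bundle_rel q M `` {p}"

definition bundle_proj :: "complex \<Rightarrow> (complex \<times> complex mat) set \<Rightarrow> complex set" where
  "bundle_proj q v = (\<Union>p\<in>v. qorbit q (fst p))"

definition bundle_zero :: "complex \<Rightarrow> qmodule \<Rightarrow> complex set \<Rightarrow> (complex \<times> complex mat) set" where
  "bundle_zero q M x = (\<Union>z\<in>x. bundle_class q M (z, 0\<^sub>m (nrows M) (ncols M)))"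

definition bundle_add :: "complex \<Rightarrow> qmodule \<Rightarrow> (complex \<times> complex mat) set \<Rightarrow>
    (complex \<times> complex mat) set \<Rightarrow> (complex \<times> complex mat) set" where
  "bundle_add q M v w = \<Union>{bundle_class q M (z, X + Y) | z X Y. (z, X) \<in> v \<and> (z, Y) \<in> w}"

definition bundle_smult :: "complex \<Rightarrow> qmodule \<Rightarrow> complex \<Rightarrow>
    (complex \<times> complex mat) set \<Rightarrow> (complex \<times> complex mat) set" where
  "bundle_smult q M a v = (\<Union>(z, X)\<in>v. bundle_class q M (z, a \<cdot>\<^sub>m X))"

text \<open>Holomorphic sections. Over \<open>qorbit q ` U\<close>, with \<open>U\<close> so small that \<open>qorbit q\<close> is injective on
  it, the bundle is trivialised by \<open>(z, X) \<mapsto> bundle_class q M (z, X)\<close> on \<open>U \<times> fibre M\<close>.\<close>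

definition holomorphic_section :: "complex \<Rightarrow> qmodule \<Rightarrow> complex set set \<Rightarrow>
    (complex set \<Rightarrow> (complex \<times> complex mat) set) \<Rightarrow> bool" where
  "holomorphic_section q M V s \<longleftrightarrow>
     (\<forall>x\<in>V. s x \<in> bundle_total q M \<and> bundle_proj q (s x) = x) \<and>
     (\<forall>z\<^sub>0\<in>Eq_preimage q V. \<exists>U X. open U \<and> z\<^sub>0 \<in> U \<and> U \<subseteq> Eq_preimage q V \<and>
        (\<forall>z\<in>U. X z \<in> fibre M) \<and>
        (\<forall>a<nrows M. \<forall>b<ncols M. (\<lambda>z. X z $$ (a, b)) holomorphic_on U) \<and>
        (\<forall>z\<in>U. s (qorbit q z) = bundle_class q M (z, X z)))"

definition bundle_sections :: "complex \<Rightarrow> qmodule \<Rightarrow> complex set set \<Rightarrow>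
    (complex set \<Rightarrow> complex, complex set \<Rightarrow> (complex \<times> complex mat) set) module" where
  "bundle_sections q M V = \<lparr>
     carrier = {s \<in> extensional V. holomorphic_section q M V s},
     mult = undefined, one = undefined,
     zero = (\<lambda>x\<in>V. bundle_zero q M x),
     add = (\<lambda>s s'. \<lambda>x\<in>V. bundle_add q M (s x) (s' x)),
     smult = (\<lambda>g s. \<lambda>x\<in>V. bundle_smult q M (g x) (s x))\<rparr>"

section \<open>Sectors and flat functions\<close>

definition sector :: "complex \<Rightarrow> complex set \<Rightarrow> bool" where
  "sector q W \<longleftrightarrow> open W \<and> 0 \<notin> W \<and> (\<forall>z\<in>W. z / q \<in> W)"

definition horizon :: "complex \<Rightarrow> complex set \<Rightarrow> complex set set" where
  "horizon q W = qorbit q ` W"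

definition spiral_hull :: "complex \<Rightarrow> complex set \<Rightarrow> complex set" where
  "spiral_hull q K = {z / q ^ n | z n. z \<in> K}"

definition flat_on :: "complex \<Rightarrow> complex set \<Rightarrow> (complex \<Rightarrow> complex) \<Rightarrow> bool" where
  "flat_on q W f \<longleftrightarrow>
     (\<forall>m::nat. \<forall>K. compact K \<and> K \<subseteq> W \<longrightarrow> bounded ((\<lambda>z. f z / z ^ m) ` spiral_hull q K))"

definition theta :: "complex \<Rightarrow> complex \<Rightarrow> complex \<Rightarrow> complex" where
  "theta q c z = (\<Sum>\<^sub>\<infinity>m::int. q powi (- (m * (m + 1) div 2)) * (z / c) powi m)"

text \<open>The case distinction is needed since \<open>0 powr 0 = 0\<close>, whereas \<open>\<bar>\<theta>\<bar>\<^sup>0 = 1\<close> also at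
  the zeros of \<open>\<theta>\<close>.\<close>

definition t_flat_on ::
  "complex \<Rightarrow> complex \<Rightarrow> real \<Rightarrow> complex set \<Rightarrow> (complex \<Rightarrow> complex) \<Rightarrow> bool" where
  "t_flat_on q c t W f \<longleftrightarrow>
     (\<forall>K. compact K \<and> K \<subseteq> W \<longrightarrow> (\<exists>N::nat.
        (\<lambda>z. norm (f z) * (if t = 0 then 1 else norm (theta q c z) powr t))
          \<in> O[at 0 within spiral_hull q K](\<lambda>z. 1 / norm z ^ N)))"

section \<open>Sheaves of flat matrices\<close>

text \<open>An \<open>n \<times> n\<close> matrix with entries in the sections of \<open>\<A>\<^sub>0\<close> over \<open>V\<close> is the class of a pair
  \<open>(W, f)\<close>, with \<open>W\<close> a sector with horizon \<open>V\<close> and \<open>f\<close> a matrix of flat functions on \<open>W\<close>,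
  under restriction to smaller sectors with horizon \<open>V\<close>. The values of \<open>f\<close> outside \<open>W\<close>
  are irrelevant.\<close>

type_synonym mat_germ = "(complex set \<times> (complex \<Rightarrow> complex mat)) set"

definition flat_reps ::
  "complex \<Rightarrow> nat \<Rightarrow> complex set set \<Rightarrow> (complex set \<times> (complex \<Rightarrow> complex mat)) set" where
  "flat_reps q n V = {(W, f). sector q W \<and> horizon q W = V \<and>
     (\<forall>z\<in>W. f z \<in> carrier_mat n n) \<and>
     (\<forall>a<n. \<forall>b<n. (\<lambda>z. f z $$ (a, b)) holomorphic_on W \<and> flat_on q W (\<lambda>z. f z $$ (a, b)))}"

definition germ_rel :: "complex \<Rightarrow> nat \<Rightarrow> complex set set \<Rightarrow>
    ((complex set \<times> (complex \<Rightarrow> complex mat)) \<times> (complex set \<times> (complex \<Rightarrow> complex mat))) set" where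
  "germ_rel q n V = {((W, f), (W', f')). (W, f) \<in> flat_reps q n V \<and> (W', f') \<in> flat_reps q n V \<and>
     (\<exists>W''. sector q W'' \<and> horizon q W'' = V \<and> W'' \<subseteq> W \<inter> W' \<and> (\<forall>z\<in>W''. f z = f' z))}"

definition germ :: "complex \<Rightarrow> nat \<Rightarrow> complex set set \<Rightarrow>
    complex set \<times> (complex \<Rightarrow> complex mat) \<Rightarrow> mat_germ" where
  "germ q n V p = germ_rel q n V `` {p}"

definition flat_mats ::
  "complex \<Rightarrow> nat \<Rightarrow> complex set set \<Rightarrow> (complex set \<Rightarrow> complex, mat_germ) module" where
  "flat_mats q n V = \<lparr>
     carrier = flat_reps q n V // germ_rel q n V,
     mult = undefined, one = undefined,
     zero = germ q n V (Eq_preimage q V, \<lambda>_. 0\<^sub>m n n),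
     add = (\<lambda>x y. \<Union>(W, f)\<in>x. \<Union>(W', f')\<in>y. germ q n V (W \<inter> W', \<lambda>z. f z + f' z)),
     smult = (\<lambda>g x. \<Union>(W, f)\<in>x. germ q n V (W, \<lambda>z. g (qorbit q z) \<cdot>\<^sub>m f z))\<rparr>"

definition flat_mats_res ::
  "complex \<Rightarrow> nat \<Rightarrow> complex set set \<Rightarrow> complex set set \<Rightarrow> mat_germ \<Rightarrow> mat_germ" where
  "flat_mats_res q n V V' x = (\<Union>(W, f)\<in>x. germ q n V' (W \<inter> Eq_preimage q V', f))"

text \<open>The equation \<open>(\<sigma>\<^sub>q f) A\<^sub>0 = A\<^sub>0 f\<close> is an equation of germs. If it holds on a sector \<open>W''\<close> with
  horizon \<open>V\<close> and \<open>W'' \<subseteq> W\<close>, then the restriction of \<open>f\<close> to \<open>W''\<close> satisfies the condition below.\<close>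

definition lambda_I ::
  "complex \<Rightarrow> pure_data \<Rightarrow> complex set set \<Rightarrow> (complex set \<Rightarrow> complex, mat_germ) module" where
  "lambda_I q P V = (flat_mats q (total_rk P) V)
     \<lparr>carrier := {x \<in> carrier (flat_mats q (total_rk P) V). \<exists>(W, f)\<in>x.
        (\<forall>z\<in>W. supported_on P {(i, j). i < j} (f z)) \<and>
        (\<forall>z\<in>W. q * z \<in> W \<longrightarrow> f (q * z) * eval_mat (A0 P) z = eval_mat (A0 P) z * f z)}\<rparr>"

definition lambda_I_flat ::
  "complex \<Rightarrow> pure_data \<Rightarrow> complex \<Rightarrow> real \<Rightarrow> complex set set \<Rightarrow> mat_germ set" where
  "lambda_I_flat q P c t V = {x \<in> carrier (lambda_I q P V). \<exists>(W, f)\<in>x.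
     \<forall>a<total_rk P. \<forall>b<total_rk P. t_flat_on q c t W (\<lambda>z. f z $$ (a, b))}"

text \<open>A map from \<open>\<lambda>\<^sub>I(M\<^sub>0)\<close> to the sections of the bundle associated to the positive part of
  the internal endomorphisms is canonical if it sends the class of \<open>(W, f)\<close>, after
  shrinking \<open>W\<close>, to the section with value the class of \<open>(z, f z)\<close> at the image of \<open>z \<in> W\<close>.\<close>

definition canonical_section_map :: "complex \<Rightarrow> pure_data \<Rightarrow>
    (complex set set \<Rightarrow> mat_germ \<Rightarrow> complex set \<Rightarrow> (complex \<times> complex mat) set) \<Rightarrow> bool" where
  "canonical_section_map q P \<phi> \<longleftrightarrow>
     (\<forall>V. openin (Eq_topology q) V \<longrightarrow> (\<forall>x\<in>carrier (lambda_I q P V). \<exists>(W, f)\<in>x.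
        \<forall>z\<in>W. \<phi> V x (qorbit q z) = bundle_class q (End_pos q P) (z, f z)))"

text \<open>The part of degree \<open>t\<close> of \<open>\<lambda>\<^sub>I(M\<^sub>0)\<close>, once \<open>\<lambda>\<^sub>I(M\<^sub>0)\<close> is identified by \<open>\<phi>\<close> with the sections of
  the bundle associated to \<open>End_pos q P\<close>. For \<open>t > 0\<close>, \<open>End_slope q P t\<close> is a submodule of
  \<open>End_pos q P\<close> stable under the inverse of \<open>\<Phi>\<close>, so a class for its bundle is
  a class for the bundle of \<open>End_pos q P\<close>, as a set; its sections are sections of the latter.\<close>

definition lambda_I_degree :: "complex \<Rightarrow> pure_data \<Rightarrow>
    (complex set set \<Rightarrow> mat_germ \<Rightarrow> complex set \<Rightarrow> (complex \<times> complex mat) set) \<Rightarrow>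
    int \<Rightarrow> complex set set \<Rightarrow> mat_germ set" where
  "lambda_I_degree q P \<phi> t V = {x \<in> carrier (lambda_I q P V).
     \<phi> V x \<in> carrier (bundle_sections q (End_slope q P t) V)}"

end

theory Submission
  imports Defs
begin

text \<open>Everything is read off holomorphic functions on the preimage of \<open>V\<close> in \<open>\<complex>\<^sup>*\<close>. Let \<open>E\<close> be the
  block diagonal matrix with blocks \<open>A\<^sub>i\<close>, let the weight \<open>m a\<close> of an index be the slope of
  its block, and call \<open>m a - m b\<close> the level of the entry \<open>(a, b)\<close>. Since \<open>A\<^sub>0\<close> is \<open>z\<^sup>-\<^sup>m E\<close> and \<open>E\<close> only
  mixes indices of equal weight, the equation \<open>(\<sigma>\<^sub>q f) A\<^sub>0 = A\<^sub>0 f\<close> becomes \<open>f (q z) = step z (f z)\<close>, where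
  \<open>step z\<close> conjugates by \<open>E\<close> and multiplies the part of level \<open>d\<close> by \<open>z powi (- d)\<close>
  (\<open>intertwining_iff_step\<close>). The same map glues the bundle of the positive part of the internal
  endomorphisms (\<open>models_hom_sum\<close>). So sections of the bundle are the same as
  holomorphic solutions of this equation on the preimage (\<open>section_eq_section_of\<close>), because
  multiplication by \<open>q\<close> acts freely on \<open>\<complex>\<^sup>*\<close>.

  Germs of flat matrices are these solutions as well (\<open>carrier_flat_germs\<close>). On the one hand, every
  spiral \<open>z / q ^ k\<close> enters a given sector, so a solution on a sector extends uniquely to the
  preimage. On the other hand, flatness is automatic: iterating the equation, the part of level \<open>d\<close> of
  \<open>F (z / q ^ k)\<close> is \<open>p\<^sub>k\<^sup>d\<close> times the part of level \<open>d\<close> of \<open>E\<^sup>-\<^sup>k (F z) E\<^sup>k\<close>, where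
  \<open>p\<^sub>k = (\<Prod>l=1..k. z / q ^ l)\<close> decays like \<open>q\<close> to the power \<open>- k\<^sup>2 / 2\<close> and the conjugation is at most
  exponential in \<open>k\<close> (\<open>norm_equivariant_spiral\<close>, \<open>conjugation_bound\<close>). As the levels are positive
  integers, \<open>F\<close> is flat. Composing the two descriptions yields the isomorphism of sheaves.

  For the filtration, theta satisfies \<open>\<theta> (z / q ^ k) = \<theta> z * c ^ k / p\<^sub>k\<close>, so \<open>\<bar>F\<bar> \<bar>\<theta>\<bar>\<^sup>t\<close> behaves in level \<open>d\<close>
  like \<open>\<bar>p\<^sub>k\<bar>\<close> to the power \<open>d - t\<close>, up to factors bounded by powers of \<open>\<bar>z / q ^ k\<bar>\<close>. If
  \<open>d \<ge> t\<close> this has polynomial growth; if \<open>d < t\<close> it does not, unless the part of level \<open>d\<close> vanishes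
  at \<open>z\<close> or theta does. The zeros of theta are nowhere dense, so \<open>t\<close>-flat means that all levels are
  at least \<open>t\<close> (\<open>t_flat_germs\<close>). Since \<open>step\<close> preserves levels, the decomposition of matrices into
  levels is a direct sum decomposition of the germs (\<open>internal_direct_sum_levels\<close>).\<close>

section \<open>The theta function\<close>

text \<open>The scalar that controls all growth below: along the spiral \<open>z / q ^ k\<close> every quantity of
  interest is a power of this product, which decays like \<open>Q\<close> to the power \<open>- k\<^sup>2 / 2\<close>,
  times a factor that is at most exponential in \<open>k\<close>.\<close>

definition gauss_prod :: "real \<Rightarrow> real \<Rightarrow> nat \<Rightarrow> real" where
  "gauss_prod Q x k = (\<Prod>l=1..k. x / Q ^ l)"

lemma gauss_prod_Suc [simp]: "gauss_prod Q x (Suc k) = gauss_prod Q x k * (x / Q ^ Suc k)"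
  unfolding gauss_prod_def by simp

lemma gauss_prod_0 [simp]: "gauss_prod Q x 0 = 1"
  unfolding gauss_prod_def by simp

lemma gauss_prod_nonneg: "Q > 1 \<Longrightarrow> x \<ge> 0 \<Longrightarrow> gauss_prod Q x k \<ge> 0"
  unfolding gauss_prod_def by (intro prod_nonneg) auto

lemma gauss_prod_pos: "Q > 1 \<Longrightarrow> x > 0 \<Longrightarrow> gauss_prod Q x k > 0"
  unfolding gauss_prod_def by (intro prod_pos) auto

lemma gauss_prod_mono: "Q > 1 \<Longrightarrow> 0 \<le> x \<Longrightarrow> x \<le> y \<Longrightarrow> gauss_prod Q x k \<le> gauss_prod Q y k"
  unfolding gauss_prod_def by (intro prod_mono) (auto intro: divide_right_mono)

text \<open>Exponential factors can be absorbed into the argument, so that they never compete with the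
  Gaussian decay.\<close>

lemma gauss_prod_mult: "gauss_prod Q (c * x) k = c ^ k * gauss_prod Q x k"
  by (induction k) auto

text \<open>Consecutive quotients are \<open>x / Q ^ (k + 1)\<close>, which tend to \<open>0\<close> because \<open>Q > 1\<close>.\<close>

lemma summable_gauss_prod:
  assumes "Q > 1" "x \<ge> 0"
  shows "summable (gauss_prod Q x)"
proof -
  have "(\<lambda>k. x * (1/Q) ^ Suc k) \<longlonglongrightarrow> x * 0"
    by (intro tendsto_intros LIMSEQ_Suc LIMSEQ_power_zero) (use assms in auto)
  then have "eventually (\<lambda>k. x * (1/Q) ^ Suc k < 1/2) sequentially"
    by (intro order_tendstoD(2)[where y = "x * 0"]) auto
  then obtain N where N: "\<And>k. k \<ge> N \<Longrightarrow> x * (1/Q) ^ Suc k < 1/2"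
    unfolding eventually_sequentially by auto
  show ?thesis
  proof (rule summable_ratio_test[of "1/2" N])
    fix k assume "k \<ge> N"
    have "x / Q ^ Suc k = x * (1/Q) ^ Suc k" by (simp only: power_one_over) simp
    then have "x / Q ^ Suc k \<le> 1/2" using N[OF \<open>k \<ge> N\<close>] by linarith
    moreover have "0 \<le> gauss_prod Q x k" "0 \<le> gauss_prod Q x (Suc k)"
      using gauss_prod_nonneg[OF assms] by blast+
    ultimately show "norm (gauss_prod Q x (Suc k)) \<le> 1/2 * norm (gauss_prod Q x k)"
      using mult_left_mono[of "x / Q ^ Suc k" "1/2" "gauss_prod Q x k"]
      unfolding real_norm_def gauss_prod_Suc
      by (simp only: abs_of_nonneg mult.commute)
  qed simp
qed

lemma gauss_prod_tendsto_0: "Q > 1 \<Longrightarrow> x \<ge> 0 \<Longrightarrow> gauss_prod Q x \<longlonglongrightarrow> 0"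
  by (rule summable_LIMSEQ_zero[OF summable_gauss_prod])

text \<open>The half of the theta series with \<open>m \<ge> 0\<close> and \<open>c = 1\<close>. It is entire.\<close>

definition half_theta :: "complex \<Rightarrow> complex \<Rightarrow> complex" where
  "half_theta q x = (\<Sum>n. (1 / q ^ (n * (n + 1) div 2)) * x ^ n)"

lemma triangular_Suc: "Suc n * (Suc n + 1) div 2 = n * (n + 1) div 2 + Suc n"
proof -
  have "Suc n * (Suc n + 1) = n * (n + 1) + 2 * Suc n" by simp
  then show ?thesis by (simp only: div_mult_self2[of 2] zero_neq_numeral)
qed

lemma norm_half_theta_term:
  fixes q x :: complex
  shows
  "norm ((1 / q ^ (n * (n + 1) div 2)) * x ^ n) = gauss_prod (norm q) (norm x) n"
proof (induction n)
  case (Suc n)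
  have "norm ((1 / q ^ (Suc n * (Suc n + 1) div 2)) * x ^ Suc n) =
      norm ((1 / q ^ (n * (n + 1) div 2)) * x ^ n) * (norm x / norm q ^ Suc n)"
    unfolding triangular_Suc power_add
    by (simp only: norm_mult norm_divide norm_power power_Suc2[of x] norm_one)
      (simp add: power_add algebra_simps)
  then show ?case using Suc by simp
qed simp

context
  fixes q :: complex
  assumes q: "norm q > 1"
begin

lemma q_nonzero: "q \<noteq> 0" using q by auto

lemma summable_half_theta: "summable (\<lambda>n. norm ((1 / q ^ (n * (n + 1) div 2)) * x ^ n))"
  unfolding norm_half_theta_term by (rule summable_gauss_prod) (use q in auto)

lemma holomorphic_half_theta: "half_theta q holomorphic_on UNIV"
proof -
  define F where "F = Abs_fps (\<lambda>n. 1 / q ^ (n * (n + 1) div 2))"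
  have "conv_radius (fps_nth F) = \<infinity>"
    using summable_norm_cancel[OF summable_half_theta]
    by (intro conv_radius_inftyI'') (simp add: F_def)
  then have "eval_fps F holomorphic_on UNIV"
    by (intro holomorphic_on_eval_fps) (auto simp: fps_conv_radius_def)
  moreover have "eval_fps F = half_theta q"
    by (auto simp: eval_fps_def half_theta_def F_def fun_eq_iff)
  ultimately show ?thesis by simp
qed

lemma half_theta_0: "half_theta q 0 = 1"
  unfolding half_theta_def by (subst suminf_finite[of "{0}"]) auto

lemma has_sum_half_theta:
  "((\<lambda>n. (1 / q ^ (n * (n + 1) div 2)) * x ^ n) has_sum half_theta q x) UNIV"
  unfolding half_theta_def
  using summable_norm_cancel[OF summable_half_theta]
  by (intro norm_summable_imp_has_sum summable_half_theta) (auto simp: summable_sums)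

text \<open>Because \<open>m (m + 1)\<close> is invariant under \<open>m \<mapsto> - m - 1\<close>, the terms of negative index
  have the same coefficients as the others, read in the variable \<open>c / z\<close> with one extra factor
  \<open>c / z\<close>. So one entire function carries all analytic information about theta.\<close>

lemma theta_eq_half_theta:
  assumes "c \<noteq> 0" "z \<noteq> 0"
  shows "theta q c z = half_theta q (z / c) + (c / z) * half_theta q (c / z)"
proof -
  define f where "f m = q powi (- (m * (m + 1) div 2)) * (z / c) powi m" for m :: int
  have "(f has_sum half_theta q (z / c)) (range int)"
  proof (subst has_sum_reindex)
    have "- (int n * (int n + 1) div 2) = - int (n * (n + 1) div 2)" for n
      by (simp only: zdiv_int of_nat_mult of_nat_add of_nat_1 of_nat_numeral)
    then have "(f \<circ> int) = (\<lambda>n. (1 / q ^ (n * (n + 1) div 2)) * (z / c) ^ n)"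
      unfolding f_def comp_def by (simp only: power_int_minus) (simp add: field_simps)
    then show "((f \<circ> int) has_sum half_theta q (z / c)) UNIV"
      using has_sum_half_theta[of "z / c"] by simp
  qed auto
  moreover have "(f has_sum (c / z) * half_theta q (c / z)) (range (\<lambda>n. - int n - 1))"
  proof (subst has_sum_reindex)
    have e: "- ((- int n - 1) * (- int n - 1 + 1) div 2) = - int (n * (n + 1) div 2)" for n
    proof -
      have "(- int n - 1) * (- int n - 1 + 1) = int (n * (n + 1))" by (simp add: algebra_simps)
      then show ?thesis by (simp only: zdiv_int) simp
    qed
    have e2: "(z / c) powi (- int n - 1) = (c / z) * (c / z) ^ n" for n
    proof -
      have "(z / c) powi (- int n - 1) = (z / c) powi (- int (Suc n))"
        by (rule arg_cong[where f = "power_int (z / c)"]) simp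
      also have "\<dots> = inverse ((z / c) ^ Suc n)" by (simp only: power_int_minus power_int_of_nat)
      also have "\<dots> = (c / z) ^ Suc n" by (simp only: power_inverse[symmetric] inverse_divide)
      finally show ?thesis by simp
    qed
    have "f (- int n - 1) = (c / z) * ((1 / q ^ (n * (n + 1) div 2)) * (c / z) ^ n)" for n
      unfolding f_def e e2 power_int_minus power_int_of_nat by (simp add: field_simps)
    then have "(f \<circ> (\<lambda>n. - int n - 1)) = (\<lambda>n. (c / z) * ((1 / q ^ (n * (n + 1) div 2)) * (c / z) ^ n))"
      by (simp add: fun_eq_iff)
    then show "((f \<circ> (\<lambda>n. - int n - 1)) has_sum (c / z) * half_theta q (c / z)) UNIV"
      using has_sum_cmult_right[OF has_sum_half_theta[of "c / z"], of "c / z"] by simp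
  qed (auto intro: inj_onI)
  moreover have "range int \<inter> range (\<lambda>n. - int n - 1) = {}" by auto
  ultimately have "(f has_sum half_theta q (z / c) + (c / z) * half_theta q (c / z))
      (range int \<union> range (\<lambda>n. - int n - 1))"
    by (rule has_sum_Un_disjoint)
  moreover have "range int \<union> range (\<lambda>n. - int n - 1) = UNIV"
  proof -
    have "m \<in> range int \<union> range (\<lambda>n. - int n - 1)" for m :: int
      by (cases m rule: int_cases) auto
    then show ?thesis by auto
  qed
  ultimately have "infsum f UNIV = half_theta q (z / c) + (c / z) * half_theta q (c / z)"
    by (simp only: infsumI)
  then show ?thesis
    unfolding theta_def f_def .
qed

lemma holomorphic_theta:
  assumes "c \<noteq> 0"
  shows "theta q c holomorphic_on (- {0})"
proof -
  have h: "(\<lambda>z. half_theta q (g z)) holomorphic_on S" if "g holomorphic_on S" for g S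
    using holomorphic_on_compose[OF that holomorphic_on_subset[OF holomorphic_half_theta]]
    by (auto simp: comp_def)
  have "(\<lambda>z. half_theta q (z / c) + (c / z) * half_theta q (c / z)) holomorphic_on (- {0})"
    by (intro holomorphic_intros h) (use assms in auto)
  then show ?thesis
    by (rule holomorphic_transform) (use theta_eq_half_theta[OF assms] in auto)
qed

text \<open>Passing from the index \<open>m\<close> to \<open>m + 1\<close> multiplies the general term of the series by
  \<open>z / c\<close>.\<close>

lemma theta_q_shift:
  assumes "z \<noteq> 0" "c \<noteq> 0"
  shows "theta q c (q * z) = (z / c) * theta q c z"
proof -
  let ?f = "\<lambda>m::int. q powi (- (m * (m + 1) div 2)) * (q * z / c) powi m"
  have s: "?f (m + 1) = (z / c) * (q powi (- (m * (m + 1) div 2)) * (z / c) powi m)" for m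
  proof -
    have "(m + 1) * (m + 1 + 1) = m * (m + 1) + (m + 1) * 2" by (simp add: algebra_simps)
    then have "(m + 1) * (m + 1 + 1) div 2 = m * (m + 1) div 2 + (m + 1)" by simp
    then have "?f (m + 1) = q powi (- (m * (m + 1) div 2)) * q powi (- (m + 1)) *
        (q powi (m + 1) * (z / c) powi (m + 1))"
      using q_nonzero power_int_add[of q "- (m * (m + 1) div 2)" "- (m + 1)"]
      by (simp add: power_int_mult_distrib flip: times_divide_eq_right)
    also have "\<dots> = q powi (- (m * (m + 1) div 2)) * (z / c) powi (m + 1)"
    proof -
      have "q powi (- (m + 1)) * q powi (m + 1) = 1"
        using q_nonzero by (simp only: power_int_minus) simp
      then show ?thesis by (metis (no_types, lifting) mult.assoc mult.right_neutral)
    qed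
    also have "(z / c) powi (m + 1) = (z / c) * (z / c) powi m"
      using assms by (simp add: power_int_add)
    finally show ?thesis by simp
  qed
  have "theta q c (q * z) = (\<Sum>\<^sub>\<infinity>m. ?f m)" unfolding theta_def ..
  also have "\<dots> = (\<Sum>\<^sub>\<infinity>m. ?f (m + 1))"
    by (rule infsum_reindex_bij_betw[symmetric]) (rule bij_plus_right)
  also have "\<dots> = (z / c) * theta q c z"
    unfolding s theta_def by (rule infsum_cmult_right')
  finally show ?thesis .
qed

text \<open>If theta vanished on \<open>\<complex>\<^sup>*\<close>, the decomposition above would make \<open>half_theta q\<close> equal to
  \<open>- (1 / x) * half_theta q (1 / x)\<close>, which tends to \<open>0\<close> at infinity. Liouville's theorem would
  then force the entire function \<open>half_theta q\<close> to vanish, although its value at \<open>0\<close> is \<open>1\<close>.\<close>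

lemma theta_not_identically_0:
  assumes "c \<noteq> 0" shows "\<exists>z. z \<noteq> 0 \<and> theta q c z \<noteq> 0"
proof (rule ccontr)
  assume neg: "\<not> ?thesis"
  then have *: "half_theta q x = - (1 / x) * half_theta q (1 / x)" if "x \<noteq> 0" for x
  proof -
    have "c * x \<noteq> 0" using assms that by simp
    then have "theta q c (c * x) = 0" using neg by blast
    then show ?thesis
      using theta_eq_half_theta[of c "c * x"] assms that by (simp add: eq_neg_iff_add_eq_0)
  qed
  have inv: "((\<lambda>x::complex. 1 / x) \<longlongrightarrow> 0) at_infinity"
    using tendsto_inverse_0[where 'a = complex] by (simp only: inverse_eq_divide[abs_def])
  have "isCont (half_theta q) 0"
    using holomorphic_on_imp_continuous_on[OF holomorphic_half_theta]
    by (simp add: continuous_on_eq_continuous_at)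
  then have "((\<lambda>x. half_theta q (1 / x)) \<longlongrightarrow> half_theta q 0) at_infinity"
    using inv by (rule isCont_tendsto_compose)
  then have "((\<lambda>x. - (1 / x) * half_theta q (1 / x)) \<longlongrightarrow> - 0 * half_theta q 0) at_infinity"
    by (intro tendsto_intros inv)
  moreover have "eventually (\<lambda>x. - (1 / x) * half_theta q (1 / x) = half_theta q x) at_infinity"
    unfolding eventually_at_infinity
  proof (intro exI[of _ 1] allI impI)
    fix x :: complex assume "1 \<le> norm x"
    then have "x \<noteq> 0" by auto
    then show "- (1 / x) * half_theta q (1 / x) = half_theta q x" by (rule *[symmetric])
  qed
  ultimately have "(half_theta q \<longlongrightarrow> 0) at_infinity"
    using tendsto_cong by fastforce
  then have "half_theta q 0 = 0" by (rule Liouville_weak_0[OF holomorphic_half_theta])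
  then show False by (simp add: half_theta_0)
qed

text \<open>The identity theorem on the connected set \<open>\<complex>\<^sup>*\<close>. A condition of flatness says nothing on a
  spiral of zeros of theta; by this lemma such spirals can be avoided by a small displacement.\<close>

lemma theta_zeros_nowhere_dense:
  assumes "c \<noteq> 0" "open U" "U \<noteq> {}" "0 \<notin> U"
  shows "\<exists>z\<in>U. theta q c z \<noteq> 0"
proof (rule ccontr)
  assume "\<not> ?thesis"
  then have z: "\<And>z. z \<in> U \<Longrightarrow> theta q c z = 0" by auto
  have con: "connected (- {0::complex})"
    by (rule connected_punctured_universe) simp
  have "theta q c w = 0" if "w \<noteq> 0" for w
    by (rule analytic_continuation_open[of U "- {0}" "theta q c" "\<lambda>_. 0"])
      (use assms con z that holomorphic_theta in auto)
  then show False using theta_not_identically_0[OF assms(1)] by auto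
qed

text \<open>The functional equation iterated \<open>k\<close> times: theta grows along spirals exactly as fast as the
  Gaussian product decays.\<close>

lemma norm_theta_spiral:
  assumes "c \<noteq> 0" "z \<noteq> 0"
  shows "norm (theta q c (z / q ^ k)) * gauss_prod (norm q) (norm z / norm c) k = norm (theta q c z)"
proof (induction k)
  case (Suc k)
  have "theta q c (z / q ^ k) = (z / q ^ Suc k / c) * theta q c (z / q ^ Suc k)"
    using theta_q_shift[of "z / q ^ Suc k" c] assms q_nonzero by simp
  then have "norm (theta q c (z / q ^ k)) = norm (theta q c (z / q ^ Suc k)) * (norm z / norm c / norm q ^ Suc k)"
    by (simp add: norm_mult norm_divide norm_power field_simps)
  then show ?case using Suc by (simp add: mult_ac)
qed simp

end

section \<open>Orbits under multiplication by \<open>q\<close>\<close>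

lemma qorbit_self: "z \<in> qorbit q z"
  unfolding qorbit_def by (rule range_eqI[of _ _ 0]) simp

lemma qorbit_powi:
  assumes "q \<noteq> 0"
  shows "qorbit q (q powi k * z) = qorbit q z"
proof -
  have "qorbit q (q powi k * z) = (\<lambda>i. q powi i * z) ` range (\<lambda>j. j + k)"
    unfolding qorbit_def image_image using assms by (simp add: power_int_add mult.assoc)
  also have "range (\<lambda>j. j + k) = UNIV"
    using bij_plus_right[of k] by (rule bij_is_surj)
  finally show ?thesis unfolding qorbit_def .
qed

lemma qorbit_mult: "q \<noteq> 0 \<Longrightarrow> qorbit q (q * z) = qorbit q z"
  using qorbit_powi[of q 1 z] by simp

lemma qorbit_divide: "q \<noteq> 0 \<Longrightarrow> qorbit q (z / q ^ k) = qorbit q z"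
  using qorbit_powi[of q "- int k" z] by (simp add: power_int_minus field_simps)

lemma qorbit_memD:
  assumes "w \<in> qorbit q z"
  obtains k where "w = q powi k * z"
  using assms unfolding qorbit_def by auto

lemma Eq_preimage_mult: "q \<noteq> 0 \<Longrightarrow> q * z \<in> Eq_preimage q V \<longleftrightarrow> z \<in> Eq_preimage q V"
  by (simp add: Eq_preimage_def qorbit_mult)

lemma Eq_preimage_divide: "q \<noteq> 0 \<Longrightarrow> z / q ^ k \<in> Eq_preimage q V \<longleftrightarrow> z \<in> Eq_preimage q V"
  by (simp add: Eq_preimage_def qorbit_divide)

lemma Eq_preimage_nonzero: "z \<in> Eq_preimage q V \<Longrightarrow> z \<noteq> 0"
  by (simp add: Eq_preimage_def)

lemma Ell_memD:
  assumes "x \<in> V" "V \<subseteq> Ell q"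
  obtains z where "z \<in> Eq_preimage q V" "x = qorbit q z"
  using assms unfolding Ell_def Eq_preimage_def by auto

lemma image_qorbit_Eq_preimage: "V \<subseteq> Ell q \<Longrightarrow> qorbit q ` Eq_preimage q V = V"
  by (auto simp: Eq_preimage_def Ell_def)

section \<open>Graded matrices and the twisted conjugation\<close>

lemma triple_product_entry:
  fixes A X B :: "'a::comm_ring_1 mat"
  assumes "A \<in> carrier_mat k l" "X \<in> carrier_mat l l'" "B \<in> carrier_mat l' k'" "a < k" "b < k'"
  shows "(A * X * B) $$ (a, b) = (\<Sum>c<l. \<Sum>d<l'. A $$ (a, c) * X $$ (c, d) * B $$ (d, b))"
proof -
  have "(A * X * B) $$ (a, b) = (A * (X * B)) $$ (a, b)"
    using assms by (simp only: assoc_mult_mat[of A k l X l' B k'])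
  also have "\<dots> = (\<Sum>c<l. A $$ (a, c) * (\<Sum>d<l'. X $$ (c, d) * B $$ (d, b)))"
    using assms by (simp add: scalar_prod_def lessThan_atLeast0)
  also have "\<dots> = (\<Sum>c<l. \<Sum>d<l'. A $$ (a, c) * X $$ (c, d) * B $$ (d, b))"
    by (simp add: sum_distrib_left mult.assoc)
  finally show ?thesis .
qed

definition entry_norm :: "nat \<Rightarrow> complex mat \<Rightarrow> real" where
  "entry_norm n X = (\<Sum>a<n. \<Sum>b<n. norm (X $$ (a, b)))"

lemma entry_norm_nonneg: "entry_norm n X \<ge> 0"
  unfolding entry_norm_def by (intro sum_nonneg) auto

lemma norm_entry_le:
  assumes "a < n" "b < n" shows "norm (X $$ (a, b)) \<le> entry_norm n X"
proof -
  have "norm (X $$ (a, b)) \<le> (\<Sum>b<n. norm (X $$ (a, b)))"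
    by (rule member_le_sum) (use assms in auto)
  also have "\<dots> \<le> entry_norm n X"
    unfolding entry_norm_def
    by (rule member_le_sum[of a "{..<n}" "\<lambda>a. \<Sum>b<n. norm (X $$ (a, b))"])
      (use assms in \<open>auto intro: sum_nonneg\<close>)
  finally show ?thesis .
qed

lemma entry_norm_triple_product:
  assumes "A \<in> carrier_mat n n" "X \<in> carrier_mat n n" "B \<in> carrier_mat n n"
  shows "entry_norm n (A * X * B) \<le>
    (real n * real n * entry_norm n A * entry_norm n B + 1) * entry_norm n X"
proof -
  have "norm ((A * X * B) $$ (a, b)) \<le> entry_norm n A * entry_norm n B * entry_norm n X"
    if "a < n" "b < n" for a b
  proof -
    have "norm ((A * X * B) $$ (a, b)) \<le> (\<Sum>c<n. \<Sum>d<n. norm (A $$ (a, c) * X $$ (c, d) * B $$ (d, b)))"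
      unfolding triple_product_entry[OF assms that]
      by (intro sum_norm_le sum_norm_le[THEN order_trans] order_refl) auto
    also have "\<dots> \<le> (\<Sum>c<n. \<Sum>d<n. entry_norm n A * entry_norm n B * norm (X $$ (c, d)))"
    proof (intro sum_mono)
      fix c d assume "c \<in> {..<n}" "d \<in> {..<n}"
      then have "norm (A $$ (a, c)) * norm (B $$ (d, b)) \<le> entry_norm n A * entry_norm n B"
        using that by (intro mult_mono norm_entry_le entry_norm_nonneg) auto
      then show "norm (A $$ (a, c) * X $$ (c, d) * B $$ (d, b)) \<le> entry_norm n A * entry_norm n B * norm (X $$ (c, d))"
        using mult_right_mono[of _ _ "norm (X $$ (c, d))"] by (fastforce simp: norm_mult mult_ac)
    qed
    also have "\<dots> = entry_norm n A * entry_norm n B * entry_norm n X"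
      unfolding entry_norm_def[of n X] by (simp add: sum_distrib_left)
    finally show ?thesis .
  qed
  then have "entry_norm n (A * X * B) \<le> (\<Sum>a<n. \<Sum>b<n. entry_norm n A * entry_norm n B * entry_norm n X)"
    unfolding entry_norm_def[of n "A * X * B"] by (intro sum_mono) auto
  also have "\<dots> = real n * real n * entry_norm n A * entry_norm n B * entry_norm n X" by simp
  also have "\<dots> \<le> (real n * real n * entry_norm n A * entry_norm n B + 1) * entry_norm n X"
    using entry_norm_nonneg[of n X] by (simp add: algebra_simps)
  finally show ?thesis .
qed

text \<open>What remains of a tamely irregular module once the block structure is forgotten: every index
  \<open>a\<close> has an integral weight \<open>m a\<close>, and an invertible constant matrix \<open>E\<close>, with inverse \<open>E'\<close>,
  only mixes indices of equal weight. The entry \<open>(a, b)\<close> of a matrix has level \<open>m a - m b\<close>;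
  in the application the weights are the slopes and \<open>E\<close> is block diagonal with blocks \<open>A\<^sub>i\<close>.\<close>

locale graded_conjugation =
  fixes q :: complex and n :: nat and m :: "nat \<Rightarrow> int" and E E' :: "complex mat"
  assumes norm_q: "norm q > 1"
    and E_carrier: "E \<in> carrier_mat n n" "E' \<in> carrier_mat n n"
    and E_inverse: "E * E' = 1\<^sub>m n" "E' * E = 1\<^sub>m n"
    and E_degree: "\<And>a b. a < n \<Longrightarrow> b < n \<Longrightarrow> m a \<noteq> m b \<Longrightarrow> E $$ (a, b) = 0"
      "\<And>a b. a < n \<Longrightarrow> b < n \<Longrightarrow> m a \<noteq> m b \<Longrightarrow> E' $$ (a, b) = 0"
begin

lemma q_not_0: "q \<noteq> 0" using norm_q by auto

text \<open>Conjugation by the diagonal matrix with entries \<open>u powi (- m a)\<close>: the part of level \<open>d\<close> is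
  multiplied by \<open>u powi (- d)\<close>.\<close>

definition scale :: "complex \<Rightarrow> complex mat \<Rightarrow> complex mat" where
  "scale u X = mat n n (\<lambda>(a, b). u powi (m b - m a) * X $$ (a, b))"

definition twist :: "complex mat \<Rightarrow> complex mat" where
  "twist X = E * X * E'"

definition untwist :: "complex mat \<Rightarrow> complex mat" where
  "untwist X = E' * X * E"

text \<open>Conjugation by the matrix \<open>z\<^sup>-\<^sup>m E\<close>. It is the gluing map of the bundle from the fibre over
  \<open>z\<close> to the fibre over \<open>q * z\<close>, and at the same time the functional equation of the germs.\<close>

definition step :: "complex \<Rightarrow> complex mat \<Rightarrow> complex mat" where
  "step z X = scale z (twist X)"

definition unstep :: "complex \<Rightarrow> complex mat \<Rightarrow> complex mat" where
  "unstep z X = scale (1 / z) (untwist X)"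

text \<open>The matrices whose entries have their levels in \<open>L\<close>. The fibres of the bundles of the graded
  pieces and of the positive part are obtained for \<open>L = {t}\<close> and \<open>L = {0<..}\<close>.\<close>

definition level_mats :: "int set \<Rightarrow> complex mat set" where
  "level_mats L = {X \<in> carrier_mat n n. \<forall>a<n. \<forall>b<n. m a - m b \<notin> L \<longrightarrow> X $$ (a, b) = 0}"

lemma level_mats_carrier: "X \<in> level_mats L \<Longrightarrow> X \<in> carrier_mat n n"
  by (simp add: level_mats_def)

lemma level_mats_mono: "L \<subseteq> L' \<Longrightarrow> level_mats L \<subseteq> level_mats L'"
  by (auto simp: level_mats_def)

lemma level_mats_UNIV: "level_mats UNIV = carrier_mat n n"
  by (simp add: level_mats_def)

lemma zero_level_mats: "0\<^sub>m n n \<in> level_mats L"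
  by (simp add: level_mats_def)

lemma add_level_mats: "X \<in> level_mats L \<Longrightarrow> Y \<in> level_mats L \<Longrightarrow> X + Y \<in> level_mats L"
  by (auto simp: level_mats_def)

lemma smult_level_mats: "X \<in> level_mats L \<Longrightarrow> c \<cdot>\<^sub>m X \<in> level_mats L"
  by (auto simp: level_mats_def)

lemma twist_carrier: "X \<in> carrier_mat n n \<Longrightarrow> twist X \<in> carrier_mat n n"
  and untwist_carrier: "X \<in> carrier_mat n n \<Longrightarrow> untwist X \<in> carrier_mat n n"
  unfolding twist_def untwist_def using E_carrier by auto

lemma scale_carrier: "scale u X \<in> carrier_mat n n"
  by (simp add: scale_def)

lemma step_carrier: "step z X \<in> carrier_mat n n"
  and unstep_carrier: "unstep z X \<in> carrier_mat n n"
  by (simp_all add: step_def unstep_def scale_carrier)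

lemma untwist_twist: "X \<in> carrier_mat n n \<Longrightarrow> untwist (twist X) = X"
proof -
  assume X: "X \<in> carrier_mat n n"
  have "untwist (twist X) = (E' * E) * X * (E' * E)"
    unfolding twist_def untwist_def using E_carrier X by (simp add: assoc_mult_mat[of _ n n _ n _ n])
  then show ?thesis using X by (simp add: E_inverse)
qed

lemma twist_untwist: "X \<in> carrier_mat n n \<Longrightarrow> twist (untwist X) = X"
proof -
  assume X: "X \<in> carrier_mat n n"
  have "twist (untwist X) = (E * E') * X * (E * E')"
    unfolding twist_def untwist_def using E_carrier X by (simp add: assoc_mult_mat[of _ n n _ n _ n])
  then show ?thesis using X by (simp add: E_inverse)
qed

text \<open>A nonzero coefficient of \<open>E\<close> or \<open>E'\<close> joins indices of equal weight, so both maps act level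
  by level.\<close>

lemma scale_twist:
  assumes X: "X \<in> carrier_mat n n"
  shows "scale u (twist X) = twist (scale u X)"
proof (rule eq_matI)
  fix a b assume "a < dim_row (twist (scale u X))" "b < dim_col (twist (scale u X))"
  then have ab: "a < n" "b < n" using twist_carrier[OF scale_carrier[of u X]] by auto
  have "twist (scale u X) $$ (a, b) = (\<Sum>c<n. \<Sum>d<n. E $$ (a, c) * scale u X $$ (c, d) * E' $$ (d, b))"
    unfolding twist_def using triple_product_entry[OF E_carrier(1) scale_carrier E_carrier(2) ab] .
  also have "\<dots> = (\<Sum>c<n. \<Sum>d<n. u powi (m b - m a) * (E $$ (a, c) * X $$ (c, d) * E' $$ (d, b)))"
  proof (intro sum.cong refl)
    fix c d assume cd: "c \<in> {..<n}" "d \<in> {..<n}"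
    show "E $$ (a, c) * scale u X $$ (c, d) * E' $$ (d, b) =
        u powi (m b - m a) * (E $$ (a, c) * X $$ (c, d) * E' $$ (d, b))"
    proof (cases "m a = m c \<and> m d = m b")
      case True
      then show ?thesis using cd by (simp add: scale_def)
    next
      case False
      then have "E $$ (a, c) = 0 \<or> E' $$ (d, b) = 0" using cd ab E_degree by auto
      then show ?thesis by auto
    qed
  qed
  also have "\<dots> = u powi (m b - m a) * twist X $$ (a, b)"
    unfolding twist_def triple_product_entry[OF E_carrier(1) X E_carrier(2) ab]
    by (simp add: sum_distrib_left)
  finally show "scale u (twist X) $$ (a, b) = twist (scale u X) $$ (a, b)"
    using ab by (simp add: scale_def)
qed (use twist_carrier[OF scale_carrier[of u X]] in \<open>auto simp: scale_def\<close>)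

text \<open>Formal consequence of the previous lemma, since \<open>untwist\<close> is inverse to \<open>twist\<close>.\<close>

lemma scale_untwist:
  assumes X: "X \<in> carrier_mat n n"
  shows "scale u (untwist X) = untwist (scale u X)"
proof -
  have "scale u (untwist X) = untwist (twist (scale u (untwist X)))"
    by (rule untwist_twist[symmetric], rule scale_carrier)
  also have "twist (scale u (untwist X)) = scale u X"
    using scale_twist[OF untwist_carrier[OF X], of u] twist_untwist[OF X] by simp
  finally show ?thesis .
qed

lemma scale_scale: "u \<noteq> 0 \<Longrightarrow> v \<noteq> 0 \<Longrightarrow> scale u (scale v X) = scale (u * v) X"
  by (rule eq_matI) (auto simp: scale_def power_int_mult_distrib)

lemma scale_1: "X \<in> carrier_mat n n \<Longrightarrow> scale 1 X = X"
  by (rule eq_matI) (auto simp: scale_def)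

lemma unstep_step: "z \<noteq> 0 \<Longrightarrow> X \<in> carrier_mat n n \<Longrightarrow> unstep z (step z X) = X"
  unfolding unstep_def step_def
  by (simp add: scale_untwist scale_carrier scale_scale scale_1 twist_carrier untwist_carrier untwist_twist flip: scale_untwist)

lemma step_unstep: "z \<noteq> 0 \<Longrightarrow> X \<in> carrier_mat n n \<Longrightarrow> step z (unstep z X) = X"
  unfolding unstep_def step_def
  by (simp add: scale_twist[symmetric] scale_carrier scale_scale scale_1 twist_carrier untwist_carrier twist_untwist flip: scale_twist)

definition proj :: "int set \<Rightarrow> complex mat \<Rightarrow> complex mat" where
  "proj L X = mat n n (\<lambda>(a, b). if m a - m b \<in> L then X $$ (a, b) else 0)"

lemma proj_level_mats: "proj L X \<in> level_mats L"
  by (simp add: proj_def level_mats_def)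

lemma level_mats_iff_proj: "X \<in> level_mats L \<longleftrightarrow> X \<in> carrier_mat n n \<and> proj L X = X"
proof
  assume "X \<in> level_mats L"
  then show "X \<in> carrier_mat n n \<and> proj L X = X"
    by (auto simp: level_mats_def proj_def intro!: eq_matI)
next
  assume "X \<in> carrier_mat n n \<and> proj L X = X"
  then show "X \<in> level_mats L" by (metis proj_level_mats)
qed

text \<open>Same reason as for \<open>scale_twist\<close>. This is why the grading by levels is compatible with all
  structures considered here.\<close>

lemma twist_proj:
  assumes X: "X \<in> carrier_mat n n"
  shows "twist (proj L X) = proj L (twist X)"
proof (rule eq_matI)
  note pc = level_mats_carrier[OF proj_level_mats[of L X]]
  fix a b assume "a < dim_row (proj L (twist X))" "b < dim_col (proj L (twist X))"
  then have ab: "a < n" "b < n" by (auto simp: proj_def)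
  have "twist (proj L X) $$ (a, b) = (\<Sum>c<n. \<Sum>d<n. E $$ (a, c) * proj L X $$ (c, d) * E' $$ (d, b))"
    unfolding twist_def using triple_product_entry[OF E_carrier(1) pc E_carrier(2) ab] .
  also have "\<dots> = (\<Sum>c<n. \<Sum>d<n. (if m a - m b \<in> L then 1 else 0) * (E $$ (a, c) * X $$ (c, d) * E' $$ (d, b)))"
  proof (intro sum.cong refl)
    fix c d assume cd: "c \<in> {..<n}" "d \<in> {..<n}"
    show "E $$ (a, c) * proj L X $$ (c, d) * E' $$ (d, b) =
        (if m a - m b \<in> L then 1 else 0) * (E $$ (a, c) * X $$ (c, d) * E' $$ (d, b))"
    proof (cases "m a = m c \<and> m d = m b")
      case True
      then show ?thesis using cd by (simp add: proj_def)
    next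
      case False
      then have "E $$ (a, c) = 0 \<or> E' $$ (d, b) = 0" using cd ab E_degree by auto
      then show ?thesis by auto
    qed
  qed
  also have "\<dots> = (if m a - m b \<in> L then 1 else 0) * twist X $$ (a, b)"
    unfolding twist_def triple_product_entry[OF E_carrier(1) X E_carrier(2) ab]
    by (simp only: sum_distrib_left)
  finally show "twist (proj L X) $$ (a, b) = proj L (twist X) $$ (a, b)"
    using ab by (simp add: proj_def)
qed (use twist_carrier[OF level_mats_carrier[OF proj_level_mats[of L X]]] in \<open>auto simp: proj_def\<close>)

lemma untwist_proj:
  assumes X: "X \<in> carrier_mat n n"
  shows "untwist (proj L X) = proj L (untwist X)"
proof -
  have "proj L (untwist X) = untwist (twist (proj L (untwist X)))"
    by (rule untwist_twist[symmetric], rule level_mats_carrier[OF proj_level_mats])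
  also have "twist (proj L (untwist X)) = proj L X"
    using twist_proj[OF untwist_carrier[OF X], of L] twist_untwist[OF X] by simp
  finally show ?thesis by simp
qed

lemma scale_proj: "scale u (proj L X) = proj L (scale u X)"
  by (rule eq_matI) (auto simp: scale_def proj_def)

lemma step_proj: "X \<in> carrier_mat n n \<Longrightarrow> step z (proj L X) = proj L (step z X)"
  unfolding step_def by (simp add: twist_proj scale_proj)

lemma unstep_proj: "X \<in> carrier_mat n n \<Longrightarrow> unstep z (proj L X) = proj L (unstep z X)"
  unfolding unstep_def by (simp add: untwist_proj scale_proj)

lemma step_level_mats: "X \<in> level_mats L \<Longrightarrow> step z X \<in> level_mats L"
  unfolding level_mats_iff_proj by (metis step_proj step_carrier)

lemma unstep_level_mats: "X \<in> level_mats L \<Longrightarrow> unstep z X \<in> level_mats L"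
  unfolding level_mats_iff_proj by (metis unstep_proj unstep_carrier)

lemma step_add:
  assumes "X \<in> carrier_mat n n" "Y \<in> carrier_mat n n"
  shows "step z (X + Y) = step z X + step z Y"
proof -
  have "twist (X + Y) = twist X + twist Y"
    unfolding twist_def using assms E_carrier
    by (simp add: mult_add_distrib_mat[of _ n n _ n] add_mult_distrib_mat[of _ n n _ _ n])
  then show ?thesis
    unfolding step_def using twist_carrier[OF assms(1)] twist_carrier[OF assms(2)]
    by (intro eq_matI) (auto simp: scale_def distrib_left)
qed

lemma step_smult:
  assumes "X \<in> carrier_mat n n"
  shows "step z (c \<cdot>\<^sub>m X) = c \<cdot>\<^sub>m step z X"
proof -
  have "twist (c \<cdot>\<^sub>m X) = c \<cdot>\<^sub>m twist X"
    unfolding twist_def using assms E_carrier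
    by (simp add: mult_smult_distrib[of _ n n _ n] mult_smult_assoc_mat[of _ n n _ n])
  then show ?thesis
    unfolding step_def using twist_carrier[OF assms]
    by (intro eq_matI) (auto simp: scale_def)
qed

lemma unstep_add:
  assumes "z \<noteq> 0" "X \<in> carrier_mat n n" "Y \<in> carrier_mat n n"
  shows "unstep z (X + Y) = unstep z X + unstep z Y"
proof -
  have "X + Y = step z (unstep z X + unstep z Y)"
    using assms by (simp add: step_add unstep_carrier step_unstep)
  then show ?thesis using assms by (simp add: unstep_step unstep_carrier)
qed

lemma unstep_smult:
  assumes "z \<noteq> 0" "X \<in> carrier_mat n n"
  shows "unstep z (c \<cdot>\<^sub>m X) = c \<cdot>\<^sub>m unstep z X"
proof -
  have "c \<cdot>\<^sub>m X = step z (c \<cdot>\<^sub>m unstep z X)"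
    using assms by (simp add: step_smult unstep_carrier step_unstep)
  then show ?thesis using assms by (simp add: unstep_step unstep_carrier)
qed

definition holomorphic_mat :: "(complex \<Rightarrow> complex mat) \<Rightarrow> complex set \<Rightarrow> bool" where
  "holomorphic_mat F U \<longleftrightarrow> (\<forall>a<n. \<forall>b<n. (\<lambda>z. F z $$ (a, b)) holomorphic_on U)"

lemma holomorphic_matI:
  assumes "\<And>a b. a < n \<Longrightarrow> b < n \<Longrightarrow> f a b holomorphic_on U"
    and "\<And>z a b. z \<in> U \<Longrightarrow> a < n \<Longrightarrow> b < n \<Longrightarrow> f a b z = F z $$ (a, b)"
  shows "holomorphic_mat F U"
  unfolding holomorphic_mat_def using assms by (metis holomorphic_transform)

lemma holomorphic_mat_subset: "holomorphic_mat F U \<Longrightarrow> U' \<subseteq> U \<Longrightarrow> holomorphic_mat F U'"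
  unfolding holomorphic_mat_def using holomorphic_on_subset by blast

lemma holomorphic_mat_step:
  assumes F: "holomorphic_mat F U" "\<And>z. z \<in> U \<Longrightarrow> F z \<in> carrier_mat n n"
    and g: "g holomorphic_on U" "\<And>z. z \<in> U \<Longrightarrow> g z \<noteq> 0"
  shows "holomorphic_mat (\<lambda>z. step (g z) (F z)) U"
  unfolding holomorphic_mat_def
proof (intro allI impI)
  fix a b assume ab: "a < n" "b < n"
  have "(\<lambda>z. g z powi (m b - m a) * (\<Sum>c<n. \<Sum>d<n. E $$ (a, c) * F z $$ (c, d) * E' $$ (d, b))) holomorphic_on U"
    using F(1) g unfolding holomorphic_mat_def by (intro holomorphic_intros) auto
  then show "(\<lambda>z. step (g z) (F z) $$ (a, b)) holomorphic_on U"
  proof (rule holomorphic_transform)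
    fix z assume "z \<in> U"
    then have "twist (F z) $$ (a, b) = (\<Sum>c<n. \<Sum>d<n. E $$ (a, c) * F z $$ (c, d) * E' $$ (d, b))"
      unfolding twist_def using triple_product_entry[OF E_carrier(1) F(2) E_carrier(2) ab] by blast
    then show "g z powi (m b - m a) * (\<Sum>c<n. \<Sum>d<n. E $$ (a, c) * F z $$ (c, d) * E' $$ (d, b)) =
        step (g z) (F z) $$ (a, b)"
      using ab by (simp add: step_def scale_def)
  qed
qed

text \<open>The common description of both sides of the theorem: holomorphic functions on the whole
  preimage of \<open>V\<close> in \<open>\<complex>\<^sup>*\<close> that satisfy the functional equation. Sections of the bundle and germs
  of flat matrices are each shown to be in bijection with these functions.\<close>

definition equivariant :: "complex set set \<Rightarrow> int set \<Rightarrow> (complex \<Rightarrow> complex mat) set" where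
  "equivariant V L = {F. (\<forall>z\<in>Eq_preimage q V. F z \<in> level_mats L \<and> F (q * z) = step z (F z)) \<and>
     holomorphic_mat F (Eq_preimage q V)}"

lemma equivariantI:
  assumes "\<And>z. z \<in> Eq_preimage q V \<Longrightarrow> F z \<in> level_mats L"
    and "\<And>z. z \<in> Eq_preimage q V \<Longrightarrow> F (q * z) = step z (F z)"
    and "holomorphic_mat F (Eq_preimage q V)"
  shows "F \<in> equivariant V L"
  using assms by (simp add: equivariant_def)

lemma equivariantD:
  assumes "F \<in> equivariant V L"
  shows "z \<in> Eq_preimage q V \<Longrightarrow> F z \<in> level_mats L"
    "z \<in> Eq_preimage q V \<Longrightarrow> F z \<in> carrier_mat n n"
    "z \<in> Eq_preimage q V \<Longrightarrow> F (q * z) = step z (F z)"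
    "holomorphic_mat F (Eq_preimage q V)"
  using assms by (auto simp: equivariant_def level_mats_carrier)

lemma equivariant_mono: "L \<subseteq> L' \<Longrightarrow> equivariant V L \<subseteq> equivariant V L'"
  using level_mats_mono[of L L'] by (auto simp: equivariant_def)

lemma equivariant_add:
  assumes F: "F \<in> equivariant V L" and G: "G \<in> equivariant V L"
  shows "(\<lambda>z. F z + G z) \<in> equivariant V L"
proof (rule equivariantI)
  show "F z + G z \<in> level_mats L" if "z \<in> Eq_preimage q V" for z
    using that F G equivariantD(1) add_level_mats by blast
  show "F (q * z) + G (q * z) = step z (F z + G z)" if "z \<in> Eq_preimage q V" for z
    using that F G by (simp add: equivariantD step_add)
  have "(\<lambda>z. F z $$ (a, b) + G z $$ (a, b)) holomorphic_on Eq_preimage q V" if "a < n" "b < n" for a b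
    using that equivariantD(4)[OF F] equivariantD(4)[OF G] unfolding holomorphic_mat_def by (intro holomorphic_intros) auto
  then show "holomorphic_mat (\<lambda>z. F z + G z) (Eq_preimage q V)"
    by (rule holomorphic_matI[where f = "\<lambda>a b z. F z $$ (a, b) + G z $$ (a, b)"])
      (auto simp: carrier_matD[OF equivariantD(2)[OF G]])
qed

lemma equivariant_zero: "(\<lambda>_. 0\<^sub>m n n) \<in> equivariant V L"
proof (rule equivariantI)
  have zero: "0 \<cdot>\<^sub>m X = 0\<^sub>m n n" if "X \<in> carrier_mat n n" for X :: "complex mat"
    using that by (intro eq_matI) auto
  have "step z (0 \<cdot>\<^sub>m 0\<^sub>m n n) = 0 \<cdot>\<^sub>m step z (0\<^sub>m n n)" for z by (rule step_smult) simp
  then show "0\<^sub>m n n = step z (0\<^sub>m n n)" for z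
    using zero[OF step_carrier] zero[OF zero_carrier_mat] by simp
qed (auto simp: zero_level_mats holomorphic_mat_def)

lemma equivariant_smult:
  assumes F: "F \<in> equivariant V L" and g: "g \<in> Eq_hol q V"
  shows "(\<lambda>z. g (qorbit q z) \<cdot>\<^sub>m F z) \<in> equivariant V L"
proof (rule equivariantI)
  show "g (qorbit q z) \<cdot>\<^sub>m F z \<in> level_mats L" if "z \<in> Eq_preimage q V" for z
    using that F equivariantD(1) smult_level_mats by blast
  show "g (qorbit q (q * z)) \<cdot>\<^sub>m F (q * z) = step z (g (qorbit q z) \<cdot>\<^sub>m F z)" if "z \<in> Eq_preimage q V" for z
    using that F by (simp add: equivariantD step_smult qorbit_mult q_not_0)
  have "(\<lambda>z. g (qorbit q z) * F z $$ (a, b)) holomorphic_on Eq_preimage q V" if "a < n" "b < n" for a b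
    using that equivariantD(4)[OF F] g unfolding holomorphic_mat_def Eq_hol_def by (intro holomorphic_intros) auto
  then show "holomorphic_mat (\<lambda>z. g (qorbit q z) \<cdot>\<^sub>m F z) (Eq_preimage q V)"
    by (rule holomorphic_matI[where f = "\<lambda>a b z. g (qorbit q z) * F z $$ (a, b)"])
      (auto simp: carrier_matD[OF equivariantD(2)[OF F]])
qed

lemma equivariant_proj:
  assumes F: "F \<in> equivariant V L"
  shows "(\<lambda>z. proj T (F z)) \<in> equivariant V T"
proof (rule equivariantI)
  show "proj T (F (q * z)) = step z (proj T (F z))" if "z \<in> Eq_preimage q V" for z
    using that F by (simp add: equivariantD step_proj)
  show "holomorphic_mat (\<lambda>z. proj T (F z)) (Eq_preimage q V)"
  proof (rule holomorphic_matI[where f = "\<lambda>a b z. if m a - m b \<in> T then F z $$ (a, b) else 0"])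
    fix a b assume "a < n" "b < n"
    then show "(\<lambda>z. if m a - m b \<in> T then F z $$ (a, b) else 0) holomorphic_on Eq_preimage q V"
      using equivariantD(4)[OF F] by (cases "m a - m b \<in> T") (auto simp: holomorphic_mat_def)
  qed (simp add: proj_def)
qed (rule proj_level_mats)

lemma equivariant_subset:
  assumes F: "F \<in> equivariant V L" and V: "V' \<subseteq> V"
  shows "F \<in> equivariant V' L"
proof -
  have "Eq_preimage q V' \<subseteq> Eq_preimage q V" using V by (auto simp: Eq_preimage_def)
  then show ?thesis
    using F holomorphic_mat_subset unfolding equivariant_def by blast
qed

end

section \<open>Sections of the associated bundle\<close>

context graded_conjugation
begin

definition next_state :: "complex \<times> complex mat \<Rightarrow> complex \<times> complex mat" where
  "next_state p = (q * fst p, step (fst p) (snd p))"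

definition prev_state :: "complex \<times> complex mat \<Rightarrow> complex \<times> complex mat" where
  "prev_state p = (fst p / q, unstep (fst p / q) (snd p))"

text \<open>The points of the trivial bundle over \<open>\<complex>\<^sup>*\<close> whose quotient is the bundle over the elliptic
  curve. On states \<open>next_state\<close> and \<open>prev_state\<close> are mutually inverse.\<close>

definition states :: "int set \<Rightarrow> (complex \<times> complex mat) set" where
  "states L = (- {0}) \<times> level_mats L"

text \<open>The action of \<open>\<int>\<close> generated by \<open>next_state\<close>; it is a group action on states only.\<close>

definition transport :: "int \<Rightarrow> complex \<times> complex mat \<Rightarrow> complex \<times> complex mat" where
  "transport k p = (if k \<ge> 0 then (next_state ^^ nat k) p else (prev_state ^^ nat (- k)) p)"

text \<open>The point of the bundle defined by a state. Unlike the classes of the associated bundle it does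
  not mention a module, so it can be compared between the bundle of the positive part and the bundles
  of its graded pieces.\<close>

definition orbit_class :: "complex \<times> complex mat \<Rightarrow> (complex \<times> complex mat) set" where
  "orbit_class p = range (\<lambda>k. transport k p)"

lemma states_iff: "p \<in> states L \<longleftrightarrow> fst p \<noteq> 0 \<and> snd p \<in> level_mats L"
  by (cases p) (simp add: states_def)

lemma next_state_states: "p \<in> states L \<Longrightarrow> next_state p \<in> states L"
  by (simp add: states_iff next_state_def step_level_mats q_not_0)

lemma prev_state_states: "p \<in> states L \<Longrightarrow> prev_state p \<in> states L"
  by (simp add: states_iff prev_state_def unstep_level_mats q_not_0)

lemma next_state_prev_state: "p \<in> states L \<Longrightarrow> next_state (prev_state p) = p"
  by (cases p) (auto simp: states_iff prev_state_def next_state_def q_not_0 step_unstep dest!: level_mats_carrier)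

lemma prev_state_next_state: "p \<in> states L \<Longrightarrow> prev_state (next_state p) = p"
  by (cases p) (auto simp: states_iff prev_state_def next_state_def q_not_0 unstep_step dest!: level_mats_carrier)

lemma funpow_prev_state_states: "p \<in> states L \<Longrightarrow> (prev_state ^^ k) p \<in> states L"
  by (induction k) (auto simp: prev_state_states)

lemma transport_0 [simp]: "transport 0 p = p"
  by (simp add: transport_def)

lemma transport_minus_of_nat: "transport (- int j) p = (prev_state ^^ j) p"
  by (cases "j = 0") (simp_all add: transport_def)

lemma transport_plus_1:
  assumes "p \<in> states L"
  shows "transport (k + 1) p = next_state (transport k p)"
proof (cases "k \<ge> 0")
  case True
  then show ?thesis by (simp add: transport_def nat_add_distrib)
next
  case False
  define j where "j = nat (- k - 1)"
  have k: "k = - int (Suc j)" using False by (simp add: j_def)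
  have "transport k p = prev_state ((prev_state ^^ j) p)" unfolding k transport_minus_of_nat by simp
  moreover have "transport (k + 1) p = (prev_state ^^ j) p"
    using transport_minus_of_nat[of j p] by (simp add: k)
  ultimately show ?thesis using next_state_prev_state[OF funpow_prev_state_states[OF assms]] by simp
qed

lemma transport_states:
  assumes "p \<in> states L"
  shows "transport k p \<in> states L"
proof (cases "k \<ge> 0")
  case True
  have "(next_state ^^ j) p \<in> states L" for j by (induction j) (auto simp: assms next_state_states)
  then show ?thesis using True by (simp add: transport_def)
next
  case False
  then show ?thesis using funpow_prev_state_states[OF assms] by (simp add: transport_def)
qed

lemma transport_minus_1: "p \<in> states L \<Longrightarrow> transport (k - 1) p = prev_state (transport k p)"
  using transport_plus_1[of p L "k - 1"] prev_state_next_state[OF transport_states[of p L "k - 1"]] by simp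

lemma transport_transport:
  assumes "p \<in> states L"
  shows "transport j (transport k p) = transport (j + k) p"
proof (induction j rule: int_induct[of _ 0])
  case (step1 i)
  then show ?case
    using transport_plus_1[OF transport_states[OF assms], of i k] transport_plus_1[OF assms, of "i + k"]
    by (simp add: ac_simps)
next
  case (step2 i)
  then show ?case
    using transport_minus_1[OF transport_states[OF assms], of i k] transport_minus_1[OF assms, of "i + k"]
    by (simp add: algebra_simps)
qed simp

lemma fst_transport:
  assumes "p \<in> states L"
  shows "fst (transport k p) = q powi k * fst p"
proof (induction k rule: int_induct[of _ 0])
  case (step1 i)
  then show ?case
    using transport_plus_1[OF assms, of i] q_not_0 by (simp add: next_state_def power_int_add)
next
  case (step2 i)
  then show ?case
    using transport_minus_1[OF assms, of i] q_not_0 by (simp add: prev_state_def power_int_diff)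
qed simp

text \<open>The base point moves by \<open>q powi k\<close>, whose modulus determines \<open>k\<close>.\<close>

lemma transport_fst_inj:
  assumes "p \<in> states L" "fst (transport j p) = fst (transport k p)"
  shows "j = k"
proof -
  have "q powi j = q powi k" using assms by (simp add: fst_transport[OF assms(1)] states_iff)
  then have "norm q powi j = norm q powi k" by (metis norm_power_int)
  then show ?thesis
    using norm_q power_int_strict_increasing[of j k "norm q"] power_int_strict_increasing[of k j "norm q"]
    by (cases j k rule: linorder_cases) auto
qed

text \<open>Transport is linear on fibres, by linearity of \<open>step\<close> and \<open>unstep\<close>.\<close>

lemma transport_add:
  assumes "z \<noteq> 0" "X \<in> carrier_mat n n" "Y \<in> carrier_mat n n"
  shows "snd (transport k (z, X + Y)) = snd (transport k (z, X)) + snd (transport k (z, Y))"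
proof -
  have s: "(z, X) \<in> states UNIV" "(z, Y) \<in> states UNIV" "(z, X + Y) \<in> states UNIV"
    using assms by (auto simp: states_def level_mats_UNIV)
  note c = transport_states[OF s(1), unfolded states_iff level_mats_UNIV] transport_states[OF s(2), unfolded states_iff level_mats_UNIV]
  note f = fst_transport[OF s(1)] fst_transport[OF s(2)] fst_transport[OF s(3)]
  show ?thesis
  proof (induction k rule: int_induct[of _ 0])
    case (step1 i)
    then show ?case
      using c[of i] by (simp add: transport_plus_1[OF s(1)] transport_plus_1[OF s(2)] transport_plus_1[OF s(3)] next_state_def f step_add)
  next
    case (step2 i)
    then show ?case
      using c[of i] assms(1) q_not_0
      by (simp add: transport_minus_1[OF s(1)] transport_minus_1[OF s(2)] transport_minus_1[OF s(3)] prev_state_def f unstep_add)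
  qed simp
qed

lemma transport_smult:
  assumes "z \<noteq> 0" "X \<in> carrier_mat n n"
  shows "snd (transport k (z, a \<cdot>\<^sub>m X)) = a \<cdot>\<^sub>m snd (transport k (z, X))"
proof -
  have s: "(z, X) \<in> states UNIV" "(z, a \<cdot>\<^sub>m X) \<in> states UNIV"
    using assms by (auto simp: states_def level_mats_UNIV)
  note c = transport_states[OF s(1), unfolded states_iff level_mats_UNIV]
  note f = fst_transport[OF s(1)] fst_transport[OF s(2)]
  show ?thesis
  proof (induction k rule: int_induct[of _ 0])
    case (step1 i)
    then show ?case
      using c[of i] by (simp add: transport_plus_1[OF s(1)] transport_plus_1[OF s(2)] next_state_def f step_smult)
  next
    case (step2 i)
    then show ?case
      using c[of i] assms(1) q_not_0
      by (simp add: transport_minus_1[OF s(1)] transport_minus_1[OF s(2)] prev_state_def f unstep_smult)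
  qed simp
qed

lemma self_orbit_class: "p \<in> orbit_class p"
  unfolding orbit_class_def by (rule range_eqI[of _ _ 0]) simp

lemma orbit_class_transport:
  assumes "p \<in> states L"
  shows "orbit_class (transport k p) = orbit_class p"
proof -
  have "orbit_class (transport k p) = (\<lambda>j. transport j p) ` range (\<lambda>j. j + k)"
    unfolding orbit_class_def image_image using transport_transport[OF assms] by simp
  also have "range (\<lambda>j. j + k) = UNIV"
    using bij_plus_right[of k] by (rule bij_is_surj)
  finally show ?thesis unfolding orbit_class_def .
qed

lemma orbit_class_states: "p \<in> states L \<Longrightarrow> orbit_class p \<subseteq> states L"
  unfolding orbit_class_def using transport_states by blast

text \<open>The action of \<open>\<int>\<close> on base points is free, so a point of the bundle has only one
  representative over a given \<open>z\<close>.\<close>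

lemma orbit_class_inj:
  assumes "orbit_class (z, X) = orbit_class (z, Y)" "(z, X) \<in> states L"
  shows "X = Y"
proof -
  obtain k where k: "transport k (z, X) = (z, Y)"
    using self_orbit_class[of "(z, Y)"] unfolding assms(1)[symmetric] unfolding orbit_class_def by (metis rangeE)
  then have "k = 0" using transport_fst_inj[OF assms(2), of k 0] by simp
  then show ?thesis using k by simp
qed

text \<open>The two representatives over \<open>w\<close> are reached by the same power of the action, because it is
  free on base points; then linearity of transport applies.\<close>

lemma orbit_class_add:
  assumes "(w, X') \<in> orbit_class (z, X)" "(w, Y') \<in> orbit_class (z, Y)" "(z, X) \<in> states L" "(z, Y) \<in> states L"
  shows "orbit_class (w, X' + Y') = orbit_class (z, X + Y)"
proof -
  obtain j k where jk: "(w, X') = transport j (z, X)" "(w, Y') = transport k (z, Y)"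
    using assms unfolding orbit_class_def by auto
  have "fst (transport j (z, X)) = fst (transport k (z, X))"
    using fst_transport[OF assms(3)] fst_transport[OF assms(4)] jk by (metis fst_conv)
  then have [simp]: "k = j" using transport_fst_inj[OF assms(3), of j k] by simp
  have s: "(z, X + Y) \<in> states L" using assms(3,4) by (simp add: states_iff add_level_mats)
  have "transport j (z, X + Y) = (w, X' + Y')"
    using transport_add[of z X Y j] assms(3,4) jk fst_transport[OF s, of j] fst_transport[OF assms(3), of j]
    by (metis \<open>k = j\<close> level_mats_carrier fst_conv prod.collapse snd_conv states_iff)
  then show ?thesis using orbit_class_transport[OF s, of j] by simp
qed

lemma orbit_class_smult:
  assumes "(w, X') \<in> orbit_class (z, X)" "(z, X) \<in> states L"
  shows "orbit_class (w, a \<cdot>\<^sub>m X') = orbit_class (z, a \<cdot>\<^sub>m X)"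
proof -
  obtain j where j: "(w, X') = transport j (z, X)"
    using assms unfolding orbit_class_def by auto
  have s: "(z, a \<cdot>\<^sub>m X) \<in> states L" using assms(2) by (simp add: states_iff smult_level_mats)
  have "transport j (z, a \<cdot>\<^sub>m X) = (w, a \<cdot>\<^sub>m X')"
    using transport_smult[of z X j a] assms(2) j fst_transport[OF s, of j] fst_transport[OF assms(2), of j]
    by (metis level_mats_carrier fst_conv prod.collapse snd_conv states_iff)
  then show ?thesis using orbit_class_transport[OF s, of j] by simp
qed

text \<open>The bundle of \<open>M\<close> is the quotient of the states with levels in \<open>L\<close> by the action of \<open>\<int>\<close>.\<close>

definition models :: "qmodule \<Rightarrow> int set \<Rightarrow> bool" where
  "models M L \<longleftrightarrow> nrows M = n \<and> ncols M = n \<and> fibre M = level_mats L \<and>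
     bundle_step q M = {(p, next_state p) | p. p \<in> states L}"

text \<open>The relation generated by an invertible map is the orbit relation of the cyclic group it
  generates, and that group preserves the states with levels in \<open>L\<close>.\<close>

lemma bundle_class_eq_orbit_class:
  assumes M: "models M L" and p: "p \<in> states L"
  shows "bundle_class q M p = orbit_class p"
proof -
  let ?R = "bundle_step q M \<union> (bundle_step q M)\<inverse>"
  have step: "bundle_step q M = {(p, next_state p) | p. p \<in> states L}" and fibre: "fibre M = level_mats L"
    using M by (auto simp: models_def)
  have 1: "r \<in> orbit_class p \<and> r \<in> states L" if "(p, r) \<in> ?R\<^sup>*" for r
    using that
  proof (induction rule: rtrancl_induct)
    case base
    then show ?case using p self_orbit_class by auto
  next
    case (step r' r)
    then obtain k where k: "r' = transport k p" by (auto simp: orbit_class_def)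
    from step(2) have "r = next_state r' \<and> r' \<in> states L \<or> r' = next_state r \<and> r \<in> states L"
      unfolding \<open>bundle_step q M = _\<close> by auto
    then have "r = transport (k + 1) p \<or> r = transport (k - 1) p"
      using transport_plus_1[OF p, of k] transport_minus_1[OF p, of k] prev_state_next_state[of r L] unfolding k[symmetric] by metis
    then show ?case using transport_states[OF p] unfolding orbit_class_def by blast
  qed
  have edge: "(r, next_state r) \<in> bundle_step q M" if "r \<in> states L" for r
    using that unfolding step by blast
  have 2: "(p, transport k p) \<in> ?R\<^sup>*" for k
  proof (induction k rule: int_induct[of _ 0])
    case (step1 i)
    have "(transport i p, transport (i + 1) p) \<in> ?R"
      unfolding transport_plus_1[OF p] using edge[OF transport_states[OF p]] by blast
    then show ?case by (rule rtrancl.rtrancl_into_rtrancl[OF step1(2)])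
  next
    case (step2 i)
    have "(transport (i - 1) p, transport i p) \<in> bundle_step q M"
      using edge[OF transport_states[OF p, of "i - 1"]] transport_plus_1[OF p, of "i - 1"] by simp
    then have "(transport i p, transport (i - 1) p) \<in> ?R" by auto
    then show ?case by (rule rtrancl.rtrancl_into_rtrancl[OF step2(2)])
  qed simp
  have "bundle_class q M p = {r. (p, r) \<in> ?R\<^sup>* \<and> p \<in> states L \<and> r \<in> states L}"
    unfolding bundle_class_def bundle_rel_def fibre states_def by auto
  also have "\<dots> = orbit_class p"
    using 1 2 p transport_states[OF p] unfolding orbit_class_def by blast
  finally show ?thesis .
qed

lemma bundle_total_eq: "models M L \<Longrightarrow> bundle_total q M = orbit_class ` states L"
proof -
  assume M: "models M L"
  have "bundle_total q M = bundle_class q M ` states L"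
    using M unfolding bundle_total_def quotient_def bundle_class_def models_def states_def by auto
  then show ?thesis using bundle_class_eq_orbit_class[OF M] by simp
qed

lemma bundle_proj_orbit_class:
  assumes "p \<in> states L"
  shows "bundle_proj q (orbit_class p) = qorbit q (fst p)"
  unfolding bundle_proj_def orbit_class_def
  by (simp add: fst_transport[OF assms] qorbit_powi q_not_0)

lemma orbit_class_at_point:
  assumes "v \<in> orbit_class ` states L" "bundle_proj q v = qorbit q z"
  obtains X where "(z, X) \<in> states L" "v = orbit_class (z, X)"
proof -
  obtain p where p: "p \<in> states L" "v = orbit_class p" using assms by auto
  have "z \<in> qorbit q (fst p)" using assms(2) bundle_proj_orbit_class[OF p(1)] qorbit_self p(2) by metis
  then obtain k where "z = q powi k * fst p" by (rule qorbit_memD)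
  then have "transport k p = (z, snd (transport k p))" using fst_transport[OF p(1)] by (metis prod.collapse)
  then show ?thesis using that transport_states[OF p(1)] orbit_class_transport[OF p(1)] p(2) by metis
qed

lemma bundle_add_orbit_class:
  assumes M: "models M L" and X: "(z, X) \<in> states L" and Y: "(z, Y) \<in> states L"
  shows "bundle_add q M (orbit_class (z, X)) (orbit_class (z, Y)) = orbit_class (z, X + Y)"
proof -
  have "bundle_class q M (w, X' + Y') = orbit_class (z, X + Y)"
    if "(w, X') \<in> orbit_class (z, X)" "(w, Y') \<in> orbit_class (z, Y)" for w X' Y'
  proof -
    have "(w, X') \<in> states L" "(w, Y') \<in> states L" using that orbit_class_states X Y by auto
    then have "(w, X' + Y') \<in> states L" by (auto simp: states_def add_level_mats)
    then show ?thesis using bundle_class_eq_orbit_class[OF M] orbit_class_add[OF that X Y] by simp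
  qed
  then have "{bundle_class q M (w, X' + Y') | w X' Y'. (w, X') \<in> orbit_class (z, X) \<and> (w, Y') \<in> orbit_class (z, Y)}
      = {orbit_class (z, X + Y)}"
    using self_orbit_class[of "(z, X)"] self_orbit_class[of "(z, Y)"] by blast
  then show ?thesis unfolding bundle_add_def by simp
qed

lemma bundle_smult_orbit_class:
  assumes M: "models M L" and X: "(z, X) \<in> states L"
  shows "bundle_smult q M a (orbit_class (z, X)) = orbit_class (z, a \<cdot>\<^sub>m X)"
proof -
  have *: "bundle_class q M (w, a \<cdot>\<^sub>m X') = orbit_class (z, a \<cdot>\<^sub>m X)" if "(w, X') \<in> orbit_class (z, X)" for w X'
  proof -
    have "(w, X') \<in> states L" using that orbit_class_states X by auto
    then have "(w, a \<cdot>\<^sub>m X') \<in> states L" by (auto simp: states_def smult_level_mats)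
    then show ?thesis using bundle_class_eq_orbit_class[OF M] orbit_class_smult[OF that X] by simp
  qed
  have "bundle_smult q M a (orbit_class (z, X)) = (\<Union>p\<in>orbit_class (z, X). orbit_class (z, a \<cdot>\<^sub>m X))"
    unfolding bundle_smult_def using * by (intro SUP_cong) auto
  then show ?thesis using self_orbit_class[of "(z, X)"] by auto
qed

text \<open>The union is taken over one and the same class, so it merely evaluates \<open>orbit_class (z, F z)\<close>
  at an arbitrary \<open>z\<close> in the orbit \<open>x\<close>.\<close>

definition section_of :: "complex set set \<Rightarrow> (complex \<Rightarrow> complex mat) \<Rightarrow> complex set \<Rightarrow> (complex \<times> complex mat) set" where
  "section_of V F = (\<lambda>x\<in>V. \<Union>z\<in>x. orbit_class (z, F z))"

lemma equivariant_states: "F \<in> equivariant V L \<Longrightarrow> z \<in> Eq_preimage q V \<Longrightarrow> (z, F z) \<in> states L"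
  using equivariantD(1) Eq_preimage_nonzero by (simp add: states_def)

lemma transport_equivariant:
  assumes F: "F \<in> equivariant V L" and z: "z \<in> Eq_preimage q V"
  shows "transport k (z, F z) = (q powi k * z, F (q powi k * z))"
proof (induction k rule: int_induct[of _ 0])
  have pre: "q powi k * z \<in> Eq_preimage q V" for k
    using z q_not_0 by (simp add: Eq_preimage_def qorbit_powi)
  note s = equivariant_states[OF F z]
  {
    case (step1 i)
    have e: "q powi (i + 1) * z = q * (q powi i * z)" using q_not_0 by (simp add: power_int_add)
    show ?case using equivariantD(3)[OF F pre, of i] step1(2) unfolding e transport_plus_1[OF s] next_state_def by simp
  next
    case (step2 i)
    have e: "q powi i * z = q * (q powi (i - 1) * z)" using q_not_0 by (simp add: power_int_diff)
    then have "transport i (z, F z) = next_state (q powi (i - 1) * z, F (q powi (i - 1) * z))"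
      using equivariantD(3)[OF F pre, of "i - 1"] step2(2) unfolding e by (simp add: next_state_def)
    then show ?case using prev_state_next_state[OF equivariant_states[OF F pre]] by (simp add: transport_minus_1[OF s])
  }
qed simp

lemma section_of_qorbit:
  assumes F: "F \<in> equivariant V L" and z: "z \<in> Eq_preimage q V"
  shows "section_of V F (qorbit q z) = orbit_class (z, F z)"
proof -
  have V: "qorbit q z \<in> V" using z by (simp add: Eq_preimage_def)
  have *: "orbit_class (w, F w) = orbit_class (z, F z)" if w: "w \<in> qorbit q z" for w
  proof -
    obtain k where "w = q powi k * z" using w by (rule qorbit_memD)
    then have "(w, F w) = transport k (z, F z)" by (simp add: transport_equivariant[OF F z])
    then show ?thesis by (simp only: orbit_class_transport[OF equivariant_states[OF F z]])
  qed
  have "section_of V F (qorbit q z) = (\<Union>w\<in>qorbit q z. orbit_class (w, F w))"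
    unfolding section_of_def by (rule restrict_apply'[OF V])
  also have "\<dots> = (\<Union>w\<in>qorbit q z. orbit_class (z, F z))"
    by (rule SUP_cong[OF refl *])
  also have "\<dots> = orbit_class (z, F z)" using qorbit_self[of z q] by (intro cSUP_const) blast
  finally show ?thesis .
qed

text \<open>The whole preimage serves as neighbourhood of each of its points, with \<open>F\<close> itself as local
  representative.\<close>

lemma section_of_section:
  assumes M: "models M L" and V: "openin (Eq_topology q) V" and F: "F \<in> equivariant V L"
  shows "section_of V F \<in> carrier (bundle_sections q M V)"
proof -
  have V': "V \<subseteq> Ell q" "open (Eq_preimage q V)" using V by (auto simp: openin_Eq)
  have "section_of V F x \<in> bundle_total q M \<and> bundle_proj q (section_of V F x) = x" if x: "x \<in> V" for x
  proof -
    obtain z where z: "z \<in> Eq_preimage q V" "x = qorbit q z"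
      using Ell_memD[OF x V'(1)] .
    show ?thesis
      unfolding z(2) section_of_qorbit[OF F z(1)] bundle_total_eq[OF M]
      using equivariant_states[OF F z(1)] bundle_proj_orbit_class by auto
  qed
  moreover have "\<exists>U X. open U \<and> z\<^sub>0 \<in> U \<and> U \<subseteq> Eq_preimage q V \<and>
        (\<forall>z\<in>U. X z \<in> fibre M) \<and>
        (\<forall>a<nrows M. \<forall>b<ncols M. (\<lambda>z. X z $$ (a, b)) holomorphic_on U) \<and>
        (\<forall>z\<in>U. section_of V F (qorbit q z) = bundle_class q M (z, X z))" if "z\<^sub>0 \<in> Eq_preimage q V" for z\<^sub>0
  proof (intro exI[of _ "Eq_preimage q V"] exI[of _ F] conjI)
    show "\<forall>z\<in>Eq_preimage q V. section_of V F (qorbit q z) = bundle_class q M (z, F z)"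
      using section_of_qorbit[OF F] bundle_class_eq_orbit_class[OF M equivariant_states[OF F]] by simp
  qed (use that V' M equivariantD[OF F] in \<open>auto simp: models_def holomorphic_mat_def\<close>)
  ultimately show ?thesis
    unfolding bundle_sections_def holomorphic_section_def by (auto simp: section_of_def)
qed

text \<open>Freeness of the action turns a section into a unique function on the preimage. Local
  representatives coincide with it, hence it is holomorphic, and comparing the values over \<open>z\<close> and
  \<open>q * z\<close> gives the functional equation.\<close>

lemma section_eq_section_of:
  assumes M: "models M L" and V: "openin (Eq_topology q) V"
    and s: "s \<in> carrier (bundle_sections q M V)"
  obtains F where "F \<in> equivariant V L" "s = section_of V F"
proof -
  have V': "V \<subseteq> Ell q" using V by (auto simp: openin_Eq)
  have dims: "nrows M = n" "ncols M = n" "fibre M = level_mats L" using M by (simp_all add: models_def)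
  have ext: "s \<in> extensional V" and hs: "holomorphic_section q M V s"
    using s by (simp_all add: bundle_sections_def)
  note h = hs[unfolded holomorphic_section_def dims bundle_total_eq[OF M]]
  have tot: "s x \<in> orbit_class ` states L" and proj: "bundle_proj q (s x) = x" if "x \<in> V" for x
    using bspec[OF conjunct1[OF h] that] by simp_all
  have loc: "\<exists>U X. open U \<and> z0 \<in> U \<and> U \<subseteq> Eq_preimage q V \<and>
        (\<forall>z\<in>U. X z \<in> level_mats L) \<and>
        (\<forall>a<n. \<forall>b<n. (\<lambda>z. X z $$ (a, b)) holomorphic_on U) \<and>
        (\<forall>z\<in>U. s (qorbit q z) = bundle_class q M (z, X z))" if "z0 \<in> Eq_preimage q V" for z0
    using bspec[OF conjunct2[OF h] that] .
  have "\<exists>X. (z, X) \<in> states L \<and> s (qorbit q z) = orbit_class (z, X)" if "z \<in> Eq_preimage q V" for z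
  proof -
    have "qorbit q z \<in> V" using that by (simp add: Eq_preimage_def)
    then show ?thesis
      using orbit_class_at_point[where v = "s (qorbit q z)" and z = z, OF tot proj] by blast
  qed
  then obtain F where F: "\<And>z. z \<in> Eq_preimage q V \<Longrightarrow> (z, F z) \<in> states L"
    "\<And>z. z \<in> Eq_preimage q V \<Longrightarrow> s (qorbit q z) = orbit_class (z, F z)"
    by metis
  have "F \<in> equivariant V L"
  proof (rule equivariantI)
    fix z assume z: "z \<in> Eq_preimage q V"
    show "F z \<in> level_mats L" using F(1)[OF z] by (simp add: states_def)
    have qz: "q * z \<in> Eq_preimage q V" using z by (simp add: Eq_preimage_mult q_not_0)
    have "orbit_class (q * z, F (q * z)) = orbit_class (z, F z)"
      using F(2)[OF z] F(2)[OF qz] by (simp add: qorbit_mult q_not_0)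
    also have "\<dots> = orbit_class (next_state (z, F z))"
      using orbit_class_transport[OF F(1)[OF z], of 1] by (simp add: transport_def)
    finally have "orbit_class (q * z, F (q * z)) = orbit_class (q * z, step z (F z))" by (simp add: next_state_def)
    then show "F (q * z) = step z (F z)" by (rule orbit_class_inj[OF _ F(1)[OF qz]])
  next
    have "(\<lambda>z. F z $$ (a, b)) field_differentiable (at z0 within Eq_preimage q V)"
      if ab: "a < n" "b < n" and z0: "z0 \<in> Eq_preimage q V" for a b z0
    proof -
      obtain U X where U: "open U" "z0 \<in> U" "U \<subseteq> Eq_preimage q V" "\<forall>z\<in>U. X z \<in> level_mats L"
        "\<forall>a<n. \<forall>b<n. (\<lambda>z. X z $$ (a, b)) holomorphic_on U"
        "\<forall>z\<in>U. s (qorbit q z) = bundle_class q M (z, X z)"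
        using loc[OF z0] by blast
      have "F z = X z" if "z \<in> U" for z
      proof -
        have zp: "z \<in> Eq_preimage q V" using that U by auto
        then have "(z, X z) \<in> states L" using U(4) that Eq_preimage_nonzero by (auto simp: states_def)
        then have "orbit_class (z, F z) = orbit_class (z, X z)"
          using U(6) that F(2)[OF zp] bundle_class_eq_orbit_class[OF M] by simp
        then show ?thesis by (rule orbit_class_inj[OF _ F(1)[OF zp]])
      qed
      then have "(\<lambda>z. F z $$ (a, b)) holomorphic_on U"
        using U(5) ab by (metis (no_types, lifting) holomorphic_transform)
      then have "(\<lambda>z. F z $$ (a, b)) field_differentiable (at z0)"
        using U(1,2) holomorphic_on_imp_differentiable_at by blast
      then show ?thesis by (rule field_differentiable_at_within)
    qed
    then show "holomorphic_mat F (Eq_preimage q V)"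
      unfolding holomorphic_mat_def holomorphic_on_def by blast
  qed
  moreover have "s = section_of V F"
  proof (rule extensionalityI[OF ext])
    show "section_of V F \<in> extensional V" by (simp add: section_of_def)
    fix x assume "x \<in> V"
    then obtain z where z: "z \<in> Eq_preimage q V" "x = qorbit q z"
      using Ell_memD[OF _ V'] by blast
    show "s x = section_of V F x" unfolding z(2) F(2)[OF z(1)] section_of_qorbit[OF \<open>F \<in> equivariant V L\<close> z(1)] ..
  qed
  ultimately show ?thesis using that by blast
qed

lemma section_of_eq_iff:
  assumes V: "openin (Eq_topology q) V" and F: "F \<in> equivariant V L" and G: "G \<in> equivariant V L'"
  shows "section_of V F = section_of V G \<longleftrightarrow> (\<forall>z\<in>Eq_preimage q V. F z = G z)"
proof
  assume *: "section_of V F = section_of V G"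
  show "\<forall>z\<in>Eq_preimage q V. F z = G z"
  proof
    fix z assume z: "z \<in> Eq_preimage q V"
    have "orbit_class (z, F z) = orbit_class (z, G z)"
      using * section_of_qorbit[OF F z] section_of_qorbit[OF G z] by simp
    then show "F z = G z" by (rule orbit_class_inj[OF _ equivariant_states[OF F z]])
  qed
next
  assume *: "\<forall>z\<in>Eq_preimage q V. F z = G z"
  have V': "V \<subseteq> Ell q" using V by (auto simp: openin_Eq)
  show "section_of V F = section_of V G"
  proof (rule extensionalityI)
    fix x assume "x \<in> V"
    then obtain z where z: "z \<in> Eq_preimage q V" "x = qorbit q z"
      using Ell_memD[OF _ V'] by blast
    show "section_of V F x = section_of V G x"
      unfolding z(2) section_of_qorbit[OF F z(1)] section_of_qorbit[OF G z(1)] using * z(1) by simp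
  qed (auto simp: section_of_def)
qed

lemma section_of_add:
  assumes M: "models M L" and V: "openin (Eq_topology q) V" and F: "F \<in> equivariant V L" and G: "G \<in> equivariant V L"
  shows "section_of V (\<lambda>z. F z + G z) = section_of V F \<oplus>\<^bsub>bundle_sections q M V\<^esub> section_of V G"
proof (rule extensionalityI)
  have V': "V \<subseteq> Ell q" using V by (auto simp: openin_Eq)
  fix x assume x: "x \<in> V"
  then obtain z where z: "z \<in> Eq_preimage q V" "x = qorbit q z"
    using Ell_memD[OF _ V'] by blast
  show "section_of V (\<lambda>z. F z + G z) x = (section_of V F \<oplus>\<^bsub>bundle_sections q M V\<^esub> section_of V G) x"
    using x bundle_add_orbit_class[OF M equivariant_states[OF F z(1)] equivariant_states[OF G z(1)]]
      section_of_qorbit[OF F z(1)] section_of_qorbit[OF G z(1)] section_of_qorbit[OF equivariant_add[OF F G] z(1)]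
    by (simp add: bundle_sections_def z(2))
qed (auto simp: section_of_def bundle_sections_def)

lemma section_of_smult:
  assumes M: "models M L" and V: "openin (Eq_topology q) V" and F: "F \<in> equivariant V L"
    and g: "g \<in> Eq_hol q V"
  shows "section_of V (\<lambda>z. g (qorbit q z) \<cdot>\<^sub>m F z) = g \<odot>\<^bsub>bundle_sections q M V\<^esub> section_of V F"
proof (rule extensionalityI)
  have V': "V \<subseteq> Ell q" using V by (auto simp: openin_Eq)
  fix x assume x: "x \<in> V"
  then obtain z where z: "z \<in> Eq_preimage q V" "x = qorbit q z"
    using Ell_memD[OF _ V'] by blast
  show "section_of V (\<lambda>z. g (qorbit q z) \<cdot>\<^sub>m F z) x = (g \<odot>\<^bsub>bundle_sections q M V\<^esub> section_of V F) x"
    using x bundle_smult_orbit_class[OF M equivariant_states[OF F z(1)]]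
      section_of_qorbit[OF F z(1)] section_of_qorbit[OF equivariant_smult[OF F g] z(1)]
    by (simp add: bundle_sections_def z(2))
qed (auto simp: section_of_def bundle_sections_def)

lemma section_of_restrict: "V' \<subseteq> V \<Longrightarrow> section_of V' F = restrict (section_of V F) V'"
  by (auto simp: section_of_def fun_eq_iff)

end

section \<open>Growth along spirals\<close>

lemma gauss_prod_bounded:
  assumes "Q > 1" "x \<ge> 0"
  obtains M where "M \<ge> 1" "\<And>k. gauss_prod Q x k \<le> M"
proof -
  have "Bseq (gauss_prod Q x)"
    using gauss_prod_tendsto_0[OF assms] by (intro convergent_imp_Bseq) (auto simp: convergent_def)
  then obtain M where M: "\<And>k. norm (gauss_prod Q x k) \<le> M" by (auto simp: Bseq_def)
  show ?thesis
  proof (rule that[of "max 1 M"])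
    show "gauss_prod Q x k \<le> max 1 M" for k
      using abs_le_D1[OF M[of k, unfolded real_norm_def]] by (rule max.coboundedI2)
  qed simp
qed

lemma power_powr_commute: "(x :: real) > 0 \<Longrightarrow> (x ^ k) powr t = (x powr t) ^ k"
  by (induction k) (simp_all add: powr_mult)

text \<open>Any positive power of the Gaussian product beats any exponential: write \<open>D\<close> as
  \<open>y powr \<epsilon>\<close> and absorb \<open>y\<close> into the argument.\<close>

lemma gauss_prod_powr_tendsto_0:
  assumes "Q > 1" "x > 0" "D > 0" "\<epsilon> > 0"
  shows "(\<lambda>k. D ^ k * gauss_prod Q x k powr \<epsilon>) \<longlonglongrightarrow> 0"
proof -
  define y where "y = D powr (1 / \<epsilon>)"
  have y: "y > 0" "y powr \<epsilon> = D" using assms by (simp_all add: y_def powr_powr)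
  have "(\<lambda>k. gauss_prod Q (y * x) k powr \<epsilon>) \<longlonglongrightarrow> 0"
    using gauss_prod_tendsto_0[of Q "y * x"] assms y(1)
    by (intro tendsto_zero_powrI[where b = \<epsilon>] always_eventually) (auto simp: gauss_prod_nonneg)
  moreover have "gauss_prod Q (y * x) k powr \<epsilon> = D ^ k * gauss_prod Q x k powr \<epsilon>" for k
  proof -
    have "(y ^ k) powr \<epsilon> = D ^ k"
      using y by (simp add: power_powr_commute)
    then show ?thesis
      using assms y gauss_prod_pos[of Q x k] by (simp add: gauss_prod_mult powr_mult)
  qed
  ultimately show ?thesis by simp
qed

context graded_conjugation
begin

abbreviation "Q \<equiv> norm q"

text \<open>The functional equation solved \<open>k\<close> times downwards. Scaling and conjugation by \<open>E\<close> commute, so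
  the scalars collect into a single product.\<close>

lemma equivariant_spiral_mat:
  assumes F: "F \<in> equivariant V L" and z: "z \<in> Eq_preimage q V"
  shows "F (z / q ^ k) = scale (1 / (\<Prod>l=1..k. z / q ^ l)) ((untwist ^^ k) (F z))"
proof (induction k)
  case 0
  show ?case using scale_1[OF equivariantD(2)[OF F z]] by simp
next
  case (Suc k)
  let ?w = "z / q ^ Suc k" and ?P = "\<Prod>l=1..k. z / q ^ l"
  have z0: "z \<noteq> 0" using z by (rule Eq_preimage_nonzero)
  have w: "?w \<in> Eq_preimage q V" "?w \<noteq> 0" "q * ?w = z / q ^ k"
    using z z0 q_not_0 by (simp_all add: Eq_preimage_divide del: power_Suc) simp
  have c: "(untwist ^^ k) (F z) \<in> carrier_mat n n"
    by (induction k) (auto simp: untwist_carrier equivariantD(2)[OF F z])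
  have "F ?w = unstep ?w (step ?w (F ?w))"
    using w equivariantD(2)[OF F] by (simp add: unstep_step del: power_Suc)
  also have "step ?w (F ?w) = F (z / q ^ k)"
    using equivariantD(3)[OF F w(1)] w(3) by simp
  also have "unstep ?w (F (z / q ^ k)) = scale (1 / ?w) (scale (1 / ?P) (untwist ((untwist ^^ k) (F z))))"
    unfolding unstep_def Suc scale_untwist[OF c] ..
  also have "\<dots> = scale (1 / ?w * (1 / ?P)) (untwist ((untwist ^^ k) (F z)))"
    using z0 q_not_0 by (intro scale_scale) auto
  finally show ?case by (simp add: mult.commute)
qed

text \<open>The key formula: down a spiral an entry of level \<open>d\<close> is the \<open>d\<close>-th power of the Gaussian
  product times an entry of \<open>E'\<^sup>k (F z) E\<^sup>k\<close>.\<close>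

lemma norm_equivariant_spiral:
  assumes F: "F \<in> equivariant V L" and z: "z \<in> Eq_preimage q V" and ab: "a < n" "b < n"
  shows "norm (F (z / q ^ k) $$ (a, b)) =
    gauss_prod Q (norm z) k powi (m a - m b) * norm (((untwist ^^ k) (F z)) $$ (a, b))"
proof -
  let ?P = "\<Prod>l=1..k. z / q ^ l"
  have "norm ?P = gauss_prod Q (norm z) k"
    unfolding gauss_prod_def by (simp add: norm_divide norm_power flip: prod_norm)
  moreover have "(1 / ?P) powi (m b - m a) = ?P powi (m a - m b)"
    by (metis inverse_eq_divide minus_diff_eq power_int_inverse power_int_minus inverse_inverse_eq)
  ultimately show ?thesis
    unfolding equivariant_spiral_mat[OF F z] using ab
    by (simp add: scale_def norm_mult norm_power_int)
qed

text \<open>Iterated conjugation distorts norms at most exponentially, in both directions. The upper bound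
  proves flatness, the lower bound its optimality.\<close>

lemma conjugation_bound:
  obtains C where "C \<ge> 1"
    "\<And>X k. X \<in> carrier_mat n n \<Longrightarrow> entry_norm n ((untwist ^^ k) X) \<le> C ^ k * entry_norm n X"
    "\<And>X k. X \<in> carrier_mat n n \<Longrightarrow> entry_norm n X \<le> C ^ k * entry_norm n ((untwist ^^ k) X)"
proof -
  define C where "C = real n * real n * entry_norm n E * entry_norm n E' + 1"
  have C: "C \<ge> 1" unfolding C_def by (simp add: entry_norm_nonneg)
  have i: "entry_norm n (untwist X) \<le> C * entry_norm n X" if "X \<in> carrier_mat n n" for X
    using entry_norm_triple_product[OF E_carrier(2) that E_carrier(1)]
    by (simp add: untwist_def C_def mult_ac)
  have c: "entry_norm n (twist X) \<le> C * entry_norm n X" if "X \<in> carrier_mat n n" for X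
    using entry_norm_triple_product[OF E_carrier(1) that E_carrier(2)]
    by (simp add: twist_def C_def mult_ac)
  have car: "(untwist ^^ k) X \<in> carrier_mat n n" if "X \<in> carrier_mat n n" for X k
    using that by (induction k) (auto simp: untwist_carrier)
  show ?thesis
  proof (rule that[OF C])
    fix X :: "complex mat" and k assume X: "X \<in> carrier_mat n n"
    show "entry_norm n ((untwist ^^ k) X) \<le> C ^ k * entry_norm n X"
    proof (induction k)
      case (Suc k)
      have "entry_norm n ((untwist ^^ Suc k) X) \<le> C * entry_norm n ((untwist ^^ k) X)"
        using i[OF car[OF X, of k]] by simp
      also have "\<dots> \<le> C * (C ^ k * entry_norm n X)"
        using Suc C by (intro mult_left_mono) auto
      finally show ?case by (simp add: mult_ac)
    qed simp
    show "entry_norm n X \<le> C ^ k * entry_norm n ((untwist ^^ k) X)"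
    proof (induction k)
      case (Suc k)
      have "entry_norm n ((untwist ^^ k) X) \<le> C * entry_norm n ((untwist ^^ Suc k) X)"
        using c[OF car[OF X, of "Suc k"]] twist_untwist[OF car[OF X, of k]] by simp
      then have "C ^ k * entry_norm n ((untwist ^^ k) X) \<le> C ^ k * (C * entry_norm n ((untwist ^^ Suc k) X))"
        using C by (intro mult_left_mono) auto
      with Suc show ?case by (simp add: mult_ac)
    qed simp
  qed
qed

lemma equivariant_entry_bounded_on_compact:
  assumes F: "F \<in> equivariant V L" and K: "compact K" "K \<subseteq> Eq_preimage q V"
  obtains B where "B > 0" "\<And>z. z \<in> K \<Longrightarrow> entry_norm n (F z) \<le> B"
proof -
  have "continuous_on K (\<lambda>z. entry_norm n (F z))"
    unfolding entry_norm_def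
    using equivariantD(4)[OF F] K(2) holomorphic_on_imp_continuous_on holomorphic_on_subset
    unfolding holomorphic_mat_def
    by (intro continuous_on_sum continuous_on_norm) blast
  then have "bounded ((\<lambda>z. entry_norm n (F z)) ` K)"
    using K(1) compact_continuous_image compact_imp_bounded by blast
  then show ?thesis using that unfolding bounded_pos by (metis abs_le_D1 imageI real_norm_def)
qed

lemma equivariant_compact_spiral_bound:
  assumes F: "F \<in> equivariant V L" and K: "compact K" "K \<subseteq> Eq_preimage q V"
  obtains C B R where "C \<ge> 1" "B > 0" "R > 0" "\<And>z. z \<in> K \<Longrightarrow> norm z \<le> R"
    "\<And>z k a b. z \<in> K \<Longrightarrow> a < n \<Longrightarrow> b < n \<Longrightarrow>
      norm (F (z / q ^ k) $$ (a, b)) \<le> gauss_prod Q (norm z) k powi (m a - m b) * (C ^ k * B)"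
proof -
  obtain C where C: "C \<ge> 1"
    "\<And>X k. X \<in> carrier_mat n n \<Longrightarrow> entry_norm n ((untwist ^^ k) X) \<le> C ^ k * entry_norm n X"
    by (rule conjugation_bound) blast
  obtain B where B: "B > 0" "\<And>z. z \<in> K \<Longrightarrow> entry_norm n (F z) \<le> B"
    using equivariant_entry_bounded_on_compact[OF F K] by blast
  obtain R where R: "R > 0" "\<And>z. z \<in> K \<Longrightarrow> norm z \<le> R"
    using K(1) compact_imp_bounded bounded_pos by metis
  show ?thesis
  proof (rule that[OF C(1) B(1) R])
    fix z k a b assume z: "z \<in> K" and ab: "a < n" "b < n"
    have zp: "z \<in> Eq_preimage q V" using z K by auto
    have "norm (((untwist ^^ k) (F z)) $$ (a, b)) \<le> entry_norm n ((untwist ^^ k) (F z))"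
      by (rule norm_entry_le[OF ab])
    also have "\<dots> \<le> C ^ k * entry_norm n (F z)" by (rule C(2)[OF equivariantD(2)[OF F zp]])
    also have "\<dots> \<le> C ^ k * B" using B(2)[OF z] C(1) by (intro mult_left_mono) auto
    finally show "norm (F (z / q ^ k) $$ (a, b)) \<le> gauss_prod Q (norm z) k powi (m a - m b) * (C ^ k * B)"
      unfolding norm_equivariant_spiral[OF F zp ab]
      using gauss_prod_nonneg[OF norm_q, of "norm z" k]
      by (intro mult_left_mono zero_le_power_int) auto
  qed
qed

text \<open>In positive level \<open>d\<close> the Gaussian factor occurs at least once, which dominates both the
  exponential distortion and the factor \<open>1 / z ^ j\<close>; entries of other levels vanish.\<close>

lemma equivariant_flat:
  assumes F: "F \<in> equivariant V L" and L: "L \<subseteq> {0<..}" and ab: "a < n" "b < n"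
  shows "flat_on q (Eq_preimage q V) (\<lambda>z. F z $$ (a, b))"
  unfolding flat_on_def
proof (intro allI impI)
  fix j :: nat and K :: "complex set" assume K: "compact K \<and> K \<subseteq> Eq_preimage q V"
  show "bounded ((\<lambda>z. F z $$ (a, b) / z ^ j) ` spiral_hull q K)"
  proof (cases "m a - m b \<in> L")
    case False
    have "F z $$ (a, b) / z ^ j = 0" if zK: "z \<in> spiral_hull q K" for z
    proof -
      from zK have "z \<in> Eq_preimage q V"
        using K q_not_0 by (auto simp: spiral_hull_def Eq_preimage_divide)
      then show ?thesis using equivariantD(1)[OF F] False ab by (simp add: level_mats_def)
    qed
    then show ?thesis unfolding bounded_iff by (intro exI[of _ 0]) auto
  next
    case True
    then obtain e where e: "m a - m b = int (Suc e)"
      using L by (metis greaterThan_iff gr0_implies_Suc of_nat_0_less_iff subsetD zero_less_imp_eq_int)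
    obtain C B R where C: "C \<ge> 1" "B > 0" "R > 0" "\<And>z. z \<in> K \<Longrightarrow> norm z \<le> R"
      "\<And>z k a b. z \<in> K \<Longrightarrow> a < n \<Longrightarrow> b < n \<Longrightarrow>
        norm (F (z / q ^ k) $$ (a, b)) \<le> gauss_prod Q (norm z) k powi (m a - m b) * (C ^ k * B)"
      using equivariant_compact_spiral_bound[OF F] K by metis
    obtain M where M: "M \<ge> 1" "\<And>k. gauss_prod Q R k \<le> M"
      using gauss_prod_bounded[OF norm_q, of R] C(3) by auto
    let ?C = "C * Q ^ j"
    have C': "?C \<ge> 0" using C(1) by simp
    obtain M' where M': "M' \<ge> 1" "\<And>k. gauss_prod Q (?C * R) k \<le> M'"
      using gauss_prod_bounded[OF norm_q, of "?C * R"] C(1,3) by auto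
    have "0 \<notin> K" using K by (auto simp: Eq_preimage_def)
    moreover have "closed K" using K compact_imp_closed by blast
    ultimately obtain r where r: "r > 0" "\<And>z. z \<in> K \<Longrightarrow> r \<le> dist 0 z"
      using separate_point_closed[of K 0] by auto
    have "norm (F (z / q ^ k) $$ (a, b) / (z / q ^ k) ^ j) \<le> M ^ e * M' * B / r ^ j"
      if z: "z \<in> K" for z k
    proof -
      let ?g = "gauss_prod Q (norm z) k"
      have g: "0 \<le> ?g" "?g \<le> gauss_prod Q R k"
        using gauss_prod_nonneg[OF norm_q] gauss_prod_mono[OF norm_q] C(4)[OF z] by auto
      have rz: "r ^ j \<le> norm z ^ j" using r z by (intro power_mono) auto
      have rj: "r ^ j > 0" using r by simp
      have "norm (F (z / q ^ k) $$ (a, b) / (z / q ^ k) ^ j) =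
          norm (F (z / q ^ k) $$ (a, b)) * (Q ^ j) ^ k / norm z ^ j"
        by (simp add: norm_divide norm_power norm_mult divide_simps power_divide flip: power_mult)
          (simp add: mult.commute norm_mult norm_power)
      also have "\<dots> \<le> (?g ^ Suc e * (C ^ k * B)) * (Q ^ j) ^ k / r ^ j"
        using C(5)[OF z ab, of k] rz rj unfolding e power_int_of_nat
        by (intro frac_le mult_right_mono mult_nonneg_nonneg zero_le_power) (use g C in auto)
      \<comment> \<open>one factor absorbs the exponentials, the others stay bounded\<close>
      also have "\<dots> = ?g ^ e * (?C ^ k * ?g) * B / r ^ j"
        by (simp add: power_mult_distrib)
      also have "\<dots> \<le> M ^ e * M' * B / r ^ j"
      proof (intro divide_right_mono mult_right_mono mult_mono power_mono)
        have "?C ^ k * ?g \<le> ?C ^ k * gauss_prod Q R k"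
          using g C' by (intro mult_left_mono) auto
        also have "\<dots> \<le> M'" using M'(2)[of k] unfolding gauss_prod_mult .
        finally show "?C ^ k * ?g \<le> M'" .
        show "?g \<le> M" using g(2) M(2)[of k] by linarith
      qed (use g C M C' rj in auto)
      finally show ?thesis .
    qed
    then show ?thesis
      unfolding bounded_iff spiral_hull_def by (intro exI[of _ "M ^ e * M' * B / r ^ j"]) auto
  qed
qed

text \<open>The weight \<open>\<bar>\<theta>\<bar>\<^sup>t\<close> in the definition of \<open>t\<close>-flatness, with value \<open>1\<close> for \<open>t = 0\<close> even at
  the zeros of theta.\<close>

definition theta_weight :: "complex \<Rightarrow> real \<Rightarrow> complex \<Rightarrow> real" where
  "theta_weight c t z = (if t = 0 then 1 else norm (theta q c z) powr t)"

lemma theta_weight_spiral: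
  assumes "c \<noteq> 0" "z \<noteq> 0"
  shows "theta_weight c t (z / q ^ k) =
    theta_weight c t z * (norm c ^ k) powr t / gauss_prod Q (norm z) k powr t"
proof (cases "t = 0")
  case True
  then show ?thesis using gauss_prod_pos[OF norm_q, of "norm z" k] assms by (simp add: theta_weight_def)
next
  case False
  let ?g = "gauss_prod Q (norm z) k"
  have g: "?g > 0" using gauss_prod_pos[OF norm_q] assms by simp
  have e: "gauss_prod Q (norm z / norm c) k = ?g / norm c ^ k"
    using gauss_prod_mult[of Q "1 / norm c" "norm z" k] by (simp add: power_one_over)
  then have "norm (theta q c (z / q ^ k)) = norm (theta q c z) * norm c ^ k / ?g"
    using norm_theta_spiral[OF norm_q assms, of k] g assms(1) unfolding e by (simp add: field_simps)
  then show ?thesis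
    using False g by (simp add: theta_weight_def powr_divide powr_mult)
qed

lemma theta_weight_bounded_on_compact:
  assumes "c \<noteq> 0" "t \<ge> 0" "compact K" "0 \<notin> K"
  obtains T where "T > 0" "\<And>z. z \<in> K \<Longrightarrow> theta_weight c t z \<le> T"
proof -
  have "continuous_on K (theta q c)"
    using holomorphic_on_imp_continuous_on[OF holomorphic_on_subset[OF holomorphic_theta[OF norm_q assms(1)]]] assms(4)
    by auto
  then have "bounded (theta q c ` K)"
    using assms(3) compact_continuous_image compact_imp_bounded by blast
  then obtain T where T: "T > 0" "\<And>z. z \<in> K \<Longrightarrow> norm (theta q c z) \<le> T"
    unfolding bounded_pos by auto
  show ?thesis
  proof (rule that[of "max 1 (T powr t)"])
    fix z assume "z \<in> K"
    then have "norm (theta q c z) powr t \<le> T powr t" using T assms(2) by (intro powr_mono2) auto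
    then show "theta_weight c t z \<le> max 1 (T powr t)"
      by (auto simp: theta_weight_def intro: max.coboundedI2)
  qed simp
qed

text \<open>At level \<open>d\<close> the weighted entry carries the Gaussian product with exponent \<open>d - t \<ge> 0\<close>, which is
  bounded. What remains is exponential in \<open>k\<close>, that is, polynomial in \<open>1 / norm z\<close>.\<close>

lemma equivariant_t_flat:
  assumes F: "F \<in> equivariant V L" and L: "\<And>d. d \<in> L \<Longrightarrow> t \<le> real_of_int d"
    and c: "c \<noteq> 0" and t: "t \<ge> 0" and ab: "a < n" "b < n"
  shows "t_flat_on q c t (Eq_preimage q V) (\<lambda>z. F z $$ (a, b))"
  unfolding t_flat_on_def theta_weight_def[symmetric]
proof (intro allI impI)
  fix K :: "complex set" assume K: "compact K \<and> K \<subseteq> Eq_preimage q V"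
  then have hull: "z \<in> Eq_preimage q V" if "z \<in> spiral_hull q K" for z
    using that q_not_0 by (auto simp: spiral_hull_def Eq_preimage_divide)
  show "\<exists>N::nat. (\<lambda>z. norm (F z $$ (a, b)) * theta_weight c t z)
     \<in> O[at 0 within spiral_hull q K](\<lambda>z. 1 / norm z ^ N)"
  proof (cases "m a - m b \<in> L")
    case False
    have "F z $$ (a, b) = 0" if "z \<in> spiral_hull q K" for z
      using equivariantD(1)[OF F hull[OF that]] False ab by (simp add: level_mats_def)
    then have "(\<lambda>z. norm (F z $$ (a, b)) * theta_weight c t z) \<in> O[at 0 within spiral_hull q K](\<lambda>z. 1 / norm z ^ 0)"
      by (intro bigoI[of _ 0]) (auto simp: eventually_at_filter intro!: always_eventually)
    then show ?thesis by (rule exI)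
  next
    case True
    define d where "d = m a - m b"
    have d: "t \<le> real_of_int d" using L[OF True] by (simp add: d_def)
    obtain C B R where C: "C \<ge> 1" "B > 0" "R > 0" "\<And>z. z \<in> K \<Longrightarrow> norm z \<le> R"
      "\<And>z k a b. z \<in> K \<Longrightarrow> a < n \<Longrightarrow> b < n \<Longrightarrow>
        norm (F (z / q ^ k) $$ (a, b)) \<le> gauss_prod Q (norm z) k powi (m a - m b) * (C ^ k * B)"
      using equivariant_compact_spiral_bound[OF F] K by metis
    obtain M where M: "M \<ge> 1" "\<And>k. gauss_prod Q R k \<le> M"
      using gauss_prod_bounded[OF norm_q, of R] C(3) by auto
    have "0 \<notin> K" using K by (auto simp: Eq_preimage_def)
    then obtain T where T: "T > 0" "\<And>z. z \<in> K \<Longrightarrow> theta_weight c t z \<le> T"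
      using theta_weight_bounded_on_compact[OF c t] K by metis
    \<comment> \<open>the exponent of the polynomial growth only has to beat the exponential rate\<close>
    obtain N where N: "C * norm c powr t < Q ^ N" using real_arch_pow[OF norm_q] by blast
    let ?A = "M powr (d - t) * B * T"
    have *: "norm (F (z / q ^ k) $$ (a, b)) * theta_weight c t (z / q ^ k) \<le> ?A * R ^ N * (1 / norm (z / q ^ k) ^ N)"
      if z: "z \<in> K" for z k
    proof -
      let ?g = "gauss_prod Q (norm z) k"
      have z0: "z \<noteq> 0" using z \<open>0 \<notin> K\<close> by auto
      have g: "0 < ?g" "?g \<le> gauss_prod Q R k"
        using gauss_prod_pos[OF norm_q] gauss_prod_mono[OF norm_q] C(4)[OF z] z0 by auto
      have w: "theta_weight c t z \<ge> 0" by (simp add: theta_weight_def)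
      have ck: "(norm c ^ k) powr t = (norm c powr t) ^ k"
        using c by (simp add: power_powr_commute)
      have "norm (F (z / q ^ k) $$ (a, b)) * theta_weight c t (z / q ^ k) \<le>
          (?g powi d * (C ^ k * B)) * (theta_weight c t z * (norm c ^ k) powr t / ?g powr t)"
        unfolding theta_weight_spiral[OF c z0] using C(5)[OF z ab, of k] w
        by (intro mult_right_mono) (auto simp: d_def)
      also have "\<dots> = ?g powr (d - t) * B * theta_weight c t z * (C * norm c powr t) ^ k"
        using g by (simp add: powr_diff powr_real_of_int' ck power_mult_distrib)
      also have "\<dots> \<le> ?A * (Q ^ N) ^ k"
        using N C M(1) g M(2)[of k] d w T(2)[OF z] T(1)
        by (intro mult_mono power_mono powr_mono2 mult_nonneg_nonneg) auto
      also have "\<dots> \<le> ?A * (R ^ N * (1 / norm (z / q ^ k) ^ N))"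
      proof (rule mult_left_mono)
        have "1 \<le> (R / norm z) ^ N" using C(4)[OF z] z0 by (intro one_le_power) auto
        then have "(Q ^ N) ^ k * 1 \<le> (Q ^ N) ^ k * (R / norm z) ^ N"
          by (intro mult_left_mono) auto
        also have "\<dots> = R ^ N * (1 / norm (z / q ^ k) ^ N)"
          by (simp add: norm_divide norm_power power_divide mult.commute flip: power_mult)
        finally show "(Q ^ N) ^ k \<le> R ^ N * (1 / norm (z / q ^ k) ^ N)" by simp
      qed (use C M T in auto)
      finally show ?thesis by (simp add: mult_ac)
    qed
    have "(\<lambda>z. norm (F z $$ (a, b)) * theta_weight c t z) \<in> O[at 0 within spiral_hull q K](\<lambda>z. 1 / norm z ^ N)"
    proof (rule bigoI[of _ "?A * R ^ N"])
      have "norm (norm (F z $$ (a, b)) * theta_weight c t z) \<le> ?A * R ^ N * norm (1 / norm z ^ N)"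
        if "z \<in> spiral_hull q K" for z
        using that * by (auto simp: spiral_hull_def theta_weight_def abs_mult)
      then show "\<forall>\<^sub>F z in at 0 within spiral_hull q K.
          norm (norm (F z $$ (a, b)) * theta_weight c t z) \<le> ?A * R ^ N * norm (1 / norm z ^ N)"
        by (auto simp: eventually_at_filter intro!: always_eventually)
    qed
    then show ?thesis by (rule exI)
  qed
qed

text \<open>If \<open>d < t\<close>, then polynomial growth of the weighted entry bounds the entries of
  \<open>untwist\<^sup>k (F z)\<close> of level \<open>d\<close> by an exponential times a positive power of the Gaussian
  product. Conjugating back costs only an exponential, so the part of \<open>F z\<close> of level \<open>d\<close> is smaller
  than a sequence that tends to \<open>0\<close>.\<close>

lemma t_flat_imp_level_zero:
  assumes F: "F \<in> equivariant V L" and z: "z \<in> Eq_preimage q V"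
    and c: "c \<noteq> 0" and t: "t > 0" and d: "real_of_int d < t"
    and theta: "theta q c z \<noteq> 0"
    and flat: "\<And>a b. a < n \<Longrightarrow> b < n \<Longrightarrow> \<exists>N::nat. (\<lambda>z. norm (F z $$ (a, b)) * theta_weight c t z)
       \<in> O[at 0 within spiral_hull q {z}](\<lambda>z. 1 / norm z ^ N)"
  shows "proj {d} (F z) = 0\<^sub>m n n"
proof -
  have z0: "z \<noteq> 0" using z by (rule Eq_preimage_nonzero)
  obtain C where C: "C \<ge> 1"
    "\<And>X k. X \<in> carrier_mat n n \<Longrightarrow> entry_norm n X \<le> C ^ k * entry_norm n ((untwist ^^ k) X)"
    by (rule conjugation_bound) blast
  let ?g = "gauss_prod Q (norm z)"
  have g: "?g k > 0" for k using gauss_prod_pos[OF norm_q] z0 by simp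
  have lim: "filterlim (\<lambda>k. z / q ^ k) (at 0 within spiral_hull q {z}) sequentially"
    unfolding filterlim_at
  proof
    have "(\<lambda>k. z * (1 / q) ^ k) \<longlonglongrightarrow> z * 0"
      using norm_q by (intro tendsto_intros LIMSEQ_power_zero) (simp add: norm_divide divide_simps)
    then show "(\<lambda>k. z / q ^ k) \<longlonglongrightarrow> 0" by (simp add: power_one_over)
    show "\<forall>\<^sub>F k in sequentially. z / q ^ k \<in> spiral_hull q {z} \<and> z / q ^ k \<noteq> 0"
      using z0 q_not_0 unfolding spiral_hull_def by (intro always_eventually allI conjI) auto
  qed
  have entry: "(\<lambda>k. C ^ k * norm (((untwist ^^ k) (F z)) $$ (a, b))) \<longlonglongrightarrow> 0"
    if ab: "a < n" "b < n" "m a - m b = d" for a b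
  proof -
    let ?X = "\<lambda>k. norm (((untwist ^^ k) (F z)) $$ (a, b))"
    obtain N where "(\<lambda>z. norm (F z $$ (a, b)) * theta_weight c t z)
       \<in> O[at 0 within spiral_hull q {z}](\<lambda>z. 1 / norm z ^ N)" using flat[OF ab(1,2)] by blast
    then obtain A where A: "A > 0" "\<forall>\<^sub>F w in at 0 within spiral_hull q {z}.
        norm (norm (F w $$ (a, b)) * theta_weight c t w) \<le> A * norm (1 / norm w ^ N)"
      by (elim landau_o.bigE) auto
    have w: "theta_weight c t z > 0" using theta t by (simp add: theta_weight_def)
    have ck: "(norm c ^ k) powr t = (norm c powr t) ^ k" for k
      using c by (simp add: power_powr_commute)
    have ct: "norm c powr t > 0" using c by simp
    have ev: "\<forall>\<^sub>F k in sequentially. C ^ k * ?X k \<le>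
        (A / norm z ^ N / theta_weight c t z) * ((C * Q ^ N / norm c powr t) ^ k * ?g k powr (t - d))"
      using eventually_compose_filterlim[OF A(2) lim]
    proof (rule eventually_mono)
      fix k
      assume *: "norm (norm (F (z / q ^ k) $$ (a, b)) * theta_weight c t (z / q ^ k)) \<le> A * norm (1 / norm (z / q ^ k) ^ N)"
      have gp: "?g k powr (t - d) > 0" using g[of k] by simp
      from * have "?g k powi d * ?X k * (theta_weight c t z * (norm c ^ k) powr t / ?g k powr t) \<le> A * (Q ^ N) ^ k / norm z ^ N"
        using norm_equivariant_spiral[OF F z ab(1,2), of k] ab(3) w g[of k]
        by (simp add: theta_weight_spiral[OF c z0] norm_divide norm_power power_divide abs_mult flip: power_mult)
          (simp add: mult_ac)
      then have "?X k * (theta_weight c t z * (norm c powr t) ^ k) / ?g k powr (t - d) \<le> A * (Q ^ N) ^ k / norm z ^ N"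
        using g[of k] by (simp add: powr_diff powr_real_of_int' ck mult_ac)
      then have "?X k \<le> (A * (Q ^ N) ^ k / norm z ^ N) * ?g k powr (t - d) / (theta_weight c t z * (norm c powr t) ^ k)"
        unfolding pos_divide_le_eq[OF gp] pos_le_divide_eq[OF mult_pos_pos[OF w zero_less_power[OF ct]]] .
      then have "C ^ k * ?X k \<le> C ^ k * ((A * (Q ^ N) ^ k / norm z ^ N) * ?g k powr (t - d) / (theta_weight c t z * (norm c powr t) ^ k))"
        using C(1) by (intro mult_left_mono) auto
      also have "\<dots> = (A / norm z ^ N / theta_weight c t z) * ((C * Q ^ N / norm c powr t) ^ k * ?g k powr (t - d))"
        by (simp only: power_mult_distrib power_divide times_divide_eq_left times_divide_eq_right
            divide_divide_eq_left mult_ac)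
      finally show "C ^ k * ?X k \<le> (A / norm z ^ N / theta_weight c t z) * ((C * Q ^ N / norm c powr t) ^ k * ?g k powr (t - d))" .
    qed
    have "(\<lambda>k. (A / norm z ^ N / theta_weight c t z) * ((C * Q ^ N / norm c powr t) ^ k * ?g k powr (t - d)))
        \<longlonglongrightarrow> (A / norm z ^ N / theta_weight c t z) * 0"
      using C(1) norm_q ct d z0 q_not_0
      by (intro tendsto_mult tendsto_const gauss_prod_powr_tendsto_0) auto
    then have u: "(\<lambda>k. (A / norm z ^ N / theta_weight c t z) * ((C * Q ^ N / norm c powr t) ^ k * ?g k powr (t - d)))
        \<longlonglongrightarrow> 0" by simp
    show ?thesis
      by (rule tendsto_sandwich[OF _ ev tendsto_const u]) (use C(1) in auto)
  qed
  \<comment> \<open>an upper bound for the part of level \<open>d\<close> of \<open>F z\<close>, whatever the value of \<open>k\<close>\<close>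
  let ?Y = "\<lambda>k. \<Sum>a<n. \<Sum>b<n. C ^ k * norm (proj {d} ((untwist ^^ k) (F z)) $$ (a, b))"
  have "?Y \<longlonglongrightarrow> (\<Sum>a<n. \<Sum>b<n. 0)"
  proof (intro tendsto_sum)
    fix a b assume "a \<in> {..<n}" "b \<in> {..<n}"
    then show "(\<lambda>k. C ^ k * norm (proj {d} ((untwist ^^ k) (F z)) $$ (a, b))) \<longlonglongrightarrow> 0"
      using entry[of a b] by (cases "m a - m b = d") (auto simp: proj_def)
  qed
  moreover have "entry_norm n (proj {d} (F z)) \<le> ?Y k" for k
  proof -
    have car: "(untwist ^^ k) (F z) \<in> carrier_mat n n" for k
      by (induction k) (auto simp: untwist_carrier equivariantD(2)[OF F z])
    have "(untwist ^^ k) (proj {d} (F z)) = proj {d} ((untwist ^^ k) (F z))"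
      by (induction k) (auto simp: untwist_proj[OF car])
    then show ?thesis
      using C(2)[OF level_mats_carrier[OF proj_level_mats], of "{d}" "F z" k]
      by (simp add: entry_norm_def sum_distrib_left)
  qed
  ultimately have "entry_norm n (proj {d} (F z)) \<le> 0"
    by (intro LIMSEQ_le_const[of ?Y]) auto
  then have "norm (proj {d} (F z) $$ (a, b)) \<le> 0" if "a < n" "b < n" for a b
    using norm_entry_le[OF that, of "proj {d} (F z)"] by linarith
  then show ?thesis by (intro eq_matI) (auto simp: proj_def)
qed

end

section \<open>Germs of flat matrices on sectors\<close>

lemma sector_divide: "sector q W \<Longrightarrow> z \<in> W \<Longrightarrow> z / q ^ k \<in> W"
proof (induction k)
  case (Suc k)
  then have "z / q ^ k / q \<in> W" unfolding sector_def by blast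
  then show ?case by (simp add: mult.commute)
qed simp

lemma sector_Int: "sector q W \<Longrightarrow> sector q W' \<Longrightarrow> sector q (W \<inter> W')"
  unfolding sector_def by auto

lemma sector_subset_Eq_preimage: "sector q W \<Longrightarrow> horizon q W = V \<Longrightarrow> W \<subseteq> Eq_preimage q V"
  by (auto simp: sector_def horizon_def Eq_preimage_def)

lemma sector_Eq_preimage:
  assumes "openin (Eq_topology q) V" "q \<noteq> 0"
  shows "sector q (Eq_preimage q V)"
  using assms Eq_preimage_divide[of q _ 1 V] by (auto simp: sector_def openin_Eq Eq_preimage_def)

lemma horizon_Eq_preimage: "openin (Eq_topology q) V \<Longrightarrow> horizon q (Eq_preimage q V) = V"
  by (simp add: horizon_def openin_Eq image_qorbit_Eq_preimage)

text \<open>A sector meets the orbit of \<open>z\<close>, and being stable under division by \<open>q\<close> it contains all points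
  of that orbit from some point on.\<close>

lemma sector_absorbs:
  assumes W: "sector q W" and q: "q \<noteq> 0" and z: "qorbit q z \<in> horizon q W"
  shows "\<exists>k. z / q ^ k \<in> W"
proof -
  obtain w where w: "w \<in> W" "qorbit q z = qorbit q w" using z by (auto simp: horizon_def)
  then have "z \<in> qorbit q w" using qorbit_self by metis
  then obtain j where j: "z = q powi j * w" by (rule qorbit_memD)
  show ?thesis
  proof (cases "j \<ge> 0")
    case True
    then have "z / q ^ nat j = w" using j q by (simp add: power_int_def)
    then show ?thesis using w by metis
  next
    case False
    then have "z = w / q ^ nat (- j)" using j by (simp add: power_int_def field_simps)
    then show ?thesis using sector_divide[OF W w(1)] by (intro exI[of _ 0]) simp
  qed
qed

text \<open>By the previous lemma two sectors meet on each orbit that lies in both horizons. This makes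
  equality of germs transitive.\<close>

lemma horizon_Int:
  assumes "sector q W" "sector q W'" "q \<noteq> 0"
  shows "horizon q (W \<inter> W') = horizon q W \<inter> horizon q W'"
proof
  show "horizon q W \<inter> horizon q W' \<subseteq> horizon q (W \<inter> W')"
  proof
    fix x assume x: "x \<in> horizon q W \<inter> horizon q W'"
    then obtain z where z: "z \<in> W" "x = qorbit q z" by (auto simp: horizon_def)
    then obtain k where "z / q ^ k \<in> W'" using sector_absorbs[OF assms(2,3), of z] x by auto
    moreover have "z / q ^ k \<in> W" by (rule sector_divide[OF assms(1) z(1)])
    ultimately show "x \<in> horizon q (W \<inter> W')"
      unfolding horizon_def z(2) by (intro image_eqI[of _ _ "z / q ^ k"]) (simp_all add: qorbit_divide assms(3))
  qed
qed (auto simp: horizon_def)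

lemma sym_germ_rel: "(p, p') \<in> germ_rel q n V \<Longrightarrow> (p', p) \<in> germ_rel q n V"
  unfolding germ_rel_def by (fastforce simp: Int_commute)

lemma trans_germ_rel:
  assumes "(p, p') \<in> germ_rel q n V" "(p', p'') \<in> germ_rel q n V" "q \<noteq> 0"
  shows "(p, p'') \<in> germ_rel q n V"
proof -
  obtain W f W' f' W'' f'' where p: "p = (W, f)" "p' = (W', f')" "p'' = (W'', f'')"
    by (metis prod.collapse)
  from assms obtain S S' where S: "sector q S" "horizon q S = V" "S \<subseteq> W \<inter> W'" "\<forall>z\<in>S. f z = f' z"
    "sector q S'" "horizon q S' = V" "S' \<subseteq> W' \<inter> W''" "\<forall>z\<in>S'. f' z = f'' z"
    and reps: "(W, f) \<in> flat_reps q n V" "(W'', f'') \<in> flat_reps q n V"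
    unfolding p germ_rel_def by auto
  have "sector q (S \<inter> S')" "horizon q (S \<inter> S') = V" "S \<inter> S' \<subseteq> W \<inter> W''" "\<forall>z\<in>S \<inter> S'. f z = f'' z"
    using S sector_Int[OF S(1,5)] horizon_Int[OF S(1,5) assms(3)] by auto
  then show ?thesis unfolding p germ_rel_def using reps by auto
qed

lemma germ_eq_germ: "(p, p') \<in> germ_rel q n V \<Longrightarrow> q \<noteq> 0 \<Longrightarrow> germ q n V p = germ q n V p'"
  unfolding germ_def using trans_germ_rel sym_germ_rel by fast

context graded_conjugation
begin

definition germ_of :: "complex set set \<Rightarrow> (complex \<Rightarrow> complex mat) \<Rightarrow> mat_germ" where
  "germ_of V F = germ q n V (Eq_preimage q V, F)"

text \<open>Equality of germs of \<open>p\<close> and \<open>F\<close>, without the condition that \<open>p\<close> is a pair of flat functions on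
  a sector. Sums and multiples can be compared in this form without a proof that they are flat.\<close>

definition represents :: "complex set set \<Rightarrow> complex set \<times> (complex \<Rightarrow> complex mat) \<Rightarrow> (complex \<Rightarrow> complex mat) \<Rightarrow> bool" where
  "represents V p F \<longleftrightarrow> (\<exists>W. sector q W \<and> horizon q W = V \<and> W \<subseteq> fst p \<and> (\<forall>z\<in>W. snd p z = F z))"

lemma equivariant_flat_rep:
  assumes V: "openin (Eq_topology q) V" and F: "F \<in> equivariant V {0<..}"
  shows "(Eq_preimage q V, F) \<in> flat_reps q n V"
  unfolding flat_reps_def
  using sector_Eq_preimage[OF V q_not_0] horizon_Eq_preimage[OF V] equivariantD(2)[OF F] equivariantD(4)[OF F] equivariant_flat[OF F subset_refl]
  by (simp add: holomorphic_mat_def)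

lemma mem_germ_of:
  assumes V: "openin (Eq_topology q) V" and F: "F \<in> equivariant V {0<..}"
  shows "p \<in> germ_of V F \<longleftrightarrow> p \<in> flat_reps q n V \<and> represents V p F"
proof -
  have "p \<in> germ_of V F \<longleftrightarrow> p \<in> flat_reps q n V \<and> (\<exists>W. sector q W \<and> horizon q W = V \<and>
      W \<subseteq> Eq_preimage q V \<inter> fst p \<and> (\<forall>z\<in>W. F z = snd p z))"
    using equivariant_flat_rep[OF V F] by (cases p) (auto simp: germ_of_def germ_def germ_rel_def)
  then show ?thesis
    unfolding represents_def using sector_subset_Eq_preimage by (metis Int_subset_iff)
qed

lemma germ_eq_germ_of:
  assumes V: "openin (Eq_topology q) V" and F: "F \<in> equivariant V {0<..}"
    and p: "p \<in> flat_reps q n V" "represents V p F"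
  shows "germ q n V p = germ_of V F"
proof -
  have "p \<in> germ q n V (Eq_preimage q V, F)" using mem_germ_of[OF V F] p by (simp add: germ_of_def)
  then show ?thesis using germ_eq_germ[OF _ q_not_0] by (metis germ_of_def germ_def ImageE singletonD)
qed

text \<open>The class of a pair that is not a flat representative is empty. Hence the unions that
  define the module operations can be computed from one pair of representatives.\<close>

lemma germ_subset_germ_of:
  assumes V: "openin (Eq_topology q) V" and F: "F \<in> equivariant V {0<..}" and p: "represents V p F"
  shows "germ q n V p \<subseteq> germ_of V F"
proof (cases "p \<in> flat_reps q n V")
  case True
  then show ?thesis using germ_eq_germ_of[OF V F _ p] by simp
next
  case False
  then show ?thesis by (auto simp: germ_def germ_rel_def)
qed

lemma represents_self: "openin (Eq_topology q) V \<Longrightarrow> represents V (Eq_preimage q V, F) F"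
  unfolding represents_def
  by (intro exI[of _ "Eq_preimage q V"]) (simp add: sector_Eq_preimage q_not_0 horizon_Eq_preimage)

lemma self_germ_of: "openin (Eq_topology q) V \<Longrightarrow> F \<in> equivariant V {0<..} \<Longrightarrow> (Eq_preimage q V, F) \<in> germ_of V F"
  by (simp add: mem_germ_of equivariant_flat_rep represents_self)

text \<open>The functional equation propagates values upwards along a spiral.\<close>

lemma equivariant_determined_below:
  assumes F: "F \<in> equivariant V L" and G: "G \<in> equivariant V L'" and z: "z \<in> Eq_preimage q V"
    and eq: "F (z / q ^ k) = G (z / q ^ k)"
  shows "F z = G z"
  using eq
proof (induction k)
  case (Suc k)
  let ?w = "z / q ^ Suc k"
  have w: "?w \<in> Eq_preimage q V" "q * ?w = z / q ^ k"
    using z q_not_0 by (simp_all add: Eq_preimage_divide del: power_Suc) simp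
  show ?case
    using Suc equivariantD(3)[OF F w(1)] equivariantD(3)[OF G w(1)] unfolding w(2) by simp
qed simp

text \<open>Every spiral enters the sector on which two equal germs agree, and from there the functional
  equation propagates equality to the whole preimage.\<close>

lemma germ_of_eq_iff:
  assumes V: "openin (Eq_topology q) V" and F: "F \<in> equivariant V {0<..}" and G: "G \<in> equivariant V {0<..}"
  shows "germ_of V F = germ_of V G \<longleftrightarrow> (\<forall>z\<in>Eq_preimage q V. F z = G z)"
proof
  assume "germ_of V F = germ_of V G"
  then have "represents V (Eq_preimage q V, G) F"
    using self_germ_of[OF V G] mem_germ_of[OF V F] by metis
  then obtain W where W: "sector q W" "horizon q W = V" "\<forall>z\<in>W. G z = F z"
    by (auto simp: represents_def)
  show "\<forall>z\<in>Eq_preimage q V. F z = G z"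
  proof
    fix z assume z: "z \<in> Eq_preimage q V"
    then obtain k where "z / q ^ k \<in> W"
      using sector_absorbs[OF W(1) q_not_0, of z] W(2) by (auto simp: Eq_preimage_def)
    then have "F (z / q ^ k) = G (z / q ^ k)" using W(3) by simp
    then show "F z = G z" by (rule equivariant_determined_below[OF F G z])
  qed
next
  assume "\<forall>z\<in>Eq_preimage q V. F z = G z"
  then have "represents V (Eq_preimage q V, G) F"
    using represents_self[OF V, of G] sector_subset_Eq_preimage
    unfolding represents_def by (metis fst_conv snd_conv subsetD)
  then show "germ_of V F = germ_of V G"
    using germ_eq_germ_of[OF V F equivariant_flat_rep[OF V G]] by (simp add: germ_of_def)
qed

text \<open>The preimage of \<open>V\<close> is the increasing union of the sets \<open>q\<^sup>k W\<close>. The functional equation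
  continues \<open>f\<close> from each of them to the next, consistently because \<open>W\<close> contains all points of a
  spiral below any of its points.\<close>

lemma extend_to_Eq_preimage:
  assumes W: "sector q W" "horizon q W = V"
    and f: "\<And>z. z \<in> W \<Longrightarrow> f z \<in> level_mats L" "holomorphic_mat f W"
    and eq: "\<And>z. z \<in> W \<Longrightarrow> q * z \<in> W \<Longrightarrow> f (q * z) = step z (f z)"
  obtains F where "F \<in> equivariant V L" "\<And>z. z \<in> W \<Longrightarrow> F z = f z"
proof -
  \<comment> \<open>\<open>g k\<close> is the continuation of \<open>f\<close> to \<open>U k = q\<^sup>k W\<close>\<close>
  define U where "U k = {z. z / q ^ k \<in> W}" for k
  define g where "g = rec_nat f (\<lambda>k h z. step (z / q) (h (z / q)))"
  have g0: "g 0 = f" and gSuc: "\<And>k z. g (Suc k) z = step (z / q) (g k (z / q))"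
    by (simp_all add: g_def)
  have W0: "z \<noteq> 0" if "z \<in> W" for z using that W by (auto simp: sector_def)
  have USuc: "z \<in> U (Suc k) \<longleftrightarrow> z / q \<in> U k" for z k by (simp add: U_def)
  have Umono: "z \<in> U (Suc k)" if "z \<in> U k" for z k
    using that W(1) unfolding U_def sector_def by (fastforce simp: mult.commute)
  have Umono': "U j \<subseteq> U k" if "j \<le> k" for j k
    using that by (induction k rule: dec_induct) (use Umono in auto)
  have open_U: "open (U k)" for k
  proof -
    have "continuous_on UNIV (\<lambda>z. z / q ^ k)" by (intro continuous_intros) (use q_not_0 in auto)
    then have "open ((\<lambda>z. z / q ^ k) -` W)" using W(1) open_vimage unfolding sector_def by blast
    then show ?thesis by (simp add: U_def vimage_def)
  qed
  have U_pre: "U k \<subseteq> Eq_preimage q V" for k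
    using sector_subset_Eq_preimage[OF W] q_not_0 by (auto simp: U_def Eq_preimage_divide[of q _ k])
  have pre_U: "\<exists>k. z \<in> U k" if "z \<in> Eq_preimage q V" for z
    using sector_absorbs[OF W(1) q_not_0, of z] W(2) that by (auto simp: Eq_preimage_def U_def)
  have gfib: "g k z \<in> level_mats L" if "z \<in> U k" for k z
    using that by (induction k arbitrary: z) (auto simp: g0 gSuc f U_def[of 0] USuc intro: step_level_mats)
  have gcons: "g (Suc k) z = g k z" if "z \<in> U k" for k z
    using that
  proof (induction k arbitrary: z)
    case 0
    then have z: "z \<in> W" "z / q \<in> W" using W(1) by (auto simp: U_def sector_def)
    then show ?case using eq[of "z / q"] q_not_0 by (simp add: g0 gSuc)
  next
    case (Suc k)
    then have "g (Suc k) (z / q) = g k (z / q)" by (simp add: USuc)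
    then show ?case by (simp add: gSuc)
  qed
  have gcons': "g k z = g j z" if "z \<in> U j" "j \<le> k" for j k z
    using that(2)
  proof (induction k rule: dec_induct)
    case (step k)
    then show ?case using gcons[of z k] Umono'[OF step(1)] that(1) by auto
  qed simp
  have ghol: "holomorphic_mat (g k) (U k)" for k
  proof (induction k)
    case 0
    then show ?case using f(2) by (simp add: g0 U_def)
  next
    case (Suc k)
    have "(\<lambda>z. g k (z / q) $$ (a, b)) holomorphic_on U (Suc k)" if "a < n" "b < n" for a b
    proof -
      have 1: "(\<lambda>z. g k z $$ (a, b)) holomorphic_on U k" using Suc that by (simp add: holomorphic_mat_def)
      have 2: "(\<lambda>z. z / q) holomorphic_on U (Suc k)" by (intro holomorphic_intros) (use q_not_0 in auto)
      have 3: "(\<lambda>z. z / q) ` U (Suc k) \<subseteq> U k" by (auto simp: USuc)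
      show ?thesis using holomorphic_on_compose_gen[OF 2 1 3] by (simp add: comp_def)
    qed
    then have "holomorphic_mat (\<lambda>z. g k (z / q)) (U (Suc k))" by (simp add: holomorphic_mat_def)
    then have "holomorphic_mat (\<lambda>z. step (z / q) (g k (z / q))) (U (Suc k))"
    proof (rule holomorphic_mat_step)
      fix z assume z: "z \<in> U (Suc k)"
      then show "g k (z / q) \<in> carrier_mat n n" using gfib USuc level_mats_carrier by blast
      show "z / q \<noteq> 0" using z W0[of "z / q ^ Suc k"] by (auto simp: U_def)
    next
      show "(\<lambda>z. z / q) holomorphic_on U (Suc k)" by (intro holomorphic_intros) (use q_not_0 in auto)
    qed
    then show ?case by (simp add: gSuc[abs_def])
  qed
  define F where "F z = g (LEAST k. z \<in> U k) z" for z
  have Fg: "F z = g k z" if "z \<in> U k" for k z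
    unfolding F_def by (rule gcons'[symmetric]) (use that in \<open>auto intro: LeastI Least_le\<close>)
  show ?thesis
  proof (rule that)
    show "F z = f z" if "z \<in> W" for z
      using Fg[of z 0] that by (simp add: U_def g0)
    show "F \<in> equivariant V L"
    proof (rule equivariantI)
      fix z assume z: "z \<in> Eq_preimage q V"
      then obtain k where k: "z \<in> U k" using pre_U by blast
      then show "F z \<in> level_mats L" using Fg gfib by simp
      have "q * z \<in> U (Suc k)" using k q_not_0 by (simp add: USuc)
      then show "F (q * z) = step z (F z)"
        using Fg k q_not_0 by (simp add: gSuc)
    next
      have "(\<lambda>z. F z $$ (a, b)) field_differentiable (at z0 within Eq_preimage q V)"
        if ab: "a < n" "b < n" and z0: "z0 \<in> Eq_preimage q V" for a b z0
      proof -
        obtain k where k: "z0 \<in> U k" using z0 pre_U by blast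
        have "(\<lambda>z. g k z $$ (a, b)) holomorphic_on U k" using ghol ab by (simp add: holomorphic_mat_def)
        then have "(\<lambda>z. F z $$ (a, b)) holomorphic_on U k"
          by (rule holomorphic_transform) (simp add: Fg)
        then have "(\<lambda>z. F z $$ (a, b)) field_differentiable (at z0)"
          using open_U k holomorphic_on_imp_differentiable_at by blast
        then show ?thesis by (rule field_differentiable_at_within)
      qed
      then show "holomorphic_mat F (Eq_preimage q V)"
        unfolding holomorphic_mat_def holomorphic_on_def by blast
    qed
  qed
qed

text \<open>The module of germs \<open>\<lambda>\<^sub>I\<close> expressed by levels and the map \<open>step\<close> in place of blocks and the
  matrix \<open>A\<^sub>0\<close>.\<close>

definition flat_germs :: "complex set set \<Rightarrow> (complex set \<Rightarrow> complex, mat_germ) module" where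
  "flat_germs V = (flat_mats q n V)\<lparr>carrier := {x \<in> carrier (flat_mats q n V). \<exists>(W, f)\<in>x.
     (\<forall>z\<in>W. f z \<in> level_mats {0<..}) \<and> (\<forall>z\<in>W. q * z \<in> W \<longrightarrow> f (q * z) = step z (f z))}\<rparr>"

text \<open>Solutions on a sector extend to the preimage; conversely a solution on the preimage, which is
  itself a sector, is flat by the growth estimates.\<close>

lemma carrier_flat_germs:
  assumes V: "openin (Eq_topology q) V"
  shows "carrier (flat_germs V) = germ_of V ` equivariant V {0<..}"
proof (intro equalityI subsetI)
  fix x assume "x \<in> carrier (flat_germs V)"
  then obtain W f where x: "x \<in> flat_reps q n V // germ_rel q n V" "(W, f) \<in> x"
    and f: "\<forall>z\<in>W. f z \<in> level_mats {0<..}" "\<forall>z\<in>W. q * z \<in> W \<longrightarrow> f (q * z) = step z (f z)"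
    by (auto simp: flat_germs_def flat_mats_def)
  obtain p where p: "x = germ q n V p" using x(1) by (auto simp: quotient_def germ_def)
  then have r: "(p, (W, f)) \<in> germ_rel q n V" using x(2) by (simp add: germ_def)
  then have rep: "(W, f) \<in> flat_reps q n V" by (auto simp: germ_rel_def)
  then have W: "sector q W" "horizon q W = V" "holomorphic_mat f W"
    by (auto simp: flat_reps_def holomorphic_mat_def)
  obtain F where F: "F \<in> equivariant V {0<..}" "\<And>z. z \<in> W \<Longrightarrow> F z = f z"
    by (rule extend_to_Eq_preimage[OF W(1,2) _ W(3), of "{0<..}"]) (use f in auto)
  have "represents V (W, f) F" unfolding represents_def using W F(2) by (intro exI[of _ W]) auto
  then have "x = germ_of V F"
    using germ_eq_germ_of[OF V F(1) rep] germ_eq_germ[OF r q_not_0] p by simp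
  then show "x \<in> germ_of V ` equivariant V {0<..}" using F(1) by blast
next
  fix x assume "x \<in> germ_of V ` equivariant V {0<..}"
  then obtain F where F: "F \<in> equivariant V {0<..}" "x = germ_of V F" by blast
  have "x \<in> flat_reps q n V // germ_rel q n V"
    unfolding F(2) germ_of_def germ_def by (rule quotientI[OF equivariant_flat_rep[OF V F(1)]])
  moreover have "(Eq_preimage q V, F) \<in> x" using self_germ_of[OF V F(1)] F(2) by simp
  ultimately show "x \<in> carrier (flat_germs V)"
    unfolding flat_germs_def flat_mats_def using equivariantD[OF F(1)] by auto
qed

lemma flat_germs_zero: "\<zero>\<^bsub>flat_germs V\<^esub> = germ_of V (\<lambda>_. 0\<^sub>m n n)"
  by (simp add: flat_germs_def flat_mats_def germ_of_def)

lemma represents_combine: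
  assumes "represents V p F" "represents V p' F'"
  shows "\<exists>W. sector q W \<and> horizon q W = V \<and> W \<subseteq> fst p \<inter> fst p' \<and>
    (\<forall>z\<in>W. snd p z = F z \<and> snd p' z = F' z)"
proof -
  obtain W W' where W: "sector q W" "horizon q W = V" "W \<subseteq> fst p" "\<forall>z\<in>W. snd p z = F z"
    "sector q W'" "horizon q W' = V" "W' \<subseteq> fst p'" "\<forall>z\<in>W'. snd p' z = F' z"
    using assms by (auto simp: represents_def)
  show ?thesis
    using W sector_Int[OF W(1,5)] horizon_Int[OF W(1,5) q_not_0] by (intro exI[of _ "W \<inter> W'"]) auto
qed

lemma flat_germs_add:
  assumes V: "openin (Eq_topology q) V" and F: "F \<in> equivariant V {0<..}" and G: "G \<in> equivariant V {0<..}"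
  shows "germ_of V F \<oplus>\<^bsub>flat_germs V\<^esub> germ_of V G = germ_of V (\<lambda>z. F z + G z)"
proof -
  note FG = equivariant_add[OF F G]
  have "germ_of V F \<oplus>\<^bsub>flat_germs V\<^esub> germ_of V G =
      (\<Union>(W, f)\<in>germ_of V F. \<Union>(W', f')\<in>germ_of V G. germ q n V (W \<inter> W', \<lambda>z. f z + f' z))"
    by (simp add: flat_germs_def flat_mats_def)
  also have "\<dots> = germ_of V (\<lambda>z. F z + G z)"
  proof
    have "germ q n V (W \<inter> W', \<lambda>z. f z + f' z) \<subseteq> germ_of V (\<lambda>z. F z + G z)"
      if "(W, f) \<in> germ_of V F" "(W', f') \<in> germ_of V G" for W f W' f'
    proof (rule germ_subset_germ_of[OF V FG])
      have "represents V (W, f) F" "represents V (W', f') G"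
        using that mem_germ_of[OF V F] mem_germ_of[OF V G] by auto
      from represents_combine[OF this] show "represents V (W \<inter> W', \<lambda>z. f z + f' z) (\<lambda>z. F z + G z)"
        unfolding represents_def by auto
    qed
    then show "(\<Union>(W, f)\<in>germ_of V F. \<Union>(W', f')\<in>germ_of V G. germ q n V (W \<inter> W', \<lambda>z. f z + f' z)) \<subseteq>
        germ_of V (\<lambda>z. F z + G z)"
      by blast
    have "germ q n V (Eq_preimage q V \<inter> Eq_preimage q V, \<lambda>z. F z + G z) \<subseteq>
        (\<Union>(W, f)\<in>germ_of V F. \<Union>(W', f')\<in>germ_of V G. germ q n V (W \<inter> W', \<lambda>z. f z + f' z))"
      using self_germ_of[OF V F] self_germ_of[OF V G] by blast
    then show "germ_of V (\<lambda>z. F z + G z) \<subseteq>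
        (\<Union>(W, f)\<in>germ_of V F. \<Union>(W', f')\<in>germ_of V G. germ q n V (W \<inter> W', \<lambda>z. f z + f' z))"
      by (simp add: germ_of_def)
  qed
  finally show ?thesis .
qed

lemma flat_germs_smult:
  assumes V: "openin (Eq_topology q) V" and F: "F \<in> equivariant V {0<..}" and g: "g \<in> Eq_hol q V"
  shows "g \<odot>\<^bsub>flat_germs V\<^esub> germ_of V F = germ_of V (\<lambda>z. g (qorbit q z) \<cdot>\<^sub>m F z)"
proof -
  note gF = equivariant_smult[OF F g]
  have "g \<odot>\<^bsub>flat_germs V\<^esub> germ_of V F = (\<Union>(W, f)\<in>germ_of V F. germ q n V (W, \<lambda>z. g (qorbit q z) \<cdot>\<^sub>m f z))"
    by (simp add: flat_germs_def flat_mats_def)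
  also have "\<dots> = germ_of V (\<lambda>z. g (qorbit q z) \<cdot>\<^sub>m F z)"
  proof
    have "germ q n V (W, \<lambda>z. g (qorbit q z) \<cdot>\<^sub>m f z) \<subseteq> germ_of V (\<lambda>z. g (qorbit q z) \<cdot>\<^sub>m F z)"
      if "(W, f) \<in> germ_of V F" for W f
    proof (rule germ_subset_germ_of[OF V gF])
      have "represents V (W, f) F" using that mem_germ_of[OF V F] by auto
      then show "represents V (W, \<lambda>z. g (qorbit q z) \<cdot>\<^sub>m f z) (\<lambda>z. g (qorbit q z) \<cdot>\<^sub>m F z)"
        unfolding represents_def by auto
    qed
    then show "(\<Union>(W, f)\<in>germ_of V F. germ q n V (W, \<lambda>z. g (qorbit q z) \<cdot>\<^sub>m f z)) \<subseteq> germ_of V (\<lambda>z. g (qorbit q z) \<cdot>\<^sub>m F z)"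
      by blast
    show "germ_of V (\<lambda>z. g (qorbit q z) \<cdot>\<^sub>m F z) \<subseteq> (\<Union>(W, f)\<in>germ_of V F. germ q n V (W, \<lambda>z. g (qorbit q z) \<cdot>\<^sub>m f z))"
      using self_germ_of[OF V F] unfolding germ_of_def[of V "\<lambda>z. g (qorbit q z) \<cdot>\<^sub>m F z"] by blast
  qed
  finally show ?thesis .
qed

lemma germ_of_restrict:
  assumes V: "openin (Eq_topology q) V" and V': "openin (Eq_topology q) V'" "V' \<subseteq> V"
    and F: "F \<in> equivariant V {0<..}"
  shows "flat_mats_res q n V V' (germ_of V F) = germ_of V' F"
proof -
  note F' = equivariant_subset[OF F V'(2)]
  have "germ q n V' (W \<inter> Eq_preimage q V', f) \<subseteq> germ_of V' F" if "(W, f) \<in> germ_of V F" for W f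
  proof (rule germ_subset_germ_of[OF V'(1) F'])
    have "represents V (W, f) F" using that mem_germ_of[OF V F] by auto
    then obtain S where S: "sector q S" "horizon q S = V" "S \<subseteq> W" "\<forall>z\<in>S. f z = F z"
      by (auto simp: represents_def)
    note s = sector_Eq_preimage[OF V'(1) q_not_0]
    have "horizon q (S \<inter> Eq_preimage q V') = V'"
      using horizon_Int[OF S(1) s q_not_0] S(2) horizon_Eq_preimage[OF V'(1)] V'(2) by auto
    then show "represents V' (W \<inter> Eq_preimage q V', f) F"
      unfolding represents_def using S sector_Int[OF S(1) s]
      by (intro exI[of _ "S \<inter> Eq_preimage q V'"]) auto
  qed
  moreover have "germ q n V' (Eq_preimage q V \<inter> Eq_preimage q V', F) \<subseteq> flat_mats_res q n V V' (germ_of V F)"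
    unfolding flat_mats_res_def using self_germ_of[OF V F] by blast
  moreover have "Eq_preimage q V \<inter> Eq_preimage q V' = Eq_preimage q V'"
    using V'(2) by (auto simp: Eq_preimage_def)
  ultimately show ?thesis
    unfolding flat_mats_res_def germ_of_def by (auto simp: UN_subset_iff)
qed

section \<open>The grading\<close>

lemma abelian_monoid_flat_germs:
  assumes V: "openin (Eq_topology q) V"
  shows "abelian_monoid (flat_germs V)"
proof (rule abelian_monoidI)
  note c = carrier_flat_germs[OF V]
  show "\<zero>\<^bsub>flat_germs V\<^esub> \<in> carrier (flat_germs V)" unfolding flat_germs_zero c using equivariant_zero by blast
  fix x y assume "x \<in> carrier (flat_germs V)" "y \<in> carrier (flat_germs V)"
  then obtain F G where F: "F \<in> equivariant V {0<..}" "x = germ_of V F" and G: "G \<in> equivariant V {0<..}" "y = germ_of V G"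
    unfolding c by blast
  show "x \<oplus>\<^bsub>flat_germs V\<^esub> y \<in> carrier (flat_germs V)"
    unfolding F(2) G(2) flat_germs_add[OF V F(1) G(1)] c using equivariant_add[OF F(1) G(1)] by blast
  have car: "F z \<in> carrier_mat n n" "G z \<in> carrier_mat n n" if "z \<in> Eq_preimage q V" for z
    using that equivariantD(2) F(1) G(1) by blast+
  show "x \<oplus>\<^bsub>flat_germs V\<^esub> y = y \<oplus>\<^bsub>flat_germs V\<^esub> x"
    unfolding F(2) G(2) flat_germs_add[OF V F(1) G(1)] flat_germs_add[OF V G(1) F(1)]
    using germ_of_eq_iff[OF V equivariant_add[OF F(1) G(1)] equivariant_add[OF G(1) F(1)]] car comm_add_mat by blast
  show "\<zero>\<^bsub>flat_germs V\<^esub> \<oplus>\<^bsub>flat_germs V\<^esub> x = x"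
    unfolding F(2) flat_germs_zero flat_germs_add[OF V equivariant_zero F(1)]
    using germ_of_eq_iff[OF V equivariant_add[OF equivariant_zero F(1)] F(1)] car left_add_zero_mat by blast
  fix w assume "w \<in> carrier (flat_germs V)"
  then obtain H where H: "H \<in> equivariant V {0<..}" "w = germ_of V H" unfolding c by blast
  have "F z + G z + H z = F z + (G z + H z)" if "z \<in> Eq_preimage q V" for z
    using assoc_add_mat[OF car[OF that] equivariantD(2)[OF H(1) that]] .
  then show "x \<oplus>\<^bsub>flat_germs V\<^esub> y \<oplus>\<^bsub>flat_germs V\<^esub> w = x \<oplus>\<^bsub>flat_germs V\<^esub> (y \<oplus>\<^bsub>flat_germs V\<^esub> w)"
    unfolding F(2) G(2) H(2) flat_germs_add[OF V F(1) G(1)] flat_germs_add[OF V G(1) H(1)]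
      flat_germs_add[OF V equivariant_add[OF F(1) G(1)] H(1)] flat_germs_add[OF V F(1) equivariant_add[OF G(1) H(1)]]
    using germ_of_eq_iff[OF V equivariant_add[OF equivariant_add[OF F(1) G(1)] H(1)] equivariant_add[OF F(1) equivariant_add[OF G(1) H(1)]]]
    by blast
qed

text \<open>Induction over the index set. The sum is described by its entries, since matrices of a fixed
  format are not a type with a zero over which sums are defined.\<close>

lemma finsum_germ_of:
  assumes V: "openin (Eq_topology q) V" and T: "finite T"
    and G: "\<And>t. t \<in> T \<Longrightarrow> G t \<in> equivariant V {0<..}"
  shows "\<exists>H\<in>equivariant V {0<..}. finsum (flat_germs V) (\<lambda>t. germ_of V (G t)) T = germ_of V H \<and>
    (\<forall>z\<in>Eq_preimage q V. \<forall>a<n. \<forall>b<n. H z $$ (a, b) = (\<Sum>t\<in>T. G t z $$ (a, b)))"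
  using T G
proof (induction T rule: finite_induct)
  interpret abelian_monoid "flat_germs V" by (rule abelian_monoid_flat_germs[OF V])
  {
    case empty
    show ?case by (intro bexI[OF _ equivariant_zero]) (auto simp: flat_germs_zero)
  next
    case (insert s T)
    then obtain H where H: "H \<in> equivariant V {0<..}" "finsum (flat_germs V) (\<lambda>t. germ_of V (G t)) T = germ_of V H"
      "\<forall>z\<in>Eq_preimage q V. \<forall>a<n. \<forall>b<n. H z $$ (a, b) = (\<Sum>t\<in>T. G t z $$ (a, b))"
      by blast
    have Gs: "G s \<in> equivariant V {0<..}" using insert by blast
    have "finsum (flat_germs V) (\<lambda>t. germ_of V (G t)) (insert s T) = germ_of V (G s) \<oplus>\<^bsub>flat_germs V\<^esub> germ_of V H"
      using insert unfolding H(2)[symmetric] by (intro finsum_insert) (auto simp: carrier_flat_germs[OF V])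
    also have "\<dots> = germ_of V (\<lambda>z. G s z + H z)" by (rule flat_germs_add[OF V Gs H(1)])
    finally show ?case
      using insert(1,2) H(3) equivariantD(2)[OF H(1)]
      by (intro bexI[OF _ equivariant_add[OF Gs H(1)]]) (auto simp: carrier_matD[OF equivariantD(2)[OF H(1)]])
  }
qed

text \<open>Splitting a matrix into its levels commutes with \<open>step\<close>, so it splits equivariant functions, and
  a family with components in distinct levels is recovered from its sum by projection.\<close>

lemma internal_direct_sum_levels:
  assumes V: "openin (Eq_topology q) V" and T: "finite T" "T \<subseteq> {0<..}"
  shows "is_internal_direct_sum (flat_germs V) T (\<lambda>t. germ_of V ` equivariant V {t}) (germ_of V ` equivariant V T)"
proof -
  interpret abelian_monoid "flat_germs V" by (rule abelian_monoid_flat_germs[OF V])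
  have sub: "equivariant V {t} \<subseteq> equivariant V {0<..}" if "t \<in> T" for t using equivariant_mono[of "{t}" "{0<..}"] that T(2) by auto
  have subT: "equivariant V T \<subseteq> equivariant V {0<..}" by (rule equivariant_mono[OF T(2)])
  \<comment> \<open>the sum of a family determines its components by projection to the levels\<close>
  have sum: "\<exists>H\<in>equivariant V T. finsum (flat_germs V) x T = germ_of V H \<and>
      (\<forall>t\<in>T. x t = germ_of V (\<lambda>z. proj {t} (H z)))"
    if x: "x \<in> (\<Pi>\<^sub>E t\<in>T. germ_of V ` equivariant V {t})" for x
  proof -
    have "\<forall>t\<in>T. \<exists>G. G \<in> equivariant V {t} \<and> x t = germ_of V G" using x by (auto simp: PiE_def Pi_def)
    then obtain G where G: "\<And>t. t \<in> T \<Longrightarrow> G t \<in> equivariant V {t}" "\<And>t. t \<in> T \<Longrightarrow> x t = germ_of V (G t)"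
      by metis
    have Gpos: "G t \<in> equivariant V {0<..}" if "t \<in> T" for t using G(1) sub that by blast
    obtain H where H: "H \<in> equivariant V {0<..}" "finsum (flat_germs V) (\<lambda>t. germ_of V (G t)) T = germ_of V H"
      "\<forall>z\<in>Eq_preimage q V. \<forall>a<n. \<forall>b<n. H z $$ (a, b) = (\<Sum>t\<in>T. G t z $$ (a, b))"
      using finsum_germ_of[OF V T(1), of G] Gpos by blast
    have Gz: "G t z $$ (a, b) = 0" if "t \<in> T" "z \<in> Eq_preimage q V" "a < n" "b < n" "m a - m b \<noteq> t" for t z a b
      using equivariantD(1)[OF G(1)[OF that(1)] that(2)] that by (simp add: level_mats_def)
    have "H \<in> equivariant V T"
    proof (rule equivariantI)
      fix z assume z: "z \<in> Eq_preimage q V"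
      show "H z \<in> level_mats T"
      proof -
        have "H z $$ (a, b) = 0" if ab: "a < n" "b < n" "m a - m b \<notin> T" for a b
        proof -
          have "H z $$ (a, b) = (\<Sum>t\<in>T. G t z $$ (a, b))" using H(3) z ab by simp
          also have "\<dots> = 0"
          proof (rule sum.neutral, rule ballI)
            fix t assume t: "t \<in> T"
            show "G t z $$ (a, b) = 0" by (rule Gz[OF t z ab(1,2)]) (use t ab(3) in metis)
          qed
          finally show ?thesis .
        qed
        then show ?thesis unfolding level_mats_def using equivariantD(2)[OF H(1) z] by blast
      qed
    qed (use equivariantD[OF H(1)] in auto)
    moreover have "finsum (flat_germs V) x T = germ_of V H"
      unfolding H(2)[symmetric] using Gpos G(2) by (intro finsum_cong') (auto simp: carrier_flat_germs[OF V])
    moreover have "x t = germ_of V (\<lambda>z. proj {t} (H z))" if t: "t \<in> T" for t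
    proof -
      have "G t z = proj {t} (H z)" if z: "z \<in> Eq_preimage q V" for z
      proof (rule eq_matI)
        fix a b assume "a < dim_row (proj {t} (H z))" "b < dim_col (proj {t} (H z))"
        then have ab: "a < n" "b < n" by (auto simp: proj_def)
        show "G t z $$ (a, b) = proj {t} (H z) $$ (a, b)"
        proof (cases "m a - m b = t")
          case True
          have "H z $$ (a, b) = (\<Sum>s\<in>T. G s z $$ (a, b))" using H(3) z ab by simp
          also have "\<dots> = (\<Sum>s\<in>T. if s = t then G t z $$ (a, b) else 0)"
            using Gz z ab True by (intro sum.cong) auto
          also have "\<dots> = G t z $$ (a, b)" using T(1) t by simp
          finally show ?thesis using ab True by (simp add: proj_def)
        next
          case False
          then show ?thesis using ab Gz[OF t z ab] by (simp add: proj_def)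
        qed
      qed (use equivariantD(2)[OF G(1)[OF t] z] in \<open>auto simp: proj_def\<close>)
      then show ?thesis
        unfolding G(2)[OF t]
        using germ_of_eq_iff[OF V] G(1)[OF t] sub[OF t] equivariant_proj[OF H(1), of "{t}"] by blast
    qed
    ultimately show ?thesis by blast
  qed
  have inj: "inj_on (\<lambda>x. finsum (flat_germs V) x T) (\<Pi>\<^sub>E t\<in>T. germ_of V ` equivariant V {t})"
  proof (rule inj_onI)
    fix x y assume x: "x \<in> (\<Pi>\<^sub>E t\<in>T. germ_of V ` equivariant V {t})" and y: "y \<in> (\<Pi>\<^sub>E t\<in>T. germ_of V ` equivariant V {t})"
      and eq: "finsum (flat_germs V) x T = finsum (flat_germs V) y T"
    obtain H where H: "H \<in> equivariant V T" "finsum (flat_germs V) x T = germ_of V H"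
      "\<And>t. t \<in> T \<Longrightarrow> x t = germ_of V (\<lambda>z. proj {t} (H z))"
      using sum[OF x] by blast
    obtain K where K: "K \<in> equivariant V T" "finsum (flat_germs V) y T = germ_of V K"
      "\<And>t. t \<in> T \<Longrightarrow> y t = germ_of V (\<lambda>z. proj {t} (K z))"
      using sum[OF y] by blast
    have HK: "\<forall>z\<in>Eq_preimage q V. H z = K z"
      using germ_of_eq_iff[OF V subsetD[OF subT H(1)] subsetD[OF subT K(1)]] H(2) K(2) eq by simp
    have "x t = y t" if t: "t \<in> T" for t
      unfolding H(3)[OF t] K(3)[OF t]
      using germ_of_eq_iff[OF V subsetD[OF sub[OF t] equivariant_proj[OF H(1)]] subsetD[OF sub[OF t] equivariant_proj[OF K(1)]]] HK
      by simp
    then show "x = y" using PiE_ext[OF x y] by blast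
  qed
  have "(\<lambda>x. finsum (flat_germs V) x T) ` (\<Pi>\<^sub>E t\<in>T. germ_of V ` equivariant V {t}) = germ_of V ` equivariant V T"
  proof (intro equalityI subsetI)
    fix y assume "y \<in> germ_of V ` equivariant V T"
    then obtain F where F: "F \<in> equivariant V T" "y = germ_of V F" by blast
    define x where "x = (\<lambda>t\<in>T. germ_of V (\<lambda>z. proj {t} (F z)))"
    have x: "x \<in> (\<Pi>\<^sub>E t\<in>T. germ_of V ` equivariant V {t})"
      unfolding x_def using equivariant_proj[OF F(1)] by (auto simp: PiE_def Pi_def)
    obtain H where H: "H \<in> equivariant V T" "finsum (flat_germs V) x T = germ_of V H"
      "\<And>t. t \<in> T \<Longrightarrow> x t = germ_of V (\<lambda>z. proj {t} (H z))"
      using sum[OF x] by blast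
    have "H z = F z" if z: "z \<in> Eq_preimage q V" for z
    proof (rule eq_matI)
      note c = carrier_matD[OF equivariantD(2)[OF H(1) z]] carrier_matD[OF equivariantD(2)[OF F(1) z]]
      fix a b assume "a < dim_row (F z)" "b < dim_col (F z)"
      then have ab: "a < n" "b < n" using c by auto
      show "H z $$ (a, b) = F z $$ (a, b)"
      proof (cases "m a - m b \<in> T")
        case True
        let ?t = "m a - m b"
        have "germ_of V (\<lambda>z. proj {?t} (F z)) = germ_of V (\<lambda>z. proj {?t} (H z))"
          using H(3)[OF True] True by (simp add: x_def)
        then have "proj {?t} (F z) = proj {?t} (H z)"
          using germ_of_eq_iff[OF V] equivariant_proj[OF F(1), of "{?t}"] equivariant_proj[OF H(1), of "{?t}"] sub[OF True] z by blast
        then have "proj {?t} (F z) $$ (a, b) = proj {?t} (H z) $$ (a, b)" by simp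
        then show ?thesis using ab by (simp add: proj_def)
      next
        case False
        then show ?thesis using equivariantD(1)[OF F(1) z] equivariantD(1)[OF H(1) z] ab by (simp add: level_mats_def)
      qed
    qed (use carrier_matD[OF equivariantD(2)[OF H(1) z]] carrier_matD[OF equivariantD(2)[OF F(1) z]] in auto)
    then have "y = finsum (flat_germs V) x T"
      unfolding F(2) H(2) using germ_of_eq_iff[OF V] F(1) H(1) subT by blast
    then show "y \<in> (\<lambda>x. finsum (flat_germs V) x T) ` (\<Pi>\<^sub>E t\<in>T. germ_of V ` equivariant V {t})" using x by blast
  qed (use sum in blast)
  then show ?thesis
    unfolding is_internal_direct_sum_def bij_betw_def using inj by blast
qed

text \<open>Sufficiency is \<open>equivariant_t_flat\<close>. For necessity, the levels below \<open>t\<close> vanish at each point of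
  a sector where theta does not, hence on the sector by continuity, hence on the preimage by the
  functional equation.\<close>

lemma t_flat_germs:
  assumes V: "openin (Eq_topology q) V" and c: "c \<noteq> 0" and t: "t \<ge> 0"
  shows "{x \<in> carrier (flat_germs V). \<exists>(W, f)\<in>x. \<forall>a<n. \<forall>b<n. t_flat_on q c t W (\<lambda>z. f z $$ (a, b))} =
    germ_of V ` equivariant V {d. 0 < d \<and> t \<le> real_of_int d}" (is "?S = germ_of V ` equivariant V ?L")
proof (intro equalityI subsetI)
  fix x assume "x \<in> germ_of V ` equivariant V ?L"
  then obtain F where F: "F \<in> equivariant V ?L" "x = germ_of V F" by blast
  have F0: "F \<in> equivariant V {0<..}" using F(1) equivariant_mono[of ?L "{0<..}" V] by auto
  have "\<forall>a<n. \<forall>b<n. t_flat_on q c t (Eq_preimage q V) (\<lambda>z. F z $$ (a, b))"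
    using equivariant_t_flat[OF F(1) _ c t] by auto
  then show "x \<in> ?S"
    using F(2) F0 self_germ_of[OF V F0] by (auto simp: carrier_flat_germs[OF V])
next
  fix x assume x: "x \<in> ?S"
  then obtain F where F: "F \<in> equivariant V {0<..}" "x = germ_of V F" by (auto simp: carrier_flat_germs[OF V])
  obtain W f where Wf: "(W, f) \<in> germ_of V F"
    and flat: "\<And>a b. a < n \<Longrightarrow> b < n \<Longrightarrow> t_flat_on q c t W (\<lambda>z. f z $$ (a, b))"
    using x F(2) by auto
  obtain S where S: "sector q S" "horizon q S = V" "S \<subseteq> W" "\<forall>z\<in>S. f z = F z"
    using Wf mem_germ_of[OF V F(1)] by (auto simp: represents_def)
  have Spre: "S \<subseteq> Eq_preimage q V" by (rule sector_subset_Eq_preimage[OF S(1,2)])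
  have "F \<in> equivariant V ?L"
  proof (rule equivariantI)
    have zero: "F z $$ (a, b) = 0"
      if z: "z \<in> S" and ab: "a < n" "b < n" and d: "0 < m a - m b" "real_of_int (m a - m b) < t" for z a b
    proof (rule ccontr)
      assume nz: "F z $$ (a, b) \<noteq> 0"
      have cont: "continuous_on S (\<lambda>z. F z $$ (a, b))"
        using equivariantD(4)[OF F(1)] ab Spre unfolding holomorphic_mat_def
        by (meson holomorphic_on_imp_continuous_on holomorphic_on_subset)
      have "open S" using S(1) by (simp add: sector_def)
      then have "open (S \<inter> (\<lambda>z. F z $$ (a, b)) -` (- {0}))"
        using continuous_open_preimage[OF cont, of "- {0}"] open_delete[OF open_UNIV, of 0]
        by (simp add: Compl_eq_Diff_UNIV)
      moreover have "z \<in> S \<inter> (\<lambda>z. F z $$ (a, b)) -` (- {0})" using z nz by simp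
      moreover have "0 \<notin> S" using S(1) by (simp add: sector_def)
      ultimately obtain w where w: "w \<in> S" "F w $$ (a, b) \<noteq> 0" "theta q c w \<noteq> 0"
        using theta_zeros_nowhere_dense[OF norm_q c, of "S \<inter> (\<lambda>z. F z $$ (a, b)) -` (- {0})"] by blast
      have hull: "spiral_hull q {w} \<subseteq> S"
        using sector_divide[OF S(1) w(1)] by (auto simp: spiral_hull_def)
      have "\<exists>N::nat. (\<lambda>z. norm (F z $$ (a, b)) * theta_weight c t z)
         \<in> O[at 0 within spiral_hull q {w}](\<lambda>z. 1 / norm z ^ N)" if ab: "a < n" "b < n" for a b
      proof -
        have "compact {w} \<and> {w} \<subseteq> W" using w(1) S(3) by auto
        then obtain N :: nat where N: "(\<lambda>z. norm (f z $$ (a, b)) * theta_weight c t z)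
           \<in> O[at 0 within spiral_hull q {w}](\<lambda>z. 1 / norm z ^ N)"
          using flat[OF ab] unfolding t_flat_on_def theta_weight_def by blast
        have "\<forall>\<^sub>F z in at 0 within spiral_hull q {w}.
            norm (f z $$ (a, b)) * theta_weight c t z = norm (F z $$ (a, b)) * theta_weight c t z"
          using hull S(4) by (auto simp: eventually_at_filter intro!: always_eventually)
        from landau_o.big.in_cong[THEN iffD1, OF this N] show ?thesis by (rule exI)
      qed
      moreover have "w \<in> Eq_preimage q V" using w(1) Spre by blast
      moreover have "t > 0" using d by linarith
      ultimately have "proj {m a - m b} (F w) = 0\<^sub>m n n"
        using t_flat_imp_level_zero[OF F(1) _ c _ d(2) w(3)] by blast
      then have "proj {m a - m b} (F w) $$ (a, b) = 0" using ab by simp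
      then show False using ab w(2) by (simp add: proj_def)
    qed
    have FS: "F z \<in> level_mats ?L" if z: "z \<in> S" for z
    proof -
      have Fz: "F z \<in> level_mats {0<..}" using equivariantD(1)[OF F(1)] Spre z by blast
      have "F z $$ (a, b) = 0" if ab: "a < n" "b < n" "m a - m b \<notin> ?L" for a b
      proof (cases "0 < m a - m b")
        case True
        then show ?thesis using zero[OF z ab(1,2)] ab(3) by simp
      next
        case False
        then show ?thesis using Fz ab(1,2) by (simp add: level_mats_def)
      qed
      then show ?thesis unfolding level_mats_def using level_mats_carrier[OF Fz] by blast
    qed
    fix z assume z: "z \<in> Eq_preimage q V"
    then obtain k where "z / q ^ k \<in> S"
      using sector_absorbs[OF S(1) q_not_0, of z] S(2) by (auto simp: Eq_preimage_def)
    then have "F (z / q ^ k) = proj ?L (F (z / q ^ k))" using FS level_mats_iff_proj by metis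
    then have "F z = proj ?L (F z)"
      by (rule equivariant_determined_below[OF F(1) equivariant_proj[OF F(1)] z])
    then show "F z \<in> level_mats ?L" using proj_level_mats by metis
  qed (use equivariantD[OF F(1)] in auto)
  then show "x \<in> germ_of V ` equivariant V ?L" using F(2) by blast
qed

lemma level_mats_cong:
  assumes "\<And>a b. a < n \<Longrightarrow> b < n \<Longrightarrow> m a - m b \<in> L \<longleftrightarrow> m a - m b \<in> L'"
  shows "level_mats L = level_mats L'"
  unfolding level_mats_def using assms by blast

text \<open>Only levels that occur as a difference of weights matter.\<close>

lemma equivariant_cong:
  assumes "\<And>a b. a < n \<Longrightarrow> b < n \<Longrightarrow> m a - m b \<in> L \<longleftrightarrow> m a - m b \<in> L'"
  shows "equivariant V L = equivariant V L'"
  unfolding equivariant_def using level_mats_cong[OF assms] by simp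

end

section \<open>Block matrices\<close>

lemma offset_Suc: "offset P (Suc i) = offset P i + rk P i"
  by (simp add: offset_def)

lemma offset_mono: "i \<le> j \<Longrightarrow> offset P i \<le> offset P j"
  unfolding offset_def by (rule sum_mono2) auto

lemma offset_less_total:
  assumes "i < length P" "r < rk P i"
  shows "offset P i + r < total_rk P"
  using offset_mono[of "Suc i" "length P" P] assms by (simp add: total_rk_def offset_Suc)

lemma block_index_offset:
  assumes "r < rk P i"
  shows "block_index P (offset P i + r) = i"
  unfolding block_index_def
proof (rule Least_equality)
  show "offset P i + r < offset P (Suc i)" using assms by (simp add: offset_Suc)
  show "i \<le> j" if "offset P i + r < offset P (Suc j)" for j
    using that offset_mono[of "Suc j" i P] by (cases "i \<le> j") auto
qed

lemma block_indexE:
  assumes "a < total_rk P"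
  obtains i r where "i < length P" "r < rk P i" "a = offset P i + r"
    "block_index P a = i" "a - offset P i = r"
proof -
  define i where "i = (LEAST i. a < offset P i)"
  have a: "a < offset P i" and le: "i \<le> length P"
    unfolding i_def using assms by (auto simp: total_rk_def intro: LeastI Least_le)
  then obtain i' where i': "i = Suc i'" by (cases i) (auto simp: offset_def)
  then have "offset P i' \<le> a" using not_less_Least[of i' "\<lambda>i. a < offset P i"] by (simp add: i_def)
  then have a': "offset P i' + (a - offset P i') = a" "a - offset P i' < rk P i'"
    using a by (auto simp: i' offset_Suc)
  have "block_index P a = i'" using block_index_offset[OF a'(2)] unfolding a'(1) .
  then show ?thesis using that[of i' "a - offset P i'"] le i' a' by simp
qed

lemma sum_over_block:
  assumes "i < length P"
  shows "(\<Sum>c<total_rk P. if block_index P c = i then g c else 0) = (\<Sum>r<rk P i. g (offset P i + r))"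
proof -
  have "(\<Sum>c<total_rk P. if block_index P c = i then g c else 0) =
      (\<Sum>c\<in>{c. c < total_rk P \<and> block_index P c = i}. g c)"
    by (simp add: sum.If_cases Int_def lessThan_def conj_commute)
  also have "{c. c < total_rk P \<and> block_index P c = i} = (\<lambda>r. offset P i + r) ` {..<rk P i}"
    using assms by (auto simp: block_index_offset offset_less_total elim!: block_indexE)
  also have "(\<Sum>c\<in>\<dots>. g c) = (\<Sum>r<rk P i. g (offset P i + r))"
    by (subst sum.reindex) auto
  finally show ?thesis .
qed

definition block_diagonal :: "pure_data \<Rightarrow> (nat \<Rightarrow> complex mat) \<Rightarrow> complex mat" where
  "block_diagonal P B = mat (total_rk P) (total_rk P) (\<lambda>(a, b).
     if block_index P a = block_index P b
     then B (block_index P a) $$ (a - offset P (block_index P a), b - offset P (block_index P a)) else 0)"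

lemma block_diagonal_carrier: "block_diagonal P B \<in> carrier_mat (total_rk P) (total_rk P)"
  by (simp add: block_diagonal_def)

lemma block_diagonal_entry:
  assumes "i < length P" "j < length P" "r < rk P i" "s < rk P j"
  shows "block_diagonal P B $$ (offset P i + r, offset P j + s) = (if i = j then B i $$ (r, s) else 0)"
  using assms
  by (cases "i = j") (simp_all add: block_diagonal_def offset_less_total block_index_offset)

lemma sum_block_diagonal_row:
  assumes "i < length P" "r < rk P i"
  shows "(\<Sum>c<total_rk P. block_diagonal P B $$ (offset P i + r, c) * g c) =
    (\<Sum>s<rk P i. B i $$ (r, s) * g (offset P i + s))"
proof -
  have "(\<Sum>c<total_rk P. block_diagonal P B $$ (offset P i + r, c) * g c) =
      (\<Sum>c<total_rk P. if block_index P c = i then block_diagonal P B $$ (offset P i + r, c) * g c else 0)"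
    using assms by (intro sum.cong) (auto simp: block_diagonal_def offset_less_total block_index_offset)
  also have "\<dots> = (\<Sum>s<rk P i. B i $$ (r, s) * g (offset P i + s))"
    unfolding sum_over_block[OF assms(1)] using assms by (intro sum.cong) (auto simp: block_diagonal_entry)
  finally show ?thesis .
qed

lemma sum_block_diagonal_column:
  assumes "j < length P" "s < rk P j"
  shows "(\<Sum>c<total_rk P. g c * block_diagonal P B $$ (c, offset P j + s)) =
    (\<Sum>r<rk P j. g (offset P j + r) * B j $$ (r, s))"
proof -
  have "(\<Sum>c<total_rk P. g c * block_diagonal P B $$ (c, offset P j + s)) =
      (\<Sum>c<total_rk P. if block_index P c = j then g c * block_diagonal P B $$ (c, offset P j + s) else 0)"
    using assms by (intro sum.cong) (auto simp: block_diagonal_def offset_less_total block_index_offset)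
  also have "\<dots> = (\<Sum>r<rk P j. g (offset P j + r) * B j $$ (r, s))"
    unfolding sum_over_block[OF assms(1)] using assms by (intro sum.cong) (auto simp: block_diagonal_entry)
  finally show ?thesis .
qed

lemma block_diagonal_mult_one:
  assumes "\<And>i. i < length P \<Longrightarrow> B i \<in> carrier_mat (rk P i) (rk P i)"
    "\<And>i. i < length P \<Longrightarrow> C i \<in> carrier_mat (rk P i) (rk P i)"
    "\<And>i. i < length P \<Longrightarrow> B i * C i = 1\<^sub>m (rk P i)"
  shows "block_diagonal P B * block_diagonal P C = 1\<^sub>m (total_rk P)"
proof (rule eq_matI)
  fix a b assume ab: "a < dim_row (1\<^sub>m (total_rk P))" "b < dim_col (1\<^sub>m (total_rk P))"
  then obtain i r j s where i: "i < length P" "r < rk P i" "a = offset P i + r"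
    and j: "j < length P" "s < rk P j" "b = offset P j + s"
    by (auto elim!: block_indexE)
  have "(block_diagonal P B * block_diagonal P C) $$ (a, b) =
      (\<Sum>c<total_rk P. block_diagonal P B $$ (a, c) * block_diagonal P C $$ (c, b))"
    using ab by (simp add: block_diagonal_def scalar_prod_def lessThan_atLeast0)
  also have "\<dots> = (\<Sum>t<rk P i. B i $$ (r, t) * block_diagonal P C $$ (offset P i + t, b))"
    unfolding i(3) by (rule sum_block_diagonal_row[OF i(1,2)])
  also have "\<dots> = (if i = j then (\<Sum>t<rk P i. B i $$ (r, t) * C i $$ (t, s)) else 0)"
    using i j by (simp add: block_diagonal_entry)
  also have "\<dots> = (if i = j then (B i * C i) $$ (r, s) else 0)"
    using i j assms(1,2)[OF i(1)] by (cases "i = j") (simp_all add: scalar_prod_def lessThan_atLeast0)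
  also have "\<dots> = 1\<^sub>m (total_rk P) $$ (a, b)"
  proof (cases "i = j")
    case True
    then show ?thesis using ab i j assms(3)[OF i(1)] by simp
  next
    case False
    then have "a \<noteq> b" using block_index_offset[OF i(2)] block_index_offset[OF j(2)] i(3) j(3) by metis
    then show ?thesis using False ab by simp
  qed
  finally show "(block_diagonal P B * block_diagonal P C) $$ (a, b) = 1\<^sub>m (total_rk P) $$ (a, b)" .
qed (auto simp: block_diagonal_def)

lemma block_diagonal_triple:
  assumes i: "i < length P" "r < rk P i" and j: "j < length P" "s < rk P j"
    and B: "B i \<in> carrier_mat (rk P i) (rk P i)" and C: "C j \<in> carrier_mat (rk P j) (rk P j)"
    and X: "X \<in> carrier_mat (total_rk P) (total_rk P)"
  shows "(block_diagonal P B * X * block_diagonal P C) $$ (offset P i + r, offset P j + s) =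
    (B i * block P i j X * C j) $$ (r, s)"
proof -
  let ?D = "block_diagonal P B" and ?D' = "block_diagonal P C"
  have "(?D * X * ?D') $$ (offset P i + r, offset P j + s) =
      (\<Sum>c<total_rk P. ?D $$ (offset P i + r, c) *
        (\<Sum>d<total_rk P. X $$ (c, d) * ?D' $$ (d, offset P j + s)))"
    using triple_product_entry[OF block_diagonal_carrier X block_diagonal_carrier
        offset_less_total[OF i] offset_less_total[OF j], of B C]
    by (simp add: sum_distrib_left mult.assoc)
  also have "\<dots> = (\<Sum>c<rk P i. B i $$ (r, c) * (\<Sum>d<rk P j. X $$ (offset P i + c, offset P j + d) * C j $$ (d, s)))"
    unfolding sum_block_diagonal_row[OF i] sum_block_diagonal_column[OF j] ..
  also have "\<dots> = (\<Sum>c<rk P i. \<Sum>d<rk P j. B i $$ (r, c) * block P i j X $$ (c, d) * C j $$ (d, s))"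
    by (simp add: sum_distrib_left mult.assoc block_def)
  also have "\<dots> = (B i * block P i j X * C j) $$ (r, s)"
    using triple_product_entry[OF B _ C i(2) j(2), of "block P i j X"] by (simp add: block_def)
  finally show ?thesis .
qed

lemma supported_on_iff:
  "supported_on P S X \<longleftrightarrow> (\<forall>a<total_rk P. \<forall>b<total_rk P.
     (block_index P a, block_index P b) \<notin> S \<longrightarrow> X $$ (a, b) = 0)"
proof
  assume s: "supported_on P S X"
  show "\<forall>a<total_rk P. \<forall>b<total_rk P. (block_index P a, block_index P b) \<notin> S \<longrightarrow> X $$ (a, b) = 0"
  proof (intro allI impI)
    fix a b assume ab: "a < total_rk P" "b < total_rk P" and S: "(block_index P a, block_index P b) \<notin> S"
    from ab obtain i r j s where i: "i < length P" "r < rk P i" "a = offset P i + r" "block_index P a = i"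
      and j: "j < length P" "s < rk P j" "b = offset P j + s" "block_index P b = j"
      by (elim block_indexE)
    have "block P i j X = 0\<^sub>m (rk P i) (rk P j)" using s S i j by (simp add: supported_on_def)
    then have "block P i j X $$ (r, s) = 0" using i j by simp
    then show "X $$ (a, b) = 0" using i j by (simp add: block_def)
  qed
next
  assume *: "\<forall>a<total_rk P. \<forall>b<total_rk P. (block_index P a, block_index P b) \<notin> S \<longrightarrow> X $$ (a, b) = 0"
  show "supported_on P S X"
    unfolding supported_on_def
  proof (intro allI impI)
    fix i j assume "i < length P" "j < length P" "(i, j) \<notin> S"
    then show "block P i j X = 0\<^sub>m (rk P i) (rk P j)"
      using * by (intro eq_matI) (auto simp: block_def offset_less_total block_index_offset)
  qed
qed

lemma offset_Cons: "offset (p # P) (Suc i) = dim_row (snd p) + offset P i"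
  unfolding offset_def by (subst sum.lessThan_Suc_shift) (simp add: rk_def)

lemma diag_block_mat_carrier_rk:
  assumes "\<And>p. p \<in> set P \<Longrightarrow> f p \<in> carrier_mat (dim_row (snd p)) (dim_row (snd p))"
  shows "diag_block_mat (map f P) \<in> carrier_mat (total_rk P) (total_rk P)"
  using assms
proof (induction P)
  case (Cons p P)
  then show ?case by (simp add: total_rk_def offset_Cons Let_def)
qed (simp add: total_rk_def offset_def)

lemma diag_block_mat_entry:
  assumes "\<And>p. p \<in> set P \<Longrightarrow> f p \<in> carrier_mat (dim_row (snd p)) (dim_row (snd p))"
    and "i < length P" "j < length P" "r < rk P i" "s < rk P j"
  shows "diag_block_mat (map f P) $$ (offset P i + r, offset P j + s) =
    (if i = j then f (P ! i) $$ (r, s) else 0)"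
  using assms
proof (induction P arbitrary: i j)
  case (Cons p P)
  have c: "f p \<in> carrier_mat (dim_row (snd p)) (dim_row (snd p))" using Cons.prems(1) by simp
  have D: "diag_block_mat (map f P) \<in> carrier_mat (total_rk P) (total_rk P)"
    using Cons.prems(1) by (intro diag_block_mat_carrier_rk) simp
  note dims = carrier_matD[OF c] carrier_matD[OF D]
  have rk: "rk (p # P) 0 = dim_row (snd p)" "rk (p # P) (Suc k) = rk P k" for k
    by (simp_all add: rk_def)
  have o0: "offset (p # P) 0 = 0" by (simp add: offset_def)
  show ?case
  proof (cases i; cases j)
    fix i' j' assume ij: "i = Suc i'" "j = Suc j'"
    then have p: "i' < length P" "j' < length P" "r < rk P i'" "s < rk P j'"
      using Cons.prems by (simp_all add: rk)
    show ?thesis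
      using Cons.IH[OF _ p] Cons.prems(1) offset_less_total[OF p(1,3)] offset_less_total[OF p(2,4)]
      unfolding ij offset_Cons by (simp add: Let_def dims)
  next
    fix j' assume ij: "i = 0" "j = Suc j'"
    then have p: "j' < length P" "r < dim_row (snd p)" "s < rk P j'"
      using Cons.prems by (simp_all add: rk)
    show ?thesis
      using p offset_less_total[OF p(1,3)] unfolding ij offset_Cons o0 by (simp add: Let_def dims)
  next
    fix i' assume ij: "i = Suc i'" "j = 0"
    then have p: "i' < length P" "s < dim_row (snd p)" "r < rk P i'"
      using Cons.prems by (simp_all add: rk)
    show ?thesis
      using p offset_less_total[OF p(1,3)] unfolding ij offset_Cons o0 by (simp add: Let_def dims)
  next
    assume ij: "i = 0" "j = 0"
    then show ?thesis using Cons.prems(4,5) unfolding ij o0 by (simp add: Let_def dims rk)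
  qed
qed simp

text \<open>The matrix on the right is carried to \<open>Y\<close> by the gluing map of the bundle of the internal Hom,
  and that map determines \<open>\<Phi>\<close> on constant matrices. There \<open>\<Phi>\<close> does not depend on \<open>q\<close>, so the
  relation may be taken for \<open>q = 1\<close>.\<close>

lemma eval_hom_qmodule:
  assumes A: "A \<in> carrier_mat r r" "invertible_mat A"
    and B: "B \<in> carrier_mat s s" "invertible_mat B"
    and Y: "Y \<in> carrier_mat s r" and z: "z \<noteq> 0"
  shows "eval_mat (Phi (hom_qmodule q (pure_mat (\<mu>, A)) (pure_mat (\<nu>, B))) (const_mat Y)) z =
    z powi (\<nu> - \<mu>) \<cdot>\<^sub>m (mat_inv B * Y * A)"
proof -
  note a = mat_inv_props[OF A] and b = mat_inv_props[OF B]
  let ?M = "hom_qmodule 1 (pure_mat (\<mu>, A)) (pure_mat (\<nu>, B))"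
  let ?X = "z powi (\<nu> - \<mu>) \<cdot>\<^sub>m (mat_inv B * Y * A)"
  have X: "?X \<in> carrier_mat s r" using a(1) b(1) A B Y by auto
  have "B * ?X * mat_inv A = z powi (\<nu> - \<mu>) \<cdot>\<^sub>m (B * (mat_inv B * Y * A) * mat_inv A)"
    using a b A B Y by (simp add: mult_smult_distrib[of _ s s _ r] mult_smult_assoc_mat[of _ s r _ r])
  also have "B * (mat_inv B * Y * A) * mat_inv A = (B * mat_inv B) * Y * (A * mat_inv A)"
    using a(1) b(1) A(1) B(1) Y by (simp add: assoc_mult_mat[where ?n\<^sub>1.0 = s]
        assoc_mult_mat[of _ s s _ r _ r] assoc_mult_mat[of _ s s _ s _ r] assoc_mult_mat[of _ s r _ r _ r])
  finally have "B * ?X * mat_inv A = z powi (\<nu> - \<mu>) \<cdot>\<^sub>m Y" using a b Y by simp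
  moreover have "z powi (- (\<nu> - \<mu>)) * z powi (\<nu> - \<mu>) = 1"
    using z by (simp only: power_int_minus) simp
  ultimately have Y_eq: "z powi (- (\<nu> - \<mu>)) \<cdot>\<^sub>m (B * ?X * mat_inv A) = Y"
    by (simp only: smult_smult_mat)
  have "((z, ?X), (1 * z, z powi (- (\<nu> - \<mu>)) \<cdot>\<^sub>m (B * ?X * mat_inv A))) \<in> bundle_step 1 ?M"
    unfolding bundle_step_hom_qmodule[OF A B] using X z
    by (intro CollectI exI[of _ z] exI[of _ ?X] conjI refl)
  then have "((z, ?X), (1 * z, Y)) \<in> bundle_step 1 ?M"
    unfolding Y_eq .
  then have "?X = eval_mat (Phi ?M (const_mat Y)) z"
    unfolding bundle_step_def by auto
  moreover have "Phi ?M (const_mat Y) = Phi (hom_qmodule q (pure_mat (\<mu>, A)) (pure_mat (\<nu>, B))) (const_mat Y)"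
    by (simp add: hom_qmodule_def)
  ultimately show ?thesis by simp
qed

section \<open>The graded module of a tamely irregular module\<close>

definition weight :: "pure_data \<Rightarrow> nat \<Rightarrow> int" where
  "weight P a = slope P (block_index P a)"

locale tamely_irregular =
  fixes q :: complex and P :: pure_data
  assumes q_norm: "norm q > 1"
    and slopes: "\<And>i j. i < j \<Longrightarrow> j < length P \<Longrightarrow> fst (P ! i) > fst (P ! j)"
    and blocks: "\<And>\<mu> A. (\<mu>, A) \<in> set P \<Longrightarrow> \<exists>r\<ge>1. A \<in> carrier_mat r r \<and> invertible_mat A"
begin

abbreviation "n \<equiv> total_rk P"
abbreviation "E \<equiv> block_diagonal P (\<lambda>i. snd (P ! i))"
abbreviation "E' \<equiv> block_diagonal P (\<lambda>i. mat_inv (snd (P ! i)))"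

lemma block_props:
  assumes "i < length P"
  shows "snd (P ! i) \<in> carrier_mat (rk P i) (rk P i)" "invertible_mat (snd (P ! i))" "rk P i \<ge> 1"
proof -
  have "(fst (P ! i), snd (P ! i)) \<in> set P" using assms by simp
  then obtain r where "r \<ge> 1" "snd (P ! i) \<in> carrier_mat r r" "invertible_mat (snd (P ! i))"
    using blocks by blast
  then show "snd (P ! i) \<in> carrier_mat (rk P i) (rk P i)" "invertible_mat (snd (P ! i))" "rk P i \<ge> 1"
    by (auto simp: rk_def)
qed

lemma slope_less_iff:
  assumes "i < length P" "j < length P"
  shows "slope P j < slope P i \<longleftrightarrow> i < j"
  using slopes[of i j] slopes[of j i] assms unfolding slope_def
  by (cases i j rule: linorder_cases) auto

lemma block_index_less: "a < n \<Longrightarrow> block_index P a < length P"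
  by (erule block_indexE) simp

sublocale graded_conjugation q n "weight P" E E'
proof
  show "E * E' = 1\<^sub>m n" "E' * E = 1\<^sub>m n"
    by (rule block_diagonal_mult_one; use block_props mat_inv_props in blast)+
  fix a b assume "a < n" "b < n" "weight P a \<noteq> weight P b"
  then show "E $$ (a, b) = 0" "E' $$ (a, b) = 0"
    by (auto simp: block_diagonal_def weight_def)
qed (auto simp: q_norm block_diagonal_carrier)

lemma slope_snd_nth: "(slope P i, snd (P ! i)) = P ! i"
  by (simp add: slope_def)

lemma supported_iff_level_mats:
  assumes "X \<in> carrier_mat n n"
  shows "supported_on P {(i, j). slope P i - slope P j \<in> L} X \<longleftrightarrow> X \<in> level_mats L"
  using assms by (simp add: supported_on_iff level_mats_def weight_def)

text \<open>The slopes decrease strictly, so the strictly upper triangular blocks are those of positive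
  level.\<close>

lemma upper_supported_iff_level_mats:
  assumes "X \<in> carrier_mat n n"
  shows "supported_on P {(i, j). i < j} X \<longleftrightarrow> X \<in> level_mats {0<..}"
  using assms slope_less_iff[OF block_index_less block_index_less]
  by (simp add: supported_on_iff level_mats_def weight_def)

lemma fibre_hom_sum: "fibre (hom_sum q P {(i, j). slope P i - slope P j \<in> L}) = level_mats L"
proof -
  have "supported_on P S (const_mat Y) \<longleftrightarrow> supported_on P S Y" if "Y \<in> carrier_mat n n" for S and Y :: "complex mat"
    using that by (simp add: supported_on_iff)
  then have "Y \<in> fibre (hom_sum q P {(i, j). slope P i - slope P j \<in> L}) \<longleftrightarrow> Y \<in> level_mats L" for Y
    using supported_iff_level_mats[of Y L] level_mats_carrier[of Y L]
    by (cases "Y \<in> carrier_mat n n") (simp_all add: fibre_def hom_sum_def, blast)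
  then show ?thesis by blast
qed

text \<open>Blockwise \<open>\<Phi>\<close> is multiplication by a power of \<open>z\<close> and conjugation by the inverses of the
  \<open>A\<^sub>i\<close>, which is the inverse of \<open>step\<close>.\<close>

lemma eval_Phi_hom_sum:
  assumes Y: "Y \<in> carrier_mat n n" and z: "z \<noteq> 0"
  shows "eval_mat (Phi (hom_sum q P S) (const_mat Y)) z = unstep z Y"
proof (rule eq_matI)
  fix a b assume "a < dim_row (unstep z Y)" "b < dim_col (unstep z Y)"
  then have ab: "a < n" "b < n" using unstep_carrier[of z Y] by auto
  obtain i r where i: "i < length P" "r < rk P i" "a = offset P i + r" "block_index P a = i" "a - offset P i = r"
    using ab(1) by (rule block_indexE)
  obtain j s where j: "j < length P" "s < rk P j" "b = offset P j + s" "block_index P b = j" "b - offset P j = s"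
    using ab(2) by (rule block_indexE)
  note A = block_props(1,2)[OF i(1)] and A' = block_props(1,2)[OF j(1)]
  have Yij: "block P i j Y \<in> carrier_mat (rk P i) (rk P j)" by (simp add: block_def)
  let ?M = "Phi (hom_qmodule q (pure_mat (P ! j)) (pure_mat (P ! i))) (const_mat (block P i j Y))"
  have ev: "eval_mat ?M z = z powi (slope P i - slope P j) \<cdot>\<^sub>m (mat_inv (snd (P ! i)) * block P i j Y * snd (P ! j))"
    using eval_hom_qmodule[OF A' A Yij z, of q "slope P j" "slope P i"]
    by (simp only: slope_snd_nth)
  have c: "mat_inv (snd (P ! i)) * block P i j Y * snd (P ! j) \<in> carrier_mat (rk P i) (rk P j)"
    using mat_inv_props(1)[OF A] A'(1) Yij by auto
  have "dim_row (eval_mat ?M z) = rk P i" "dim_col (eval_mat ?M z) = rk P j"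
    unfolding ev using c by auto
  then have M: "dim_row ?M = rk P i" "dim_col ?M = rk P j" by simp_all
  have "block P i j (const_mat Y) = const_mat (block P i j Y)"
    using Y i j by (intro eq_matI) (auto simp: block_def offset_less_total)
  then have "eval_mat (Phi (hom_sum q P S) (const_mat Y)) z $$ (a, b) = eval_mat ?M z $$ (r, s)"
    using ab i j M by (simp add: hom_sum_def from_blocks_def)
  also have "\<dots> = z powi (slope P i - slope P j) * (mat_inv (snd (P ! i)) * block P i j Y * snd (P ! j)) $$ (r, s)"
    unfolding ev using i(2) j(2) by (intro index_smult_mat(1)) (simp_all only: carrier_matD[OF c])
  also have "(mat_inv (snd (P ! i)) * block P i j Y * snd (P ! j)) $$ (r, s) = untwist Y $$ (a, b)"
    unfolding untwist_def i(3) j(3)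
    by (rule block_diagonal_triple[where B = "\<lambda>i. mat_inv (snd (P ! i))" and C = "\<lambda>i. snd (P ! i)",
          OF i(1,2) j(1,2) mat_inv_props(1)[OF A] A'(1) Y, symmetric])
  also have "z powi (slope P i - slope P j) = (1 / z) powi (weight P b - weight P a)"
    unfolding weight_def i(4) j(4) using z by (simp add: power_int_diff power_int_divide_distrib)
  finally show "eval_mat (Phi (hom_sum q P S) (const_mat Y)) z $$ (a, b) = unstep z Y $$ (a, b)"
    using ab by (simp add: unstep_def scale_def)
qed (use unstep_carrier[of z Y] in \<open>auto simp: hom_sum_def from_blocks_def\<close>)

lemma models_hom_sum: "models (hom_sum q P {(i, j). slope P i - slope P j \<in> L}) L"
proof -
  let ?M = "hom_sum q P {(i, j). slope P i - slope P j \<in> L}"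
  have "bundle_step q ?M = {(p, next_state p) | p. p \<in> states L}"
  proof (intro equalityI subsetI)
    fix e assume "e \<in> bundle_step q ?M"
    then obtain z X Y where e: "e = ((z, X), (q * z, Y))" "z \<noteq> 0" "X \<in> level_mats L" "Y \<in> level_mats L"
      "X = eval_mat (Phi ?M (const_mat Y)) z"
      unfolding bundle_step_def fibre_hom_sum by blast
    have "X = unstep z Y" using e(5) eval_Phi_hom_sum[OF level_mats_carrier[OF e(4)] e(2)] by simp
    then have "Y = step z X" using step_unstep[OF e(2) level_mats_carrier[OF e(4)]] by simp
    then have "e = ((z, X), next_state (z, X))" by (simp add: e(1) next_state_def)
    moreover have "(z, X) \<in> states L" using e by (simp add: states_def)
    ultimately show "e \<in> {(p, next_state p) | p. p \<in> states L}" by blast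
  next
    fix e assume "e \<in> {(p, next_state p) | p. p \<in> states L}"
    then obtain z X where e: "e = ((z, X), (q * z, step z X))" and z: "z \<noteq> 0" and X: "X \<in> level_mats L"
      by (auto simp: next_state_def states_def)
    have "X = eval_mat (Phi ?M (const_mat (step z X))) z"
      using eval_Phi_hom_sum[OF step_carrier z] unstep_step[OF z level_mats_carrier[OF X]] by simp
    then show "e \<in> bundle_step q ?M"
      unfolding bundle_step_def fibre_hom_sum e using z X step_level_mats[OF X] by blast
  qed
  moreover have "nrows ?M = n" "ncols ?M = n" by (simp_all add: hom_sum_def)
  ultimately show ?thesis unfolding models_def fibre_hom_sum by blast
qed

lemma models_End_pos: "models (End_pos q P) {0<..}"
  using models_hom_sum[of "{0<..}"] by (simp add: End_pos_def)

lemma models_End_slope: "models (End_slope q P t) {t}"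
  using models_hom_sum[of "{t}"] by (simp add: End_slope_def)

text \<open>The two forms agree because \<open>E\<close> preserves weights.\<close>

lemma eval_A0_entry:
  assumes z: "z \<noteq> 0" and ab: "a < n" "b < n"
  shows "eval_mat (A0 P) z $$ (a, b) = z powi (- weight P a) * E $$ (a, b)"
    "eval_mat (A0 P) z $$ (a, b) = z powi (- weight P b) * E $$ (a, b)"
proof -
  obtain i r where i: "i < length P" "r < rk P i" "a = offset P i + r" "block_index P a = i" "a - offset P i = r"
    using ab(1) by (rule block_indexE)
  obtain j s where j: "j < length P" "s < rk P j" "b = offset P j + s" "block_index P b = j" "b - offset P j = s"
    using ab(2) by (rule block_indexE)
  have c: "pure_mat p \<in> carrier_mat (dim_row (snd p)) (dim_row (snd p))" if "p \<in> set P" for p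
    using that blocks[of "fst p" "snd p"] by (auto simp: pure_mat_def)
  have car: "A0 P \<in> carrier_mat n n"
    unfolding A0_def by (rule diag_block_mat_carrier_rk) (rule c)
  have "A0 P $$ (a, b) = (if i = j then pure_mat (P ! i) $$ (r, s) else 0)"
    unfolding A0_def i(3) j(3) by (rule diag_block_mat_entry) (use c i j in auto)
  then have "eval_mat (A0 P) z $$ (a, b) = (if i = j then eval_mat (pure_mat (P ! i)) z $$ (r, s) else 0)"
    using car ab i j block_props(1)[OF i(1)] by (auto simp: pure_mat_def)
  also have "eval_mat (pure_mat (P ! i)) z = z powi (- slope P i) \<cdot>\<^sub>m snd (P ! i)"
    unfolding pure_mat_def slope_def using z by (rule eval_mat_smult)
  finally have *: "eval_mat (A0 P) z $$ (a, b) = z powi (- weight P a) * E $$ (a, b)"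
    using i j block_props(1)[OF i(1)] block_diagonal_entry[OF i(1) j(1) i(2) j(2)]
    by (auto simp: weight_def)
  then show "eval_mat (A0 P) z $$ (a, b) = z powi (- weight P a) * E $$ (a, b)" .
  show "eval_mat (A0 P) z $$ (a, b) = z powi (- weight P b) * E $$ (a, b)"
    unfolding * using E_degree(1)[OF ab] by (cases "weight P a = weight P b") auto
qed

lemma eval_A0_carrier: "eval_mat (A0 P) z \<in> carrier_mat n n"
proof -
  have "A0 P \<in> carrier_mat n n"
    unfolding A0_def by (rule diag_block_mat_carrier_rk) (use blocks in \<open>fastforce simp: pure_mat_def\<close>)
  then show ?thesis by simp
qed

lemma scale_mult_E:
  assumes X: "X \<in> carrier_mat n n"
  shows "scale z X * E = scale z (X * E)"
proof (rule eq_matI)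
  fix a b assume "a < dim_row (scale z (X * E))" "b < dim_col (scale z (X * E))"
  then have ab: "a < n" "b < n" by (auto simp: scale_def)
  have "(scale z X * E) $$ (a, b) = (\<Sum>c<n. z powi (weight P c - weight P a) * X $$ (a, c) * E $$ (c, b))"
    using ab E_carrier by (simp add: scalar_prod_def scale_def lessThan_atLeast0)
  also have "\<dots> = (\<Sum>c<n. z powi (weight P b - weight P a) * (X $$ (a, c) * E $$ (c, b)))"
  proof (rule sum.cong[OF refl])
    fix c assume "c \<in> {..<n}"
    then show "z powi (weight P c - weight P a) * X $$ (a, c) * E $$ (c, b) =
        z powi (weight P b - weight P a) * (X $$ (a, c) * E $$ (c, b))"
      using E_degree(1)[of c b] ab by (cases "weight P c = weight P b") auto
  qed
  also have "\<dots> = scale z (X * E) $$ (a, b)"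
    using ab E_carrier X by (simp add: scalar_prod_def scale_def lessThan_atLeast0 sum_distrib_left)
  finally show "(scale z X * E) $$ (a, b) = scale z (X * E) $$ (a, b)" .
qed (use E_carrier in \<open>auto simp: scale_def\<close>)

text \<open>The matrix \<open>A\<^sub>0\<close> at \<open>z\<close> is \<open>E\<close> with the power \<open>z powi (- m)\<close> of the weight on either side, so
  the equation says that \<open>Y\<close> is \<open>X\<close> conjugated by it.\<close>

lemma intertwining_iff_step:
  assumes z: "z \<noteq> 0" and X: "X \<in> carrier_mat n n" and Y: "Y \<in> carrier_mat n n"
  shows "Y * eval_mat (A0 P) z = eval_mat (A0 P) z * X \<longleftrightarrow> Y = step z X"
proof -
  define D where "D = eval_mat (A0 P) z"
  have D: "D \<in> carrier_mat n n" unfolding D_def by (rule eval_A0_carrier)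
  \<comment> \<open>with \<open>D\<close> on the right the power of \<open>z\<close> is read off the column index, with \<open>D\<close> on the left off the row index\<close>
  have YD: "(Y * D) $$ (a, b) = z powi (- weight P b) * (Y * E) $$ (a, b)" if ab: "a < n" "b < n" for a b
  proof -
    have "(Y * D) $$ (a, b) = (\<Sum>c<n. Y $$ (a, c) * D $$ (c, b))"
      using ab Y D
      by (simp add: scalar_prod_def lessThan_atLeast0)
    also have "\<dots> = (\<Sum>c<n. z powi (- weight P b) * (Y $$ (a, c) * E $$ (c, b)))"
      using ab by (intro sum.cong refl) (simp add: eval_A0_entry(2)[OF z, folded D_def])
    also have "\<dots> = z powi (- weight P b) * (Y * E) $$ (a, b)"
      using ab Y E_carrier by (simp add: scalar_prod_def lessThan_atLeast0 sum_distrib_left)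
    finally show ?thesis .
  qed
  have DX: "(D * X) $$ (a, b) = z powi (- weight P a) * (E * X) $$ (a, b)" if ab: "a < n" "b < n" for a b
  proof -
    have "(D * X) $$ (a, b) = (\<Sum>c<n. D $$ (a, c) * X $$ (c, b))"
      using ab X D
      by (simp add: scalar_prod_def lessThan_atLeast0)
    also have "\<dots> = (\<Sum>c<n. z powi (- weight P a) * (E $$ (a, c) * X $$ (c, b)))"
      using ab by (intro sum.cong refl) (simp add: eval_A0_entry(1)[OF z, folded D_def])
    also have "\<dots> = z powi (- weight P a) * (E * X) $$ (a, b)"
      using ab X E_carrier by (simp add: scalar_prod_def lessThan_atLeast0 sum_distrib_left)
    finally show ?thesis .
  qed
  have pw: "z powi (- weight P b) * u = z powi (- weight P a) * v \<longleftrightarrow> u = z powi (weight P b - weight P a) * v" for a b u v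
    using z by (simp add: power_int_diff power_int_minus field_simps)
  have "Y * D = D * X \<longleftrightarrow> Y * E = scale z (E * X)"
  proof
    assume *: "Y * D = D * X"
    show "Y * E = scale z (E * X)"
    proof (rule eq_matI)
      fix a b assume "a < dim_row (scale z (E * X))" "b < dim_col (scale z (E * X))"
      then have ab: "a < n" "b < n" by (auto simp: scale_def)
      show "(Y * E) $$ (a, b) = scale z (E * X) $$ (a, b)"
        using YD[OF ab] DX[OF ab] pw[of b "(Y * E) $$ (a, b)" a "(E * X) $$ (a, b)"] ab
        unfolding * by (simp add: scale_def del: index_mult_mat(1))
    qed (use Y E_carrier in \<open>auto simp: scale_def\<close>)
  next
    assume *: "Y * E = scale z (E * X)"
    show "Y * D = D * X"
    proof (rule eq_matI)
      fix a b assume "a < dim_row (D * X)" "b < dim_col (D * X)"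
      then have ab: "a < n" "b < n" using X D by auto
      show "(Y * D) $$ (a, b) = (D * X) $$ (a, b)"
        unfolding YD[OF ab] DX[OF ab] pw unfolding * using ab by (simp add: scale_def del: index_mult_mat(1))
    qed (use X Y D in auto)
  qed
  also have "\<dots> \<longleftrightarrow> Y = step z X"
  proof -
    have EX: "E * X \<in> carrier_mat n n" using E_carrier X by auto
    have "twist X * E = E * X"
    proof -
      have "twist X * E = E * X * (E' * E)"
        unfolding twist_def by (rule assoc_mult_mat[OF EX E_carrier(2,1)])
      then show ?thesis unfolding E_inverse right_mult_one_mat[OF EX] .
    qed
    then have s: "step z X * E = scale z (E * X)"
      unfolding step_def using scale_mult_E[OF twist_carrier[OF X]] by simp
    \<comment> \<open>right multiplication by \<open>E\<close> can be cancelled\<close>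
    have canc: "Z = Z * E * E'" if "Z \<in> carrier_mat n n" for Z
      using that assoc_mult_mat[OF that E_carrier] by (simp add: E_inverse)
    show ?thesis using s canc[OF Y] canc[OF step_carrier[of z X]] by metis
  qed
  finally show ?thesis unfolding D_def .
qed

lemma lambda_I_eq_flat_germs: "lambda_I q P V = flat_germs V"
proof -
  have "(\<exists>(W, f)\<in>x. (\<forall>z\<in>W. supported_on P {(i, j). i < j} (f z)) \<and>
        (\<forall>z\<in>W. q * z \<in> W \<longrightarrow> f (q * z) * eval_mat (A0 P) z = eval_mat (A0 P) z * f z)) \<longleftrightarrow>
      (\<exists>(W, f)\<in>x. (\<forall>z\<in>W. f z \<in> level_mats {0<..}) \<and> (\<forall>z\<in>W. q * z \<in> W \<longrightarrow> f (q * z) = step z (f z)))"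
    if x: "x \<in> carrier (flat_mats q n V)" for x
  proof (rule bex_cong[OF refl])
    fix p assume p: "p \<in> x"
    obtain W f where [simp]: "p = (W, f)" by (cases p)
    have "(W, f) \<in> flat_reps q n V"
      using x p by (auto simp: flat_mats_def quotient_def germ_rel_def)
    then have W: "f z \<in> carrier_mat n n" "z \<noteq> 0" if "z \<in> W" for z
      using that by (auto simp: flat_reps_def sector_def)
    show "(case p of (W, f) \<Rightarrow> (\<forall>z\<in>W. supported_on P {(i, j). i < j} (f z)) \<and>
          (\<forall>z\<in>W. q * z \<in> W \<longrightarrow> f (q * z) * eval_mat (A0 P) z = eval_mat (A0 P) z * f z)) \<longleftrightarrow>
        (case p of (W, f) \<Rightarrow> (\<forall>z\<in>W. f z \<in> level_mats {0<..}) \<and> (\<forall>z\<in>W. q * z \<in> W \<longrightarrow> f (q * z) = step z (f z)))"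
      using W upper_supported_iff_level_mats intertwining_iff_step by auto
  qed
  then show ?thesis
    unfolding lambda_I_def flat_germs_def by (simp cong: conj_cong)
qed

text \<open>Every block is nonempty, so each difference of slopes is realised by a pair of indices.\<close>

lemma pos_levels_iff: "d \<in> pos_levels P \<longleftrightarrow> 0 < d \<and> (\<exists>a<n. \<exists>b<n. d = weight P a - weight P b)"
proof
  assume "d \<in> pos_levels P"
  then obtain i j where ij: "i < length P" "j < length P" "d = slope P i - slope P j" "d > 0"
    by (auto simp: pos_levels_def)
  have r: "0 < rk P i" "0 < rk P j" using block_props(3)[OF ij(1)] block_props(3)[OF ij(2)] by auto
  have "d = weight P (offset P i + 0) - weight P (offset P j + 0)"
    unfolding weight_def block_index_offset[OF r(1)] block_index_offset[OF r(2)] by (rule ij(3))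
  then show "0 < d \<and> (\<exists>a<n. \<exists>b<n. d = weight P a - weight P b)"
    using ij(4) offset_less_total[OF ij(1) r(1)] offset_less_total[OF ij(2) r(2)] by blast
next
  assume "0 < d \<and> (\<exists>a<n. \<exists>b<n. d = weight P a - weight P b)"
  then show "d \<in> pos_levels P"
    unfolding pos_levels_def weight_def using block_index_less by blast
qed

lemma finite_pos_levels: "finite (pos_levels P)"
proof -
  have "pos_levels P \<subseteq> (\<lambda>(i, j). slope P i - slope P j) ` ({..<length P} \<times> {..<length P})"
    by (auto simp: pos_levels_def)
  then show ?thesis by (rule finite_subset) auto
qed

text \<open>The function \<open>F\<close> is unique on the preimage of \<open>V\<close>, and the section depends on nothing else.\<close>

definition section_map :: "complex set set \<Rightarrow> mat_germ \<Rightarrow> complex set \<Rightarrow> (complex \<times> complex mat) set" where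
  "section_map V x = section_of V (SOME F. F \<in> equivariant V {0<..} \<and> germ_of V F = x)"

lemma section_map_germ_of:
  assumes V: "openin (Eq_topology q) V" and F: "F \<in> equivariant V {0<..}"
  shows "section_map V (germ_of V F) = section_of V F"
proof -
  define G where "G = (SOME G. G \<in> equivariant V {0<..} \<and> germ_of V G = germ_of V F)"
  have "G \<in> equivariant V {0<..} \<and> germ_of V G = germ_of V F"
    unfolding G_def by (rule someI[of _ F]) (use F in simp)
  then have "section_of V G = section_of V F"
    using section_of_eq_iff[OF V _ F] germ_of_eq_iff[OF V _ F] by blast
  then show ?thesis by (simp add: section_map_def G_def)
qed

lemma section_map_iso:
  "sheaf_module_iso q (lambda_I q P) (flat_mats_res q n) (bundle_sections q (End_pos q P))
     (\<lambda>V V' s. restrict s V') section_map"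
  unfolding sheaf_module_iso_def lambda_I_eq_flat_germs
proof (intro conjI allI impI ballI)
  fix V assume V: "openin (Eq_topology q) V"
  note c = carrier_flat_germs[OF V] and sm = section_map_germ_of[OF V]
  show "bij_betw (section_map V) (carrier (flat_germs V)) (carrier (bundle_sections q (End_pos q P) V))"
    unfolding bij_betw_def
  proof
    show "inj_on (section_map V) (carrier (flat_germs V))"
    proof (rule inj_onI)
      fix x y assume "x \<in> carrier (flat_germs V)" "y \<in> carrier (flat_germs V)" and eq: "section_map V x = section_map V y"
      then obtain F G where F: "F \<in> equivariant V {0<..}" "x = germ_of V F" and G: "G \<in> equivariant V {0<..}" "y = germ_of V G"
        unfolding c by blast
      then show "x = y"
        using eq sm section_of_eq_iff[OF V F(1) G(1)] germ_of_eq_iff[OF V F(1) G(1)] by simp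
    qed
    show "section_map V ` carrier (flat_germs V) = carrier (bundle_sections q (End_pos q P) V)"
    proof (intro equalityI subsetI)
      fix s assume "s \<in> section_map V ` carrier (flat_germs V)"
      then show "s \<in> carrier (bundle_sections q (End_pos q P) V)"
        unfolding c using sm section_of_section[OF models_End_pos V] by auto
    next
      fix s assume "s \<in> carrier (bundle_sections q (End_pos q P) V)"
      then obtain F where "F \<in> equivariant V {0<..}" "s = section_of V F"
        by (rule section_eq_section_of[OF models_End_pos V])
      then show "s \<in> section_map V ` carrier (flat_germs V)"
        unfolding c using sm by (metis imageI)
    qed
  qed
  fix x assume "x \<in> carrier (flat_germs V)"
  then obtain F where F: "F \<in> equivariant V {0<..}" "x = germ_of V F" unfolding c by blast
  {
    fix y assume "y \<in> carrier (flat_germs V)"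
    then obtain G where G: "G \<in> equivariant V {0<..}" "y = germ_of V G" unfolding c by blast
    show "section_map V (x \<oplus>\<^bsub>flat_germs V\<^esub> y) =
        section_map V x \<oplus>\<^bsub>bundle_sections q (End_pos q P) V\<^esub> section_map V y"
      unfolding F(2) G(2) flat_germs_add[OF V F(1) G(1)] sm[OF F(1)] sm[OF G(1)] sm[OF equivariant_add[OF F(1) G(1)]]
      by (rule section_of_add[OF models_End_pos V F(1) G(1)])
  }
  fix g assume g: "g \<in> Eq_hol q V"
  show "section_map V (g \<odot>\<^bsub>flat_germs V\<^esub> x) = g \<odot>\<^bsub>bundle_sections q (End_pos q P) V\<^esub> section_map V x"
    unfolding F(2) flat_germs_smult[OF V F(1) g] sm[OF F(1)] sm[OF equivariant_smult[OF F(1) g]]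
    by (rule section_of_smult[OF models_End_pos V F(1) g])
next
  fix V V' x
  assume V: "openin (Eq_topology q) V \<and> openin (Eq_topology q) V' \<and> V' \<subseteq> V" and "x \<in> carrier (flat_germs V)"
  then obtain F where F: "F \<in> equivariant V {0<..}" "x = germ_of V F" using carrier_flat_germs by blast
  have F': "F \<in> equivariant V' {0<..}" using equivariant_subset[OF F(1)] V by blast
  show "section_map V' (flat_mats_res q n V V' x) = restrict (section_map V x) V'"
    unfolding F(2) using V F(1) F' germ_of_restrict section_map_germ_of section_of_restrict by simp
qed

lemma section_map_canonical: "canonical_section_map q P section_map"
  unfolding canonical_section_map_def lambda_I_eq_flat_germs
proof (intro allI impI ballI)
  fix V x assume V: "openin (Eq_topology q) V" and "x \<in> carrier (flat_germs V)"
  then obtain F where F: "F \<in> equivariant V {0<..}" "x = germ_of V F" using carrier_flat_germs by blast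
  have "\<forall>z\<in>Eq_preimage q V. section_map V x (qorbit q z) = bundle_class q (End_pos q P) (z, F z)"
    unfolding F(2) section_map_germ_of[OF V F(1)]
    using section_of_qorbit[OF F(1)] bundle_class_eq_orbit_class[OF models_End_pos equivariant_states[OF F(1)]] by simp
  then show "\<exists>(W, f)\<in>x. \<forall>z\<in>W. section_map V x (qorbit q z) = bundle_class q (End_pos q P) (z, f z)"
    using self_germ_of[OF V F(1)] F(2) by (intro bexI[of _ "(Eq_preimage q V, F)"]) auto
qed

text \<open>A class of the bundle of a graded piece is a class of the bundle of the positive part. If the
  section of \<open>F\<close> takes values in the smaller bundle, then \<open>F\<close> has the same values as a function of
  level \<open>t\<close>, by uniqueness of representatives.\<close>

lemma lambda_I_degree_eq:
  assumes V: "openin (Eq_topology q) V" and t: "t > 0"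
  shows "lambda_I_degree q P section_map t V = germ_of V ` equivariant V {t}"
proof -
  have sub: "equivariant V {t} \<subseteq> equivariant V {0<..}" using t by (intro equivariant_mono) auto
  show ?thesis
  proof (intro equalityI subsetI)
    fix x assume "x \<in> lambda_I_degree q P section_map t V"
    then have x: "x \<in> carrier (flat_germs V)" "section_map V x \<in> carrier (bundle_sections q (End_slope q P t) V)"
      by (auto simp: lambda_I_degree_def lambda_I_eq_flat_germs)
    obtain F where F: "F \<in> equivariant V {0<..}" "x = germ_of V F" using x(1) carrier_flat_germs[OF V] by blast
    obtain G where G: "G \<in> equivariant V {t}" "section_map V x = section_of V G"
      using section_eq_section_of[OF models_End_slope V x(2)] by blast
    have "section_of V F = section_of V G" using G(2) F section_map_germ_of[OF V F(1)] by simp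
    then have "germ_of V F = germ_of V G"
      using section_of_eq_iff[OF V F(1) G(1)] germ_of_eq_iff[OF V F(1) subsetD[OF sub G(1)]] by simp
    then show "x \<in> germ_of V ` equivariant V {t}" using F(2) G(1) by blast
  next
    fix x assume "x \<in> germ_of V ` equivariant V {t}"
    then obtain F where F: "F \<in> equivariant V {t}" "x = germ_of V F" by blast
    then show "x \<in> lambda_I_degree q P section_map t V"
      using sub carrier_flat_germs[OF V] section_map_germ_of[OF V] section_of_section[OF models_End_slope V F(1)]
      by (auto simp: lambda_I_degree_def lambda_I_eq_flat_germs)
  qed
qed

lemma internal_direct_sum_degrees:
  assumes V: "openin (Eq_topology q) V" and T: "T \<subseteq> pos_levels P"
  shows "is_internal_direct_sum (lambda_I q P V) T (\<lambda>t. lambda_I_degree q P section_map t V)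
    (germ_of V ` equivariant V T)"
proof -
  have pos: "T \<subseteq> {0<..}" using T by (auto simp: pos_levels_def)
  have "finite T" using T finite_pos_levels by (rule finite_subset)
  moreover have "(\<Pi>\<^sub>E t\<in>T. lambda_I_degree q P section_map t V) = (\<Pi>\<^sub>E t\<in>T. germ_of V ` equivariant V {t})"
    using lambda_I_degree_eq[OF V] pos by (intro PiE_cong) auto
  ultimately show ?thesis
    using internal_direct_sum_levels[OF V _ pos]
    unfolding is_internal_direct_sum_def lambda_I_eq_flat_germs by simp
qed

lemma lambda_I_flat_eq:
  assumes V: "openin (Eq_topology q) V" and "c \<noteq> 0" "t \<ge> 0"
  shows "lambda_I_flat q P c t V = germ_of V ` equivariant V {d \<in> pos_levels P. real_of_int d \<ge> t}"
proof -
  have "lambda_I_flat q P c t V = germ_of V ` equivariant V {d. 0 < d \<and> t \<le> real_of_int d}"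
    unfolding lambda_I_flat_def lambda_I_eq_flat_germs using t_flat_germs[OF assms] .
  also have "equivariant V {d. 0 < d \<and> t \<le> real_of_int d} = equivariant V {d \<in> pos_levels P. real_of_int d \<ge> t}"
    by (rule equivariant_cong) (auto simp: pos_levels_iff)
  finally show ?thesis .
qed

lemma carrier_lambda_I:
  assumes V: "openin (Eq_topology q) V"
  shows "carrier (lambda_I q P V) = germ_of V ` equivariant V (pos_levels P)"
proof -
  have "equivariant V {0<..} = equivariant V (pos_levels P)"
    by (rule equivariant_cong) (auto simp: pos_levels_iff)
  then show ?thesis by (simp add: lambda_I_eq_flat_germs carrier_flat_germs[OF V])
qed

end

section \<open>The filtration by levels of flatness\<close>

theorem proposition4p1:
  fixes q :: complex and P :: "(int \<times> complex mat) list"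
  assumes "norm q > 1"
    and "P \<noteq> []"
    and slopes: "\<And>i j. i < j \<Longrightarrow> j < length P \<Longrightarrow> fst (P ! i) > fst (P ! j)"
    and blocks: "\<And>\<mu> A. (\<mu>, A) \<in> set P \<Longrightarrow>
                   \<exists>r\<ge>1. A \<in> carrier_mat r r \<and> invertible_mat A"
  shows "\<exists>\<phi>. sheaf_module_iso q
               (lambda_I q P) (flat_mats_res q (total_rk P))
               (bundle_sections q (End_pos q P)) (\<lambda>V V' s. restrict s V') \<phi> \<and>
             canonical_section_map q P \<phi> \<and>
             (\<forall>V. openin (Eq_topology q) V \<longrightarrow>
                is_internal_direct_sum (lambda_I q P V) (pos_levels P)
                  (\<lambda>t'. lambda_I_degree q P \<phi> t' V) (carrier (lambda_I q P V)) \<and>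
                (\<forall>c t. c \<noteq> 0 \<longrightarrow> t \<ge> 0 \<longrightarrow>
                   is_internal_direct_sum (lambda_I q P V) {t' \<in> pos_levels P. real_of_int t' \<ge> t}
                     (\<lambda>t'. lambda_I_degree q P \<phi> t' V) (lambda_I_flat q P c t V)))"
proof -
  interpret tamely_irregular q P
    by unfold_locales (use assms in auto)
  show ?thesis
  proof (intro exI[of _ section_map] conjI allI impI)
    fix V assume V: "openin (Eq_topology q) V"
    show "is_internal_direct_sum (lambda_I q P V) (pos_levels P)
        (\<lambda>t'. lambda_I_degree q P section_map t' V) (carrier (lambda_I q P V))"
      unfolding carrier_lambda_I[OF V] by (rule internal_direct_sum_degrees[OF V subset_refl])
    fix c :: complex and t :: real assume "c \<noteq> 0" "t \<ge> 0"
    then show "is_internal_direct_sum (lambda_I q P V) {t' \<in> pos_levels P. real_of_int t' \<ge> t}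
        (\<lambda>t'. lambda_I_degree q P section_map t' V) (lambda_I_flat q P c t V)"
      unfolding lambda_I_flat_eq[OF V \<open>c \<noteq> 0\<close> \<open>t \<ge> 0\<close>] by (intro internal_direct_sum_degrees[OF V]) auto
  qed (rule section_map_iso section_map_canonical)+
qed

end
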